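(* Let $K$ be a field and $\mathcal O$ a finite order ideal of terms in $K[x_1,\dots,x_n]$. There is a projection morphism from $\mathbb A^{|C|}$ to $\mathbb A^{|C\setminus\tilde C|}$ such that its restriction to the border marked scheme $\mathrm{Spec}(K[C]/\mathfrak B)\subset\mathbb A^{|C|}$ of $\mathcal O$ is an isomorphism between the border marked scheme and the Pommaret marked scheme $\mathrm{Spec}(K[C\setminus\tilde C]/\mathfrak P)\subset\mathbb A^{|C\setminus\tilde C|}$ of $\mathcal O$.
   Context: $\mathbb A^{|C|}=\mathrm{Spec}(K[C])$ and $\mathbb A^{|C\setminus\tilde C|}=\mathrm{Spec}(K[C\setminus\tilde C])$, with $C,\tilde C$ as defined below. $\mathbb T$ is the set of terms (monic monomials) in the variables $x_1<\dots<x_n$. For a term $\tau\ne1$, $\min(\tau)$ is the smallest variable dividing $\tau$. An order ideal is a (nonempty) set of terms closed under taking divisors. For a finite order ideal $\mathcal O=\{\sigma_1,\dots,\sigma_\ell\}$, the border is $\partial\mathcal O=\{x_i\tau:\tau\in\mathcal O,\ 1\le i\le n\}\setminus\mathcal O$. Write $\partial\mathcal O=\{\tau_1,\dots,\tau_m\}$, ordered increasingly by degree (terms of equal degree arbitrarily). The Pommaret basis $\mathcal P_{\mathcal O}\subseteq\partial\mathcal O$ is the set of terms $\sigma$ in the ideal $J$ generated by $\mathbb T\setminus\mathcal O$ with $\sigma/\min(\sigma)\notin J$. Generic marked sets: let $C=\{C_{ij}:1\le i\le m,\ 1\le j\le\ell\}$ be new parameters and $b_i=\tau_i-\sum_{j=1}^\ell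 C_{ij}\sigma_j\in K[C][x_1,\dots,x_n]$, with head term $\mathrm{Ht}(b_i)=\tau_i$. Put $\mathscr B=\{b_1,\dots,b_m\}$ (generic $\partial\mathcal O$-marked set), $\mathscr P=\{b_i:\tau_i\in\mathcal P_{\mathcal O}\}$ (generic $\mathcal P_{\mathcal O}$-marked set), and $\tilde C=\{C_{ij}:\tau_i\in\partial\mathcal O\setminus\mathcal P_{\mathcal O}\}$. Multiplicative sets: for the border structure, $\mathcal T_{\tau_i}=\{\mu\in\mathbb T:\tau_j\text{ does not divide }\tau_i\mu\text{ for all }j>i\}$ for $\tau_i\in\partial\mathcal O$; for the Pommaret structure, $\mathcal T_\alpha=\mathbb T\cap K[x_1,\dots,\min(\alpha)]$ for $\alpha\in\mathcal P_{\mathcal O}$. The cone of $\alpha$ is $\{\eta\alpha:\eta\in\mathcal T_\alpha\}$. In each structure, a reduction step replaces a polynomial $g$ by $g-c\,\eta\, b$, where $b$ is in the marked set, $\eta\in\mathcal T_{\mathrm{Ht}(b)}$, and $\eta\,\mathrm{Ht}(b)$ is in the support of $g$ with coefficient $c$. Both reduction relations (finitely many, possibly zero, steps) are Noetherian and confluent, so every polynomial reduces to a unique polynomial supported on $\mathcal O$ (an $\mathcal O$-reduced polynomial). $S(f,f')=\eta f-\eta'f'$, where $\eta\,\mathrm{Ht}(f)=\eta'\,\mathrm{Ht}(f')=\mathrm{lcm}(\mathrm{Ht}(f),\mathrm{Ht}(f'))$. Border marked scheme: a couple $(\alpha,\alpha')$ of border terms is a neighbour couple if $\alpha=x_j\alpha'$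 for some $j$ or $x_i\alpha=x_j\alpha'$ for some $i,j$. For each $b_r,b_s\in\mathscr B$ whose head terms form a neighbour couple, let $h_{rs}$ be the $\mathcal O$-reduced polynomial to which $S(b_r,b_s)$ reduces by $\mathscr B$ in the border structure. $\mathfrak B\subset K[C]$ is the ideal generated by all coefficients (with respect to the terms in $x_1,\dots,x_n$) of the $h_{rs}$. The border marked scheme is $\mathrm{Spec}(K[C]/\mathfrak B)$. Pommaret marked scheme: a couple $(\alpha,\alpha')$ in $\mathcal P_{\mathcal O}$ is non-multiplicative if there is a variable $x_i\notin\mathcal T_\alpha$ with $x_i\alpha$ in the cone of $\alpha'$ (Pommaret structure). For each $p_r,p_s\in\mathscr P$ whose head terms form a non-multiplicative couple, let $h'_{rs}$ be the $\mathcal O$-reduced polynomial to which $S(p_r,p_s)$ reduces by $\mathscr P$ in the Pommaret structure. $\mathfrak P\subset K[C\setminus\tilde C]$ is the ideal generated by all coefficients (with respect to the terms in $x_1,\dots,x_n$) of the $h'_{rs}$. The Pommaret marked scheme is $\mathrm{Spec}(K[C\setminus\tilde C]/\mathfrak P)$. *)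

theory Defs
  imports
    "HOL-Library.Poly_Mapping"
    "HOL-Algebra.QuotRing"
    "HOL-Analysis.Abstract_Topology"
begin

section \<open>Ringed spaces and affine schemes\<close>

record ('p, 's) ringed_space =
  space_top :: "'p topology"
  sections :: "'p set \<Rightarrow> 's ring"
  restr :: "'p set \<Rightarrow> 'p set \<Rightarrow> 's \<Rightarrow> 's"  \<comment> \<open>\<open>restr X U V\<close> restricts from \<open>U\<close> to \<open>V\<close>\<close>

text \<open>
  A morphism from \<open>X\<close> to \<open>Y\<close> consists of a map on points and, for every open set \<open>V\<close> of \<open>Y\<close>,
  a map from the sections of \<open>Y\<close> over \<open>V\<close> to the sections of \<open>X\<close> over the preimage of \<open>V\<close>.
  All these maps are kept extensional, so that equality of morphisms is equality in HOL.
\<close>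

record ('p, 's, 'q, 't) space_mor =
  on_points :: "'p \<Rightarrow> 'q"
  on_sections :: "'q set \<Rightarrow> 't \<Rightarrow> 's"

definition preimg :: "('p, 's) ringed_space \<Rightarrow> ('p \<Rightarrow> 'q) \<Rightarrow> 'q set \<Rightarrow> 'p set" where
  "preimg X f V = {x \<in> topspace (space_top X). f x \<in> V}"

text \<open>
  The germ at \<open>x\<close> of a section \<open>s\<close> over \<open>V\<close> is a unit of the stalk at \<open>x\<close>: the stalk being the
  direct limit over the open neighbourhoods of \<open>x\<close>, this says that \<open>s\<close> becomes a unit on one of them.
\<close>

definition germ_is_unit :: "('p, 's) ringed_space \<Rightarrow> 'p \<Rightarrow> 'p set \<Rightarrow> 's \<Rightarrow> bool" where
  "germ_is_unit X x V s \<longleftrightarrow>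
     (\<exists>W. openin (space_top X) W \<and> x \<in> W \<and> W \<subseteq> V \<and> restr X V W s \<in> Units (sections X W))"

text \<open>
  Morphisms of locally ringed spaces. The last conjunct says that the induced homomorphisms on
  stalks are local, i.e. reflect units.
\<close>

definition lrs_morphism ::
  "('p, 's) ringed_space \<Rightarrow> ('q, 't) ringed_space \<Rightarrow> ('p, 's, 'q, 't) space_mor \<Rightarrow> bool" where
  "lrs_morphism X Y f \<longleftrightarrow>
     continuous_map (space_top X) (space_top Y) (on_points f) \<and>
     on_points f \<in> extensional (topspace (space_top X)) \<and>
     on_sections f \<in> extensional {V. openin (space_top Y) V} \<and>
     (\<forall>V. openin (space_top Y) V \<longrightarrow>
        on_sections f V \<in> ring_hom (sections Y V) (sections X (preimg X (on_points f) V)) \<and>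
        on_sections f V \<in> extensional (carrier (sections Y V))) \<and>
     (\<forall>U V. openin (space_top Y) U \<longrightarrow> openin (space_top Y) V \<longrightarrow> V \<subseteq> U \<longrightarrow>
        (\<forall>s \<in> carrier (sections Y U).
           on_sections f V (restr Y U V s) =
           restr X (preimg X (on_points f) U) (preimg X (on_points f) V) (on_sections f U s))) \<and>
     (\<forall>V. openin (space_top Y) V \<longrightarrow>
        (\<forall>x \<in> preimg X (on_points f) V. \<forall>s \<in> carrier (sections Y V).
           germ_is_unit X x (preimg X (on_points f) V) (on_sections f V s) \<longrightarrow>
           germ_is_unit Y (on_points f x) V s))"

definition lrs_id :: "('p, 's) ringed_space \<Rightarrow> ('p, 's, 'p, 's) space_mor" where
  "lrs_id X =
     \<lparr>on_points = (\<lambda>x \<in> topspace (space_top X). x),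
      on_sections = (\<lambda>U \<in> {U. openin (space_top X) U}. \<lambda>s \<in> carrier (sections X U). s)\<rparr>"

text \<open>The composite of \<open>f\<close> from \<open>X\<close> to \<open>Y\<close> and \<open>g\<close> from \<open>Y\<close> to \<open>Z\<close>.\<close>

definition lrs_comp ::
  "('p, 's) ringed_space \<Rightarrow> ('q, 't) ringed_space \<Rightarrow> ('r, 'u) ringed_space \<Rightarrow>
   ('q, 't, 'r, 'u) space_mor \<Rightarrow> ('p, 's, 'q, 't) space_mor \<Rightarrow> ('p, 's, 'r, 'u) space_mor" where
  "lrs_comp X Y Z g f =
     \<lparr>on_points = (\<lambda>x \<in> topspace (space_top X). on_points g (on_points f x)),
      on_sections = (\<lambda>W \<in> {W. openin (space_top Z) W}. \<lambda>s \<in> carrier (sections Z W).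
         on_sections f (preimg Y (on_points g) W) (on_sections g W s))\<rparr>"

definition lrs_isomorphism ::
  "('p, 's) ringed_space \<Rightarrow> ('q, 't) ringed_space \<Rightarrow> ('p, 's, 'q, 't) space_mor \<Rightarrow> bool" where
  "lrs_isomorphism X Y f \<longleftrightarrow>
     lrs_morphism X Y f \<and>
     (\<exists>g. lrs_morphism Y X g \<and> lrs_comp X Y X g f = lrs_id X \<and> lrs_comp Y X Y f g = lrs_id Y)"

definition spectrum :: "'a ring \<Rightarrow> 'a set set" where
  "spectrum R = {p. primeideal p R}"

definition zariski :: "'a ring \<Rightarrow> 'a set topology" where
  "zariski R = topology (\<lambda>U. \<exists>S \<subseteq> carrier R. U = {p \<in> spectrum R. \<not> S \<subseteq> p})"

lemma openin_zariski:
  "openin (zariski R) U \<longleftrightarrow> (\<exists>S \<subseteq> carrier R. U = {p \<in> spectrum R. \<not> S \<subseteq> p})"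
proof -
  let ?P = "\<lambda>U. \<exists>S \<subseteq> carrier R. U = {p \<in> spectrum R. \<not> S \<subseteq> p}"
  have "?P (U \<inter> V)" if "?P U" "?P V" for U V
  proof -
    from that obtain S T where S: "S \<subseteq> carrier R" "U = {p \<in> spectrum R. \<not> S \<subseteq> p}"
      and T: "T \<subseteq> carrier R" "V = {p \<in> spectrum R. \<not> T \<subseteq> p}"
      by auto
    define ST where "ST = {s \<otimes>\<^bsub>R\<^esub> t |s t. s \<in> S \<and> t \<in> T} \<inter> carrier R"
    have ST: "ST \<subseteq> p \<longleftrightarrow> S \<subseteq> p \<or> T \<subseteq> p" if "p \<in> spectrum R" for p
    proof -
      interpret primeideal p R
        using that by (simp add: spectrum_def)
      show ?thesis
      proof
        assume *: "ST \<subseteq> p"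
        show "S \<subseteq> p \<or> T \<subseteq> p"
        proof (rule ccontr)
          assume "\<not> (S \<subseteq> p \<or> T \<subseteq> p)"
          then obtain s t where st: "s \<in> S" "s \<notin> p" "t \<in> T" "t \<notin> p"
            by blast
          with S T have c: "s \<in> carrier R" "t \<in> carrier R"
            by auto
          with st * have "s \<otimes>\<^bsub>R\<^esub> t \<in> p"
            unfolding ST_def by blast
          with I_prime c st show False
            by blast
        qed
      next
        assume "S \<subseteq> p \<or> T \<subseteq> p"
        with S(1) T(1) show "ST \<subseteq> p"
          by (auto simp: ST_def subset_iff I_l_closed I_r_closed)
      qed
    qed
    have "U \<inter> V = {p \<in> spectrum R. \<not> ST \<subseteq> p}"
      unfolding S(2) T(2) by (intro Set.set_eqI) (use ST in auto)
    moreover have "ST \<subseteq> carrier R"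
      by (simp add: ST_def)
    ultimately show ?thesis
      by (intro exI[of _ ST]) simp
  qed
  moreover have "?P (\<Union>\<U>)" if "\<forall>U\<in>\<U>. ?P U" for \<U>
  proof -
    from that obtain S where S: "\<And>U. U \<in> \<U> \<Longrightarrow> S U \<subseteq> carrier R \<and> U = {p \<in> spectrum R. \<not> S U \<subseteq> p}"
      by metis
    have "p \<in> \<Union>\<U> \<longleftrightarrow> p \<in> {p \<in> spectrum R. \<not> \<Union>(S ` \<U>) \<subseteq> p}" for p
    proof -
      have "p \<in> U \<longleftrightarrow> p \<in> spectrum R \<and> \<not> S U \<subseteq> p" if "U \<in> \<U>" for U
        using S[OF that] by blast
      then show ?thesis
        by blast
    qed
    then have "\<Union>\<U> = {p \<in> spectrum R. \<not> \<Union>(S ` \<U>) \<subseteq> p}"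
      by blast
    moreover have "\<Union>(S ` \<U>) \<subseteq> carrier R"
      using S by blast
    ultimately show ?thesis
      by blast
  qed
  ultimately have "istopology ?P"
    unfolding istopology_def by blast
  then show ?thesis
    by (simp add: zariski_def topology_inverse')
qed

text \<open>The fraction \<open>a / s\<close> in the localization of \<open>R\<close> at the prime ideal \<open>p\<close>.\<close>

definition frac_at :: "'a ring \<Rightarrow> 'a set \<Rightarrow> 'a \<Rightarrow> 'a \<Rightarrow> ('a \<times> 'a) set" where
  "frac_at R p a s =
     {(b, t). b \<in> carrier R \<and> t \<in> carrier R - p \<and>
       (\<exists>u \<in> carrier R - p. u \<otimes>\<^bsub>R\<^esub> (a \<otimes>\<^bsub>R\<^esub> t) = u \<otimes>\<^bsub>R\<^esub> (b \<otimes>\<^bsub>R\<^esub> s))}"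

definition local_ring_at :: "'a ring \<Rightarrow> 'a set \<Rightarrow> ('a \<times> 'a) set ring" where
  "local_ring_at R p =
     \<lparr>carrier = {frac_at R p a s |a s. a \<in> carrier R \<and> s \<in> carrier R - p},
      mult = (\<lambda>x y. \<Union>(a, s)\<in>x. \<Union>(b, t)\<in>y. frac_at R p (a \<otimes>\<^bsub>R\<^esub> b) (s \<otimes>\<^bsub>R\<^esub> t)),
      one = frac_at R p \<one>\<^bsub>R\<^esub> \<one>\<^bsub>R\<^esub>,
      zero = frac_at R p \<zero>\<^bsub>R\<^esub> \<one>\<^bsub>R\<^esub>,
      add = (\<lambda>x y. \<Union>(a, s)\<in>x. \<Union>(b, t)\<in>y.
               frac_at R p (a \<otimes>\<^bsub>R\<^esub> t \<oplus>\<^bsub>R\<^esub> b \<otimes>\<^bsub>R\<^esub> s) (s \<otimes>\<^bsub>R\<^esub> t))\<rparr>"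

text \<open>
  Sections of the structure sheaf over \<open>U\<close>: functions into the local rings which are locally
  given by a fraction.
\<close>

definition structure_sheaf :: "'a ring \<Rightarrow> 'a set set \<Rightarrow> ('a set \<Rightarrow> ('a \<times> 'a) set) ring" where
  "structure_sheaf R U =
     \<lparr>carrier = {f \<in> (\<Pi>\<^sub>E p\<in>U. carrier (local_ring_at R p)).
        \<forall>p\<in>U. \<exists>V. openin (zariski R) V \<and> p \<in> V \<and> V \<subseteq> U \<and>
          (\<exists>a\<in>carrier R. \<exists>s\<in>carrier R. \<forall>q\<in>V. s \<notin> q \<and> f q = frac_at R q a s)},
      mult = (\<lambda>f g. \<lambda>p\<in>U. f p \<otimes>\<^bsub>local_ring_at R p\<^esub> g p),
      one = (\<lambda>p\<in>U. \<one>\<^bsub>local_ring_at R p\<^esub>),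
      zero = (\<lambda>p\<in>U. \<zero>\<^bsub>local_ring_at R p\<^esub>),
      add = (\<lambda>f g. \<lambda>p\<in>U. f p \<oplus>\<^bsub>local_ring_at R p\<^esub> g p)\<rparr>"

definition Spec :: "'a ring \<Rightarrow> ('a set, 'a set \<Rightarrow> ('a \<times> 'a) set) ringed_space" where
  "Spec R =
     \<lparr>space_top = zariski R, sections = structure_sheaf R, restr = (\<lambda>U V f. restrict f V)\<rparr>"

text \<open>The morphism from \<open>Spec S\<close> to \<open>Spec R\<close> induced by a ring homomorphism \<open>\<phi>\<close> from \<open>R\<close> to \<open>S\<close>.\<close>

definition contract :: "'a ring \<Rightarrow> ('a \<Rightarrow> 'b) \<Rightarrow> 'b set \<Rightarrow> 'a set" where
  "contract R \<phi> q = {a \<in> carrier R. \<phi> a \<in> q}"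

definition local_hom_at :: "'b ring \<Rightarrow> ('a \<Rightarrow> 'b) \<Rightarrow> 'b set \<Rightarrow> ('a \<times> 'a) set \<Rightarrow> ('b \<times> 'b) set" where
  "local_hom_at S \<phi> q x = (\<Union>(a, s)\<in>x. frac_at S q (\<phi> a) (\<phi> s))"

definition Spec_map ::
  "'a ring \<Rightarrow> 'b ring \<Rightarrow> ('a \<Rightarrow> 'b) \<Rightarrow>
   ('b set, 'b set \<Rightarrow> ('b \<times> 'b) set, 'a set, 'a set \<Rightarrow> ('a \<times> 'a) set) space_mor" where
  "Spec_map R S \<phi> =
     \<lparr>on_points = (\<lambda>q\<in>spectrum S. contract R \<phi> q),
      on_sections = (\<lambda>U \<in> {U. openin (zariski R) U}. \<lambda>f \<in> carrier (structure_sheaf R U).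
         \<lambda>q \<in> {q \<in> spectrum S. contract R \<phi> q \<in> U}. local_hom_at S \<phi> q (f (contract R \<phi> q)))\<rparr>"

text \<open>The embedding of the closed subscheme \<open>Spec (R / I)\<close> into \<open>Spec R\<close>.\<close>

definition closed_embedding ::
  "'a ring \<Rightarrow> 'a set \<Rightarrow>
   ('a set set, 'a set set \<Rightarrow> ('a set \<times> 'a set) set, 'a set, 'a set \<Rightarrow> ('a \<times> 'a) set) space_mor" where
  "closed_embedding R I = Spec_map R (R Quot I) (\<lambda>a. I +>\<^bsub>R\<^esub> a)"

section \<open>Affine spaces\<close>

text \<open>
  The polynomial ring over the field \<open>'k\<close> in the variables from the set \<open>V\<close>, as a subring of
  the type of polynomials in variables of type \<open>'v\<close> (monomials are exponent functions).
\<close>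

definition poly_ring :: "'v set \<Rightarrow> (('v \<Rightarrow>\<^sub>0 nat) \<Rightarrow>\<^sub>0 'k::field) ring" where
  "poly_ring V =
     \<lparr>carrier = {p. \<forall>t \<in> Poly_Mapping.keys p. Poly_Mapping.keys t \<subseteq> V},
      mult = (*), one = 1, zero = 0, add = (+)\<rparr>"

definition affine_space ::
  "'v set \<Rightarrow> (_, (('v \<Rightarrow>\<^sub>0 nat) \<Rightarrow>\<^sub>0 'k::field) set \<Rightarrow> _) ringed_space" where
  "affine_space V = Spec (poly_ring V :: (('v \<Rightarrow>\<^sub>0 nat) \<Rightarrow>\<^sub>0 'k) ring)"

text \<open>
  The projection of affine spaces which forgets the coordinates outside \<open>W\<close>; on coordinate
  rings it is the inclusion of polynomial rings.
\<close>

definition projection_morphism ::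
  "'v set \<Rightarrow> 'v set \<Rightarrow>
   (_, (('v \<Rightarrow>\<^sub>0 nat) \<Rightarrow>\<^sub>0 'k::field) set \<Rightarrow> _, _, (('v \<Rightarrow>\<^sub>0 nat) \<Rightarrow>\<^sub>0 'k) set \<Rightarrow> _) space_mor \<Rightarrow> bool" where
  "projection_morphism V W \<pi> \<longleftrightarrow>
     W \<subseteq> V \<and> lrs_morphism (affine_space V) (affine_space W) \<pi> \<and>
     \<pi> = Spec_map (poly_ring W) (poly_ring V) (\<lambda>p. p)"

section \<open>Terms and order ideals\<close>

text \<open>
  Terms in the variables \<open>x\<^sub>1 < \<dots> < x\<^sub>n\<close> are exponent functions on a finite linearly ordered
  type with \<open>n\<close> elements; the product of terms is \<open>+\<close> and the term \<open>1\<close> is \<open>0\<close>. The difference of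
  terms is truncated, and it is the quotient whenever the second term divides the first one.
\<close>

type_synonym 'x pterm = "'x \<Rightarrow>\<^sub>0 nat"

definition var :: "'x \<Rightarrow> 'x pterm" where
  "var x = Poly_Mapping.single x 1"

definition term_dvd :: "'x pterm \<Rightarrow> 'x pterm \<Rightarrow> bool" where
  "term_dvd \<alpha> \<beta> \<longleftrightarrow> (\<exists>\<gamma>. \<beta> = \<gamma> + \<alpha>)"

definition term_deg :: "'x::finite pterm \<Rightarrow> nat" where
  "term_deg \<alpha> = (\<Sum>x\<in>UNIV. Poly_Mapping.lookup \<alpha> x)"

definition min_var :: "'x::linorder pterm \<Rightarrow> 'x" where
  "min_var \<alpha> = Min (Poly_Mapping.keys \<alpha>)"

text \<open>By truncation, the exponents of this term are the maxima of those of \<open>\<alpha>\<close> and \<open>\<beta>\<close>.\<close>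

definition term_lcm :: "'x pterm \<Rightarrow> 'x pterm \<Rightarrow> 'x pterm" where
  "term_lcm \<alpha> \<beta> = \<alpha> + (\<beta> - \<alpha>)"

definition order_ideal :: "'x pterm set \<Rightarrow> bool" where
  "order_ideal \<O> \<longleftrightarrow> \<O> \<noteq> {} \<and> (\<forall>\<tau>\<in>\<O>. \<forall>\<sigma>. term_dvd \<sigma> \<tau> \<longrightarrow> \<sigma> \<in> \<O>)"

definition border :: "'x pterm set \<Rightarrow> 'x pterm set" where
  "border \<O> = {var x + \<tau> |x \<tau>. \<tau> \<in> \<O>} - \<O>"

text \<open>
  The terms in the monomial ideal generated by the terms outside \<open>\<O>\<close>; a term lies in a monomial
  ideal iff it is a multiple of one of the generators.
\<close>

definition complement_ideal :: "'x pterm set \<Rightarrow> 'x pterm set" where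
  "complement_ideal \<O> = {\<eta> + \<tau> |\<eta> \<tau>. \<tau> \<notin> \<O>}"

definition pommaret_basis :: "'x::linorder pterm set \<Rightarrow> 'x pterm set" where
  "pommaret_basis \<O> =
     {\<sigma> \<in> complement_ideal \<O>. \<sigma> - var (min_var \<sigma>) \<notin> complement_ideal \<O>}"

definition pommaret_mult :: "'x::linorder pterm \<Rightarrow> 'x pterm set" where
  "pommaret_mult \<alpha> = {\<mu>. Poly_Mapping.keys \<mu> \<subseteq> {..min_var \<alpha>}}"

definition pommaret_cone :: "'x::linorder pterm \<Rightarrow> 'x pterm set" where
  "pommaret_cone \<alpha> = {\<eta> + \<alpha> |\<eta>. \<eta> \<in> pommaret_mult \<alpha>}"

text \<open>Here \<open>\<tau> 1, \<dots>, \<tau> m\<close> enumerate the border.\<close>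

definition border_mult :: "(nat \<Rightarrow> 'x pterm) \<Rightarrow> nat \<Rightarrow> nat \<Rightarrow> 'x pterm set" where
  "border_mult \<tau> m i = {\<mu>. \<forall>j\<in>{i<..m}. \<not> term_dvd (\<tau> j) (\<tau> i + \<mu>)}"

definition neighbour_couple :: "'x pterm \<Rightarrow> 'x pterm \<Rightarrow> bool" where
  "neighbour_couple \<alpha> \<alpha>' \<longleftrightarrow>
     (\<exists>x. \<alpha> = var x + \<alpha>') \<or> (\<exists>x y. var x + \<alpha> = var y + \<alpha>')"

definition nonmult_couple :: "'x::linorder pterm \<Rightarrow> 'x pterm \<Rightarrow> bool" where
  "nonmult_couple \<alpha> \<alpha>' \<longleftrightarrow>
     (\<exists>x. var x \<notin> pommaret_mult \<alpha> \<and> var x + \<alpha> \<in> pommaret_cone \<alpha>')"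

section \<open>Generic marked sets and reduction\<close>

text \<open>
  Below, \<open>b i\<close> for \<open>i \<in> I\<close> are marked polynomials with coefficients in a ring \<open>'r\<close> and with head
  terms \<open>\<tau> i\<close>, and \<open>T i\<close> is the multiplicative set of \<open>b i\<close>.
\<close>

definition reduction_step ::
  "nat set \<Rightarrow> (nat \<Rightarrow> 'x pterm) \<Rightarrow> (nat \<Rightarrow> 'x pterm set) \<Rightarrow> (nat \<Rightarrow> 'x pterm \<Rightarrow>\<^sub>0 'r::comm_ring_1) \<Rightarrow>
   ('x pterm \<Rightarrow>\<^sub>0 'r) \<Rightarrow> ('x pterm \<Rightarrow>\<^sub>0 'r) \<Rightarrow> bool" where
  "reduction_step I \<tau> T b g g' \<longleftrightarrow>
     (\<exists>i\<in>I. \<exists>\<eta>\<in>T i. \<eta> + \<tau> i \<in> Poly_Mapping.keys g \<and>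
        g' = g - Poly_Mapping.single \<eta> (Poly_Mapping.lookup g (\<eta> + \<tau> i)) * b i)"

text \<open>
  The \<open>\<O>\<close>-reduced polynomial to which \<open>g\<close> reduces; it exists and is unique because the two
  reduction relations to which this is applied are Noetherian and confluent.
\<close>

definition reduced_form ::
  "'x pterm set \<Rightarrow> nat set \<Rightarrow> (nat \<Rightarrow> 'x pterm) \<Rightarrow> (nat \<Rightarrow> 'x pterm set) \<Rightarrow>
   (nat \<Rightarrow> 'x pterm \<Rightarrow>\<^sub>0 'r::comm_ring_1) \<Rightarrow> ('x pterm \<Rightarrow>\<^sub>0 'r) \<Rightarrow> ('x pterm \<Rightarrow>\<^sub>0 'r)" where
  "reduced_form \<O> I \<tau> T b g =
     (THE h. Poly_Mapping.keys h \<subseteq> \<O> \<and> (reduction_step I \<tau> T b)\<^sup>*\<^sup>* g h)"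

definition S_poly ::
  "(nat \<Rightarrow> 'x pterm) \<Rightarrow> (nat \<Rightarrow> 'x pterm \<Rightarrow>\<^sub>0 'r::comm_ring_1) \<Rightarrow> nat \<Rightarrow> nat \<Rightarrow> ('x pterm \<Rightarrow>\<^sub>0 'r)" where
  "S_poly \<tau> b r s =
     Poly_Mapping.single (term_lcm (\<tau> r) (\<tau> s) - \<tau> r) 1 * b r -
     Poly_Mapping.single (term_lcm (\<tau> r) (\<tau> s) - \<tau> s) 1 * b s"

definition coeff_set :: "('x pterm \<Rightarrow>\<^sub>0 'r::zero) \<Rightarrow> 'r set" where
  "coeff_set h = Poly_Mapping.lookup h ` Poly_Mapping.keys h"

text \<open>
  The parameters \<open>C\<^sub>i\<^sub>j\<close> are the variables with index \<open>(i, j)\<close>. The order ideal \<open>\<O>\<close> is enumerated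
  by \<open>\<sigma> 1, \<dots>, \<sigma> l\<close> and its border by \<open>\<tau> 1, \<dots>, \<tau> m\<close>.
\<close>

type_synonym 'k param_poly = "(nat \<times> nat \<Rightarrow>\<^sub>0 nat) \<Rightarrow>\<^sub>0 'k"

definition param :: "nat \<Rightarrow> nat \<Rightarrow> 'k::field param_poly" where
  "param i j = Poly_Mapping.single (Poly_Mapping.single (i, j) 1) 1"

definition generic_poly ::
  "(nat \<Rightarrow> 'x pterm) \<Rightarrow> nat \<Rightarrow> (nat \<Rightarrow> 'x pterm) \<Rightarrow> nat \<Rightarrow> ('x pterm \<Rightarrow>\<^sub>0 'k::field param_poly)" where
  "generic_poly \<sigma> l \<tau> i =
     Poly_Mapping.single (\<tau> i) 1 - (\<Sum>j\<in>{1..l}. Poly_Mapping.single (\<sigma> j) (param i j))"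

definition border_params :: "nat \<Rightarrow> nat \<Rightarrow> (nat \<times> nat) set" where
  "border_params l m = {1..m} \<times> {1..l}"

definition pommaret_indices ::
  "'x::linorder pterm set \<Rightarrow> (nat \<Rightarrow> 'x pterm) \<Rightarrow> nat \<Rightarrow> nat set" where
  "pommaret_indices \<O> \<tau> m = {i \<in> {1..m}. \<tau> i \<in> pommaret_basis \<O>}"

text \<open>The parameters which do not occur in the generic Pommaret marked set.\<close>

definition extra_params ::
  "'x::linorder pterm set \<Rightarrow> nat \<Rightarrow> (nat \<Rightarrow> 'x pterm) \<Rightarrow> nat \<Rightarrow> (nat \<times> nat) set" where
  "extra_params \<O> l \<tau> m =
     {(i, j) \<in> border_params l m. \<tau> i \<in> border \<O> - pommaret_basis \<O>}"

definition border_ideal ::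
  "'x pterm set \<Rightarrow> (nat \<Rightarrow> 'x pterm) \<Rightarrow> nat \<Rightarrow> (nat \<Rightarrow> 'x pterm) \<Rightarrow> nat \<Rightarrow> 'k::field param_poly set" where
  "border_ideal \<O> \<sigma> l \<tau> m =
     (let b = generic_poly \<sigma> l \<tau> in
      genideal (poly_ring (border_params l m))
        (\<Union>{coeff_set (reduced_form \<O> {1..m} \<tau> (border_mult \<tau> m) b (S_poly \<tau> b r s)) |r s.
             r \<in> {1..m} \<and> s \<in> {1..m} \<and> neighbour_couple (\<tau> r) (\<tau> s)}))"

definition pommaret_ideal ::
  "'x::linorder pterm set \<Rightarrow> (nat \<Rightarrow> 'x pterm) \<Rightarrow> nat \<Rightarrow> (nat \<Rightarrow> 'x pterm) \<Rightarrow> nat \<Rightarrow>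
   'k::field param_poly set" where
  "pommaret_ideal \<O> \<sigma> l \<tau> m =
     (let b = generic_poly \<sigma> l \<tau>; I = pommaret_indices \<O> \<tau> m in
      genideal (poly_ring (border_params l m - extra_params \<O> l \<tau> m))
        (\<Union>{coeff_set (reduced_form \<O> I \<tau> (\<lambda>i. pommaret_mult (\<tau> i)) b (S_poly \<tau> b r s)) |r s.
             r \<in> I \<and> s \<in> I \<and> nonmult_couple (\<tau> r) (\<tau> s)}))"

end

theory Submission
  imports Defs "HOL-Library.Multiset"
begin

text \<open>
  The two schemes are the spectra of \<open>K[C] / \<BB>\<close> and \<open>K[C'] / \<PP>\<close>, where \<open>C'\<close> consists of the parameters
  of the Pommaret marked set. The isomorphism exists because the remaining parameters are determined
  modulo \<open>\<BB>\<close> by those in \<open>C'\<close>: the inclusion of \<open>K[C']\<close> into \<open>K[C]\<close> and a substitution \<open>force\<close> in the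
  opposite direction respect the two ideals and are inverse to each other modulo them. The spectrum
  is functorial, so they induce an isomorphism over the projection of affine spaces
  (\<open>Spec_quotient_isomorphism\<close>).
  
  All the algebra rests on one property, shared by both structures: if an \<open>\<O>\<close>-reduced polynomial lies in
  the ideal generated by the marked set, then all of its coefficients lie in the ideal generated by the
  coefficients of the reduced S-polynomials (\<open>reduced_in_border_ideal\<close>, \<open>reduced_in_pommaret_ideal\<close>).
  Moreover a polynomial and its reduced form differ by an element of the ideal generated by the
  marked set (\<open>diff_nf_in_span\<close>). Three consequences follow.
  
  \<^item> A generator of \<open>\<PP>\<close> is a coefficient of the reduced form of an S-polynomial of the Pommaret marked
    set. This reduced form lies in the ideal generated by the border marked set, so \<open>\<PP> \<subseteq> \<BB>\<close>.
  \<^item> If the border term \<open>\<tau>\<^sub>i\<close> reduces to \<open>h\<close> by the Pommaret marked set, then the tail of \<open>b\<^sub>i\<close> minus \<open>h\<close> is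
    \<open>\<O>\<close>-reduced and lies in the ideal generated by the border marked set. Hence modulo \<open>\<BB>\<close> the parameter
    \<open>C\<^sub>i\<^sub>j\<close> equals the coefficient of \<open>h\<close> at \<open>\<sigma>\<^sub>j\<close>, a polynomial in the parameters \<open>C'\<close>: its forced value.
  \<^item> Substituting the forced values turns \<open>b\<^sub>i\<close> into \<open>\<tau>\<^sub>i - h\<close>, which is in the ideal generated by the
    Pommaret marked set. So it turns reduced S-polynomials of the border marked set into
    \<open>\<O>\<close>-reduced elements of that ideal, and maps \<open>\<BB>\<close> into \<open>\<PP>\<close>.
  
  For the border structure, the shared property holds because the S-polynomials of neighbours express
  that the multiplications by the variables on the span of \<open>\<O>\<close> commute modulo \<open>\<BB>\<close>. They make this
  span a module over the polynomial ring, in which every \<open>b\<^sub>i\<close> acts as zero and an \<open>\<O>\<close>-reduced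
  polynomial maps \<open>1\<close> to itself. For the Pommaret structure, all monomial multiples of marked
  polynomials reduce to zero modulo \<open>\<PP>\<close>, by induction on the multiplier in the lexicographic order:
  the S-polynomial of a non-multiplicative couple rewrites a non-multiplicative multiple in terms of
  multiples with smaller multipliers (\<open>multiples_reduce\<close>).
\<close>

section \<open>Spectra and the morphisms induced by ring homomorphisms\<close>

lemma topspace_zariski: "cring R \<Longrightarrow> topspace (zariski R) = spectrum R"
proof -
  assume "cring R"
  then interpret R: cring R .
  have "openin (zariski R) (spectrum R)"
    unfolding openin_zariski
    by (rule exI[of _ "{\<one>\<^bsub>R\<^esub>}"])
      (auto simp: spectrum_def dest: ideal.one_imp_carrier[OF primeideal.axioms(1)]
         primeideal.I_notcarr)
  moreover have "U \<subseteq> spectrum R" if "openin (zariski R) U" for U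
    using that by (auto simp: openin_zariski)
  ultimately show ?thesis
    by (auto simp: topspace_def)
qed

text \<open>
  Fractions and spectra are defined for rings without additional record fields; the locale restricts
  prime ideals to such rings.
\<close>

locale prime_at = primeideal I R for I and R :: "'a ring" (structure)
begin

lemma frac_at_iff:
  "(b, t) \<in> frac_at R I a s \<longleftrightarrow> b \<in> carrier R \<and> t \<in> carrier R - I \<and>
     (\<exists>u \<in> carrier R - I. u \<otimes> (a \<otimes> t) = u \<otimes> (b \<otimes> s))"
  by (simp add: frac_at_def)

lemma nonmembers_mult: "s \<in> carrier R - I \<Longrightarrow> t \<in> carrier R - I \<Longrightarrow> s \<otimes> t \<in> carrier R - I"
  using I_prime by blast

lemma one_nonmember: "\<one> \<in> carrier R - I"
  using I_notcarr one_imp_carrier by auto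

lemma frac_at_self:
  assumes "a \<in> carrier R" "s \<in> carrier R - I"
  shows "(a, s) \<in> frac_at R I a s"
  using assms one_nonmember by (auto simp: frac_at_iff)

lemma frac_at_sym:
  assumes "(b, t) \<in> frac_at R I a s" "a \<in> carrier R" "s \<in> carrier R - I"
  shows "(a, s) \<in> frac_at R I b t"
  using assms unfolding frac_at_iff by metis

lemma frac_at_trans:
  assumes "(b, t) \<in> frac_at R I a s" "(c, w) \<in> frac_at R I b t"
    and "a \<in> carrier R" "s \<in> carrier R - I"
  shows "(c, w) \<in> frac_at R I a s"
proof -
  from assms obtain u v where u: "u \<in> carrier R - I" "u \<otimes> (a \<otimes> t) = u \<otimes> (b \<otimes> s)"
    and v: "v \<in> carrier R - I" "v \<otimes> (b \<otimes> w) = v \<otimes> (c \<otimes> t)"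
    and bt: "b \<in> carrier R" "t \<in> carrier R - I" and cw: "c \<in> carrier R" "w \<in> carrier R - I"
    unfolding frac_at_iff by blast
  have c: "a \<in> carrier R" "s \<in> carrier R" "b \<in> carrier R" "t \<in> carrier R" "c \<in> carrier R"
    "w \<in> carrier R" "u \<in> carrier R" "v \<in> carrier R"
    using assms u v bt cw by auto
  have "u \<otimes> v \<otimes> t \<otimes> (a \<otimes> w) = v \<otimes> w \<otimes> (u \<otimes> (a \<otimes> t))"
    using c by algebra
  also have "\<dots> = u \<otimes> s \<otimes> (v \<otimes> (b \<otimes> w))"
    unfolding u(2) using c by algebra
  also have "\<dots> = u \<otimes> v \<otimes> t \<otimes> (c \<otimes> s)"
    unfolding v(2) using c by algebra
  finally show ?thesis
    using cw u v bt nonmembers_mult unfolding frac_at_iff by blast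
qed

lemma frac_at_eq_iff:
  assumes "a \<in> carrier R" "s \<in> carrier R - I" "b \<in> carrier R" "t \<in> carrier R - I"
  shows "frac_at R I a s = frac_at R I b t \<longleftrightarrow>
    (\<exists>u \<in> carrier R - I. u \<otimes> (a \<otimes> t) = u \<otimes> (b \<otimes> s))" (is "?L \<longleftrightarrow> ?R")
proof
  assume ?L
  then have "(b, t) \<in> frac_at R I a s"
    using frac_at_self assms by simp
  then show ?R
    by (simp add: frac_at_iff)
next
  assume ?R
  then have 1: "(b, t) \<in> frac_at R I a s"
    using assms by (simp add: frac_at_iff)
  have 2: "(a, s) \<in> frac_at R I b t"
    using 1 assms frac_at_sym by blast
  show ?L
    using frac_at_trans[OF 1] frac_at_trans[OF 2] assms by auto
qed

text \<open>
  The operations of a local ring are unions over all pairs representing the arguments. Such a union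
  collapses as soon as its members do not depend on the representatives.
\<close>

lemma UN_frac_at:
  assumes "a \<in> carrier R" "s \<in> carrier R - I"
    and "\<And>b t. (b, t) \<in> frac_at R I a s \<Longrightarrow> F b t = G"
  shows "(\<Union>(b, t)\<in>frac_at R I a s. F b t) = G"
  using frac_at_self[OF assms(1,2)] assms(3) by (auto split: prod.splits)

lemma local_ring_mult:
  assumes "a \<in> carrier R" "s \<in> carrier R - I" "b \<in> carrier R" "t \<in> carrier R - I"
  shows "frac_at R I a s \<otimes>\<^bsub>local_ring_at R I\<^esub> frac_at R I b t = frac_at R I (a \<otimes> b) (s \<otimes> t)"
proof -
  have "frac_at R I (a' \<otimes> b') (s' \<otimes> t') = frac_at R I (a \<otimes> b) (s \<otimes> t)"
    if A: "(a', s') \<in> frac_at R I a s" and B: "(b', t') \<in> frac_at R I b t" for a' s' b' t'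
  proof -
    from A B obtain u v where u: "u \<in> carrier R - I" "u \<otimes> (a \<otimes> s') = u \<otimes> (a' \<otimes> s)"
      and v: "v \<in> carrier R - I" "v \<otimes> (b \<otimes> t') = v \<otimes> (b' \<otimes> t)"
      and c': "a' \<in> carrier R" "s' \<in> carrier R - I" "b' \<in> carrier R" "t' \<in> carrier R - I"
      unfolding frac_at_iff by blast
    have c: "a \<in> carrier R" "s \<in> carrier R" "b \<in> carrier R" "t \<in> carrier R" "a' \<in> carrier R"
      "s' \<in> carrier R" "b' \<in> carrier R" "t' \<in> carrier R" "u \<in> carrier R" "v \<in> carrier R"
      using assms c' u v by auto
    have "u \<otimes> v \<otimes> (a' \<otimes> b' \<otimes> (s \<otimes> t)) = (u \<otimes> (a' \<otimes> s)) \<otimes> (v \<otimes> (b' \<otimes> t))"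
      using c by algebra
    also have "\<dots> = u \<otimes> v \<otimes> (a \<otimes> b \<otimes> (s' \<otimes> t'))"
      unfolding u(2)[symmetric] v(2)[symmetric] using c by algebra
    finally show ?thesis
      using assms c' u v c nonmembers_mult by (subst frac_at_eq_iff) (blast intro: m_closed)+
  qed
  then show ?thesis
    unfolding local_ring_at_def using assms by (simp add: UN_frac_at)
qed

lemma local_ring_add:
  assumes "a \<in> carrier R" "s \<in> carrier R - I" "b \<in> carrier R" "t \<in> carrier R - I"
  shows "frac_at R I a s \<oplus>\<^bsub>local_ring_at R I\<^esub> frac_at R I b t =
    frac_at R I (a \<otimes> t \<oplus> b \<otimes> s) (s \<otimes> t)"
proof -
  have "frac_at R I (a' \<otimes> t' \<oplus> b' \<otimes> s') (s' \<otimes> t') = frac_at R I (a \<otimes> t \<oplus> b \<otimes> s) (s \<otimes> t)"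
    if A: "(a', s') \<in> frac_at R I a s" and B: "(b', t') \<in> frac_at R I b t" for a' s' b' t'
  proof -
    from A B obtain u v where u: "u \<in> carrier R - I" "u \<otimes> (a \<otimes> s') = u \<otimes> (a' \<otimes> s)"
      and v: "v \<in> carrier R - I" "v \<otimes> (b \<otimes> t') = v \<otimes> (b' \<otimes> t)"
      and c': "a' \<in> carrier R" "s' \<in> carrier R - I" "b' \<in> carrier R" "t' \<in> carrier R - I"
      unfolding frac_at_iff by blast
    have c: "a \<in> carrier R" "s \<in> carrier R" "b \<in> carrier R" "t \<in> carrier R" "a' \<in> carrier R"
      "s' \<in> carrier R" "b' \<in> carrier R" "t' \<in> carrier R" "u \<in> carrier R" "v \<in> carrier R"
      using assms c' u v by auto
    have "u \<otimes> v \<otimes> ((a' \<otimes> t' \<oplus> b' \<otimes> s') \<otimes> (s \<otimes> t)) =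
        v \<otimes> t' \<otimes> t \<otimes> (u \<otimes> (a' \<otimes> s)) \<oplus> u \<otimes> s' \<otimes> s \<otimes> (v \<otimes> (b' \<otimes> t))"
      using c by algebra
    also have "\<dots> = u \<otimes> v \<otimes> ((a \<otimes> t \<oplus> b \<otimes> s) \<otimes> (s' \<otimes> t'))"
      unfolding u(2)[symmetric] v(2)[symmetric] using c by algebra
    finally show ?thesis
      using assms c' u v c nonmembers_mult
      by (subst frac_at_eq_iff) (blast intro: m_closed a_closed)+
  qed
  then show ?thesis
    unfolding local_ring_at_def using assms by (simp add: UN_frac_at)
qed

end

lemma carrier_local_ring:
  "carrier (local_ring_at R p) = {frac_at R p a s |a s. a \<in> carrier R \<and> s \<in> carrier R - p}"
  by (simp add: local_ring_at_def)

lemma local_ring_one: "\<one>\<^bsub>local_ring_at R p\<^esub> = frac_at R p \<one>\<^bsub>R\<^esub> \<one>\<^bsub>R\<^esub>"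
  by (simp add: local_ring_at_def)

lemma section_iff:
  "f \<in> carrier (structure_sheaf R U) \<longleftrightarrow>
     f \<in> extensional U \<and> (\<forall>p\<in>U. f p \<in> carrier (local_ring_at R p)) \<and>
     (\<forall>p\<in>U. \<exists>V. openin (zariski R) V \<and> p \<in> V \<and> V \<subseteq> U \<and>
          (\<exists>a\<in>carrier R. \<exists>s\<in>carrier R. \<forall>q\<in>V. s \<notin> q \<and> f q = frac_at R q a s))"
  by (auto simp: structure_sheaf_def PiE_def Pi_def)

lemma structure_sheaf_simps:
  "f \<otimes>\<^bsub>structure_sheaf R U\<^esub> g = (\<lambda>p\<in>U. f p \<otimes>\<^bsub>local_ring_at R p\<^esub> g p)"
  "f \<oplus>\<^bsub>structure_sheaf R U\<^esub> g = (\<lambda>p\<in>U. f p \<oplus>\<^bsub>local_ring_at R p\<^esub> g p)"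
  "\<one>\<^bsub>structure_sheaf R U\<^esub> = (\<lambda>p\<in>U. \<one>\<^bsub>local_ring_at R p\<^esub>)"
  by (simp_all add: structure_sheaf_def)

lemma section_value:
  assumes "f \<in> carrier (structure_sheaf R U)" "p \<in> U"
  obtains a s where "a \<in> carrier R" "s \<in> carrier R - p" "f p = frac_at R p a s"
  using assms unfolding section_iff carrier_local_ring by blast

lemma sectionI:
  assumes ext: "f \<in> extensional U"
    and frac: "\<And>p. p \<in> U \<Longrightarrow> \<exists>V a s. openin (zariski R) V \<and> p \<in> V \<and> V \<subseteq> U \<and>
          a \<in> carrier R \<and> s \<in> carrier R \<and> (\<forall>q\<in>V. s \<notin> q \<and> f q = frac_at R q a s)"
  shows "f \<in> carrier (structure_sheaf R U)"
  unfolding section_iff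
proof (intro conjI ballI ext)
  fix p assume p: "p \<in> U"
  obtain V a s where *: "openin (zariski R) V" "p \<in> V" "V \<subseteq> U" "a \<in> carrier R" "s \<in> carrier R"
    "\<forall>q\<in>V. s \<notin> q \<and> f q = frac_at R q a s"
    using frac[OF p] by (elim exE conjE) (rule that)
  have "s \<notin> p \<and> f p = frac_at R p a s"
    using *(2,6) by (rule bspec[rotated])
  then show "f p \<in> carrier (local_ring_at R p)"
    using *(4,5) unfolding carrier_local_ring by blast
  show "\<exists>V. openin (zariski R) V \<and> p \<in> V \<and> V \<subseteq> U \<and>
      (\<exists>a\<in>carrier R. \<exists>s\<in>carrier R. \<forall>q\<in>V. s \<notin> q \<and> f q = frac_at R q a s)"
    by (rule exI[of _ V], intro conjI bexI[OF _ *(4)] bexI[OF _ *(5)] *)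
qed

text \<open>
  Two sections are simultaneously given by fractions on the intersection of suitable neighbourhoods,
  where their product and sum are again fractions.
\<close>

lemma section_mult_add:
  assumes R: "cring R" and f: "f \<in> carrier (structure_sheaf R U)"
    and g: "g \<in> carrier (structure_sheaf R U)"
  shows "f \<otimes>\<^bsub>structure_sheaf R U\<^esub> g \<in> carrier (structure_sheaf R U)" (is "?m \<in> _")
    and "f \<oplus>\<^bsub>structure_sheaf R U\<^esub> g \<in> carrier (structure_sheaf R U)" (is "?a \<in> _")
proof -
  interpret R: cring R by (fact R)
  have *: "\<exists>V a s b t. openin (zariski R) V \<and> p \<in> V \<and> V \<subseteq> U \<and>
      a \<in> carrier R \<and> s \<in> carrier R \<and> b \<in> carrier R \<and> t \<in> carrier R \<and>
      (\<forall>q\<in>V. s \<in> carrier R - q \<and> t \<in> carrier R - q \<and> f q = frac_at R q a s \<and> g q = frac_at R q b t)"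
    if p: "p \<in> U" for p
  proof -
    obtain W a s where W: "openin (zariski R) W" "p \<in> W" "W \<subseteq> U"
      and as: "a\<in>carrier R" "s\<in>carrier R" "\<forall>q\<in>W. s \<notin> q \<and> f q = frac_at R q a s"
      using p f unfolding section_iff by blast
    obtain X b t where X: "openin (zariski R) X" "p \<in> X" "X \<subseteq> U"
      and bt: "b\<in>carrier R" "t\<in>carrier R" "\<forall>q\<in>X. t \<notin> q \<and> g q = frac_at R q b t"
      using p g unfolding section_iff by blast
    show ?thesis
      by (rule exI[of _ "W \<inter> X"], intro exI[of _ a] exI[of _ s] exI[of _ b] exI[of _ t])
        (use W X as bt in \<open>simp add: openin_Int le_infI1\<close>)
  qed
  show "?m \<in> carrier (structure_sheaf R U)" "?a \<in> carrier (structure_sheaf R U)"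
  proof (rule_tac [!] sectionI)
    fix p assume p: "p \<in> U"
    obtain V a s b t where V: "openin (zariski R) V" "p \<in> V" "V \<subseteq> U"
      and c: "a \<in> carrier R" "s \<in> carrier R" "b \<in> carrier R" "t \<in> carrier R"
      and fg: "\<forall>q\<in>V. s \<in> carrier R - q \<and> t \<in> carrier R - q \<and> f q = frac_at R q a s \<and> g q = frac_at R q b t"
      using *[OF p] by (elim exE conjE) (rule that)
    have 1: "s \<otimes>\<^bsub>R\<^esub> t \<notin> q \<and> ?m q = frac_at R q (a \<otimes>\<^bsub>R\<^esub> b) (s \<otimes>\<^bsub>R\<^esub> t) \<and>
      ?a q = frac_at R q (a \<otimes>\<^bsub>R\<^esub> t \<oplus>\<^bsub>R\<^esub> b \<otimes>\<^bsub>R\<^esub> s) (s \<otimes>\<^bsub>R\<^esub> t)" if q: "q \<in> V" for q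
    proof -
      have "q \<in> spectrum R"
        using q openin_subset[OF V(1)] by (auto simp: topspace_zariski[OF R])
      then interpret q: prime_at q R
        by (simp add: spectrum_def prime_at_def)
      have "q \<in> U" using q V by blast
      moreover have "s \<in> carrier R - q" "t \<in> carrier R - q" "f q = frac_at R q a s"
        "g q = frac_at R q b t"
        using fg q by blast+
      ultimately show ?thesis
        using q.nonmembers_mult[of s t] c(1,3)
        by (simp del: Diff_iff add: structure_sheaf_simps q.local_ring_mult q.local_ring_add) simp
    qed
    show "\<exists>V c d. openin (zariski R) V \<and> p \<in> V \<and> V \<subseteq> U \<and>
        c \<in> carrier R \<and> d \<in> carrier R \<and> (\<forall>q\<in>V. d \<notin> q \<and> ?m q = frac_at R q c d)"
      by (intro exI[of _ V] exI[of _ "a \<otimes>\<^bsub>R\<^esub> b"] exI[of _ "s \<otimes>\<^bsub>R\<^esub> t"]) (use V c 1 in simp)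
    show "\<exists>V c d. openin (zariski R) V \<and> p \<in> V \<and> V \<subseteq> U \<and>
        c \<in> carrier R \<and> d \<in> carrier R \<and> (\<forall>q\<in>V. d \<notin> q \<and> ?a q = frac_at R q c d)"
      by (intro exI[of _ V] exI[of _ "a \<otimes>\<^bsub>R\<^esub> t \<oplus>\<^bsub>R\<^esub> b \<otimes>\<^bsub>R\<^esub> s"] exI[of _ "s \<otimes>\<^bsub>R\<^esub> t"])
        (use V c 1 in simp)
  qed (simp_all add: structure_sheaf_simps)
qed

lemma section_one:
  assumes R: "cring R" and U: "openin (zariski R) U"
  shows "\<one>\<^bsub>structure_sheaf R U\<^esub> \<in> carrier (structure_sheaf R U)"
proof (rule sectionI)
  interpret R: cring R by (fact R)
  have "\<one>\<^bsub>R\<^esub> \<in> carrier R - q" if "q \<in> U" for q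
  proof -
    have "q \<in> spectrum R"
      using that openin_subset[OF U] by (auto simp: topspace_zariski[OF R])
    then show ?thesis
      using prime_at.one_nonmember[of q R] by (simp add: spectrum_def prime_at_def)
  qed
  then show "\<exists>V a s. openin (zariski R) V \<and> p \<in> V \<and> V \<subseteq> U \<and> a \<in> carrier R \<and> s \<in> carrier R \<and>
      (\<forall>q\<in>V. s \<notin> q \<and> \<one>\<^bsub>structure_sheaf R U\<^esub> q = frac_at R q a s)" if "p \<in> U" for p
    using U that
    by (intro exI[of _ U] exI[of _ "\<one>\<^bsub>R\<^esub>"]) (simp add: structure_sheaf_simps local_ring_one)
qed (simp add: structure_sheaf_simps)

lemma section_restrict:
  assumes "f \<in> carrier (structure_sheaf R U)" "V \<subseteq> U" "openin (zariski R) V"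
  shows "restrict f V \<in> carrier (structure_sheaf R V)"
proof -
  have "\<exists>W. openin (zariski R) W \<and> p \<in> W \<and> W \<subseteq> V \<and>
      (\<exists>a\<in>carrier R. \<exists>s\<in>carrier R. \<forall>q\<in>W. s \<notin> q \<and> restrict f V q = frac_at R q a s)"
    if "p \<in> V" for p
  proof -
    from that assms obtain W a s where W: "openin (zariski R) W" "p \<in> W" "W \<subseteq> U"
      and as: "a\<in>carrier R" "s\<in>carrier R" "\<forall>q\<in>W. s \<notin> q \<and> f q = frac_at R q a s"
      unfolding section_iff by blast
    show ?thesis
      using W as assms(3) that by (intro exI[of _ "W \<inter> V"]) auto
  qed
  then show ?thesis
    using assms unfolding section_iff by auto
qed

locale cring_hom =
  fixes R :: "'a ring" and S :: "'b ring" and \<phi>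
  assumes R: "cring R" and S: "cring S" and hom: "\<phi> \<in> ring_hom R S"
begin

sublocale R: cring R by (fact R)
sublocale S: cring S by (fact S)

lemmas hom_simps = ring_hom_closed[OF hom] ring_hom_mult[OF hom] ring_hom_add[OF hom]
  ring_hom_one[OF hom]

lemma contract_spectrum:
  assumes "q \<in> spectrum S"
  shows "contract R \<phi> q \<in> spectrum R"
proof -
  interpret ring_hom_ring R S \<phi>
    using R.ring_axioms S.ring_axioms hom by (intro ring_hom_ringI2)
  show ?thesis
    using primeideal_vimage[OF R.is_cring, of q] assms
    by (simp add: spectrum_def contract_def)
qed

lemma nonmember_contract: "s \<in> carrier R - contract R \<phi> q \<longleftrightarrow> s \<in> carrier R \<and> \<phi> s \<notin> q"
  by (auto simp: contract_def)

lemma local_hom_frac: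
  assumes q: "q \<in> spectrum S" and a: "a \<in> carrier R" and s: "s \<in> carrier R - contract R \<phi> q"
  shows "local_hom_at S \<phi> q (frac_at R (contract R \<phi> q) a s) = frac_at S q (\<phi> a) (\<phi> s)"
proof -
  note D = nonmember_contract[THEN iffD1]
  interpret p: prime_at "contract R \<phi> q" R
    using contract_spectrum[OF q] by (simp add: spectrum_def prime_at_def)
  interpret q: prime_at q S
    using q by (simp add: spectrum_def prime_at_def)
  have "frac_at S q (\<phi> b) (\<phi> t) = frac_at S q (\<phi> a) (\<phi> s)"
    if bt: "(b, t) \<in> frac_at R (contract R \<phi> q) a s" for b t
  proof -
    obtain u where u0: "u \<in> carrier R - contract R \<phi> q"
      and eq: "u \<otimes>\<^bsub>R\<^esub> (a \<otimes>\<^bsub>R\<^esub> t) = u \<otimes>\<^bsub>R\<^esub> (b \<otimes>\<^bsub>R\<^esub> s)"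
      and b: "b \<in> carrier R" and t: "t \<in> carrier R - contract R \<phi> q"
      using bt[unfolded p.frac_at_iff] by (elim conjE bexE) (rule that)
    note u = conjunct1[OF D[OF u0]] conjunct2[OF D[OF u0]]
      and bt' = b conjunct1[OF D[OF t]] conjunct2[OF D[OF t]]
    have "\<phi> u \<otimes>\<^bsub>S\<^esub> (\<phi> b \<otimes>\<^bsub>S\<^esub> \<phi> s) = \<phi> u \<otimes>\<^bsub>S\<^esub> (\<phi> a \<otimes>\<^bsub>S\<^esub> \<phi> t)"
      using arg_cong[OF eq, of \<phi>] a D[OF s] u(1) bt' by (simp add: hom_simps)
    moreover have "\<phi> a \<in> carrier S" "\<phi> b \<in> carrier S" "\<phi> s \<in> carrier S - q"
      "\<phi> t \<in> carrier S - q" "\<phi> u \<in> carrier S - q"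
      using a D[OF s] u bt' hom_simps(1) by simp_all
    ultimately show ?thesis
      by (subst q.frac_at_eq_iff) blast+
  qed
  then show ?thesis
    unfolding local_hom_at_def by (rule p.UN_frac_at[OF a s])
qed

lemma points_Spec_map: "q \<in> spectrum S \<Longrightarrow> on_points (Spec_map R S \<phi>) q = contract R \<phi> q"
  by (simp add: Spec_map_def)

lemma preimg_Spec_map:
  "preimg (Spec S) (on_points (Spec_map R S \<phi>)) V = {q \<in> spectrum S. contract R \<phi> q \<in> V}"
  by (auto simp: preimg_def Spec_def topspace_zariski[OF S] Spec_map_def)

lemma openin_preimg:
  assumes "openin (zariski R) V"
  shows "openin (zariski S) {q \<in> spectrum S. contract R \<phi> q \<in> V}"
proof -
  obtain T where T: "T \<subseteq> carrier R" "V = {p \<in> spectrum R. \<not> T \<subseteq> p}"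
    using assms by (auto simp: openin_zariski)
  have "{q \<in> spectrum S. contract R \<phi> q \<in> V} = {q \<in> spectrum S. \<not> \<phi> ` T \<subseteq> q}"
    using T contract_spectrum by (auto simp: contract_def)
  moreover have "\<phi> ` T \<subseteq> carrier S"
    using T hom_simps by auto
  ultimately show ?thesis
    unfolding openin_zariski by blast
qed

lemma sections_Spec_map:
  assumes "openin (zariski R) V" "f \<in> carrier (structure_sheaf R V)"
  shows "on_sections (Spec_map R S \<phi>) V f =
    (\<lambda>q \<in> {q \<in> spectrum S. contract R \<phi> q \<in> V}. local_hom_at S \<phi> q (f (contract R \<phi> q)))"
  using assms by (simp add: Spec_map_def)

lemma section_pullback:
  assumes V: "openin (zariski R) V" and f: "f \<in> carrier (structure_sheaf R V)"
  shows "on_sections (Spec_map R S \<phi>) V f \<in>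
    carrier (structure_sheaf S {q \<in> spectrum S. contract R \<phi> q \<in> V})"
  unfolding section_iff
proof (intro conjI ballI)
  let ?g = "on_sections (Spec_map R S \<phi>) V f" and ?U = "{q \<in> spectrum S. contract R \<phi> q \<in> V}"
  show "?g \<in> extensional ?U"
    by (simp add: sections_Spec_map[OF V f])
  fix q assume q: "q \<in> ?U"
  obtain a s where "a \<in> carrier R" "s \<in> carrier R - contract R \<phi> q"
    "f (contract R \<phi> q) = frac_at R (contract R \<phi> q) a s"
    using section_value[OF f] q by blast
  then have "?g q = frac_at S q (\<phi> a) (\<phi> s) \<and> \<phi> a \<in> carrier S \<and> \<phi> s \<in> carrier S - q"
    using q hom_simps(1) nonmember_contract local_hom_frac[of q a s]
    by (simp add: sections_Spec_map[OF V f])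
  then show "?g q \<in> carrier (local_ring_at S q)"
    unfolding carrier_local_ring by blast
  obtain W a s where W: "openin (zariski R) W" "contract R \<phi> q \<in> W" "W \<subseteq> V"
    and as: "a \<in> carrier R" "s \<in> carrier R" "\<forall>p\<in>W. s \<notin> p \<and> f p = frac_at R p a s"
    using f q unfolding section_iff by blast
  have "\<forall>r\<in>{r \<in> spectrum S. contract R \<phi> r \<in> W}. \<phi> s \<notin> r \<and> ?g r = frac_at S r (\<phi> a) (\<phi> s)"
  proof
    fix r assume r: "r \<in> {r \<in> spectrum S. contract R \<phi> r \<in> W}"
    then have *: "s \<in> carrier R - contract R \<phi> r" "f (contract R \<phi> r) = frac_at R (contract R \<phi> r) a s"
      using as by auto
    have "?g r = local_hom_at S \<phi> r (f (contract R \<phi> r))"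
      using r W(3) by (auto simp: sections_Spec_map[OF V f])
    also have "\<dots> = frac_at S r (\<phi> a) (\<phi> s)"
      unfolding *(2) using r by (intro local_hom_frac[OF _ as(1) *(1)]) simp
    finally show "\<phi> s \<notin> r \<and> ?g r = frac_at S r (\<phi> a) (\<phi> s)"
      using *(1) nonmember_contract by metis
  qed
  then show "\<exists>V. openin (zariski S) V \<and> q \<in> V \<and> V \<subseteq> ?U \<and>
      (\<exists>a\<in>carrier S. \<exists>s\<in>carrier S. \<forall>r\<in>V. s \<notin> r \<and> ?g r = frac_at S r a s)"
    by (intro exI[of _ "{r \<in> spectrum S. contract R \<phi> r \<in> W}"] conjI
          bexI[of _ "\<phi> s"] bexI[of _ "\<phi> a"] openin_preimg[OF W(1)])
      (use W q as(1,2) hom_simps(1) in auto)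
qed

text \<open>
  A germ \<open>a / s\<close> with \<open>\<phi> a / \<phi> s\<close> invertible at \<open>q\<close> has a numerator outside the contraction of \<open>q\<close>,
  so \<open>s / a\<close> is an inverse on a neighbourhood.
\<close>

lemma germ_unit_reflect:
  assumes V: "openin (zariski R) V" and f: "f \<in> carrier (structure_sheaf R V)"
    and q: "q \<in> spectrum S" "contract R \<phi> q \<in> V"
    and unit: "germ_is_unit (Spec S) q U (on_sections (Spec_map R S \<phi>) V f)"
  shows "germ_is_unit (Spec R) (contract R \<phi> q) V f"
proof -
  interpret q: prime_at q S
    using q by (simp add: spectrum_def prime_at_def)
  let ?g = "on_sections (Spec_map R S \<phi>) V f"
  obtain V1 a s where V1: "openin (zariski R) V1" "contract R \<phi> q \<in> V1" "V1 \<subseteq> V"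
    and as: "a \<in> carrier R" "s \<in> carrier R" "\<forall>p\<in>V1. s \<notin> p \<and> f p = frac_at R p a s"
    using f q unfolding section_iff by blast
  from unit obtain W h where W: "openin (zariski S) W" "q \<in> W"
    and h: "h \<in> carrier (structure_sheaf S W)"
      "restrict ?g W \<otimes>\<^bsub>structure_sheaf S W\<^esub> h = \<one>\<^bsub>structure_sheaf S W\<^esub>"
    unfolding germ_is_unit_def Spec_def Units_def by auto
  have s: "s \<in> carrier R - contract R \<phi> q"
    using as V1 by auto
  have gq: "?g q = frac_at S q (\<phi> a) (\<phi> s)"
    using q as V1 s by (simp add: sections_Spec_map[OF V f] local_hom_frac)
  obtain b t where bt: "b \<in> carrier S" "t \<in> carrier S - q" "h q = frac_at S q b t"
    using section_value[OF h(1) W(2)] .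
  have phi: "\<phi> a \<in> carrier S" "\<phi> s \<in> carrier S - q"
    using as s hom_simps unfolding nonmember_contract by auto
  have "frac_at S q (\<phi> a \<otimes>\<^bsub>S\<^esub> b) (\<phi> s \<otimes>\<^bsub>S\<^esub> t) = frac_at S q \<one>\<^bsub>S\<^esub> \<one>\<^bsub>S\<^esub>"
    using fun_cong[OF h(2), of q] W(2) phi bt
    by (simp add: structure_sheaf_simps gq local_ring_one q.local_ring_mult)
  then obtain u where u: "u \<in> carrier S - q"
    "u \<otimes>\<^bsub>S\<^esub> (\<phi> a \<otimes>\<^bsub>S\<^esub> b \<otimes>\<^bsub>S\<^esub> \<one>\<^bsub>S\<^esub>) = u \<otimes>\<^bsub>S\<^esub> (\<one>\<^bsub>S\<^esub> \<otimes>\<^bsub>S\<^esub> (\<phi> s \<otimes>\<^bsub>S\<^esub> t))"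
    using phi bt q.nonmembers_mult q.one_nonmember
    by (subst (asm) q.frac_at_eq_iff) auto
  have "u \<otimes>\<^bsub>S\<^esub> (\<phi> s \<otimes>\<^bsub>S\<^esub> t) \<in> carrier S - q"
    using u phi bt q.nonmembers_mult by blast
  then have "u \<otimes>\<^bsub>S\<^esub> (\<phi> a \<otimes>\<^bsub>S\<^esub> b) \<notin> q"
    using u phi bt by simp
  then have "\<phi> a \<notin> q"
    using u(1) bt(1) q.I_r_closed q.I_l_closed by blast
  then have a: "a \<in> carrier R - contract R \<phi> q"
    using as by (simp add: contract_def)
  (* on this neighbourhood the numerator is invertible too *)
  define V2 where "V2 = {p \<in> V1. a \<notin> p}"
  have V2: "openin (zariski R) V2" "V2 \<subseteq> V" "contract R \<phi> q \<in> V2"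
  proof -
    have "V1 \<subseteq> spectrum R"
      using openin_subset[OF V1(1)] by (simp add: topspace_zariski[OF R])
    then have "V2 = V1 \<inter> {p \<in> spectrum R. \<not> {a} \<subseteq> p}"
      by (auto simp: V2_def)
    moreover have "openin (zariski R) {p \<in> spectrum R. \<not> {a} \<subseteq> p}"
      unfolding openin_zariski using as by blast
    ultimately show "openin (zariski R) V2"
      using V1(1) by auto
    show "V2 \<subseteq> V" "contract R \<phi> q \<in> V2"
      using V1 a by (auto simp: V2_def)
  qed
  define k where "k = (\<lambda>p\<in>V2. frac_at R p s a)"
  have k: "k \<in> carrier (structure_sheaf R V2)"
    unfolding section_iff carrier_local_ring
  proof (intro conjI ballI)
    show "k \<in> extensional V2"
      by (simp add: k_def)
    show "k p \<in> {frac_at R p a s |a s. a \<in> carrier R \<and> s \<in> carrier R - p}" if "p \<in> V2" for p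
      using that as by (auto simp: k_def V2_def)
    show "\<exists>V. openin (zariski R) V \<and> p \<in> V \<and> V \<subseteq> V2 \<and>
        (\<exists>a\<in>carrier R. \<exists>s\<in>carrier R. \<forall>q\<in>V. s \<notin> q \<and> k q = frac_at R q a s)"
      if "p \<in> V2" for p
      by (rule exI[of _ V2], intro conjI bexI[of _ s] bexI[of _ a])
        (use that V2(1) as in \<open>auto simp: k_def V2_def\<close>)
  qed
  have inv: "f p \<otimes>\<^bsub>local_ring_at R p\<^esub> k p = \<one>\<^bsub>local_ring_at R p\<^esub>"
    "k p \<otimes>\<^bsub>local_ring_at R p\<^esub> f p = \<one>\<^bsub>local_ring_at R p\<^esub>" if "p \<in> V2" for p
  proof -
    have "p \<in> spectrum R"
      using that openin_subset[OF V2(1)] by (auto simp: topspace_zariski[OF R])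
    then interpret p: prime_at p R
      by (simp add: spectrum_def prime_at_def)
    have *: "f p = frac_at R p a s" "k p = frac_at R p s a" "a \<in> carrier R - p" "s \<in> carrier R - p"
      using that as by (auto simp: k_def V2_def)
    show "f p \<otimes>\<^bsub>local_ring_at R p\<^esub> k p = \<one>\<^bsub>local_ring_at R p\<^esub>"
      "k p \<otimes>\<^bsub>local_ring_at R p\<^esub> f p = \<one>\<^bsub>local_ring_at R p\<^esub>"
      using * p.one_nonmember p.nonmembers_mult
      by (auto simp: p.local_ring_mult local_ring_one R.m_comm p.frac_at_eq_iff
          intro!: bexI[of _ "\<one>\<^bsub>R\<^esub>"])
  qed
  have "k \<otimes>\<^bsub>structure_sheaf R V2\<^esub> restrict f V2 = \<one>\<^bsub>structure_sheaf R V2\<^esub>"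
    "restrict f V2 \<otimes>\<^bsub>structure_sheaf R V2\<^esub> k = \<one>\<^bsub>structure_sheaf R V2\<^esub>"
    using inv unfolding structure_sheaf_simps by (auto intro!: restrict_ext)
  then have "restrict f V2 \<in> Units (structure_sheaf R V2)"
    unfolding Units_def using section_restrict[OF f V2(2,1)] k by blast
  then show ?thesis
    unfolding germ_is_unit_def Spec_def using V2 by auto
qed

lemma hom_local_ring:
  assumes q: "q \<in> spectrum S" and x: "x \<in> carrier (local_ring_at R (contract R \<phi> q))"
    and y: "y \<in> carrier (local_ring_at R (contract R \<phi> q))"
  shows "local_hom_at S \<phi> q (x \<otimes>\<^bsub>local_ring_at R (contract R \<phi> q)\<^esub> y) =
      local_hom_at S \<phi> q x \<otimes>\<^bsub>local_ring_at S q\<^esub> local_hom_at S \<phi> q y"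
    and "local_hom_at S \<phi> q (x \<oplus>\<^bsub>local_ring_at R (contract R \<phi> q)\<^esub> y) =
      local_hom_at S \<phi> q x \<oplus>\<^bsub>local_ring_at S q\<^esub> local_hom_at S \<phi> q y"
    and "local_hom_at S \<phi> q \<one>\<^bsub>local_ring_at R (contract R \<phi> q)\<^esub> = \<one>\<^bsub>local_ring_at S q\<^esub>"
proof -
  interpret p: prime_at "contract R \<phi> q" R
    using contract_spectrum[OF q] by (simp add: spectrum_def prime_at_def)
  interpret q: prime_at q S
    using q by (simp add: spectrum_def prime_at_def)
  obtain a s where x: "x = frac_at R (contract R \<phi> q) a s" "a \<in> carrier R" "s \<in> carrier R - contract R \<phi> q"
    using x by (auto simp: carrier_local_ring)
  obtain b t where y: "y = frac_at R (contract R \<phi> q) b t" "b \<in> carrier R" "t \<in> carrier R - contract R \<phi> q"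
    using y by (auto simp: carrier_local_ring)
  have st: "s \<otimes>\<^bsub>R\<^esub> t \<in> carrier R - contract R \<phi> q"
    using x y p.nonmembers_mult by blast
  have phi: "\<phi> s \<in> carrier S - q" "\<phi> t \<in> carrier S - q"
    using x y hom_simps unfolding nonmember_contract by auto
  have sc: "s \<in> carrier R" "t \<in> carrier R" using x y by auto
  note frac = local_hom_frac[OF q _ st] local_hom_frac[OF q x(2,3)] local_hom_frac[OF q y(2,3)]
  show "local_hom_at S \<phi> q (x \<otimes>\<^bsub>local_ring_at R (contract R \<phi> q)\<^esub> y) =
      local_hom_at S \<phi> q x \<otimes>\<^bsub>local_ring_at S q\<^esub> local_hom_at S \<phi> q y"
    unfolding x(1) y(1) p.local_ring_mult[OF x(2,3) y(2,3)] frac frac(1)[OF R.m_closed[OF x(2) y(2)]]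
    using x(2) y(2) phi sc by (simp add: q.local_ring_mult hom_simps)
  have c: "a \<otimes>\<^bsub>R\<^esub> t \<oplus>\<^bsub>R\<^esub> b \<otimes>\<^bsub>R\<^esub> s \<in> carrier R"
    using x(2) y(2) sc by simp
  show "local_hom_at S \<phi> q (x \<oplus>\<^bsub>local_ring_at R (contract R \<phi> q)\<^esub> y) =
      local_hom_at S \<phi> q x \<oplus>\<^bsub>local_ring_at S q\<^esub> local_hom_at S \<phi> q y"
    unfolding x(1) y(1) p.local_ring_add[OF x(2,3) y(2,3)] frac frac(1)[OF c]
    using x(2) y(2) phi sc by (simp add: q.local_ring_add hom_simps)
  show "local_hom_at S \<phi> q \<one>\<^bsub>local_ring_at R (contract R \<phi> q)\<^esub> = \<one>\<^bsub>local_ring_at S q\<^esub>"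
    unfolding local_ring_one using p.one_nonmember by (simp add: local_hom_frac[OF q] hom_simps)
qed

lemma lrs_morphism_Spec_map: "lrs_morphism (Spec S) (Spec R) (Spec_map R S \<phi>)"
  unfolding lrs_morphism_def preimg_Spec_map
proof (intro conjI allI impI ballI)
  have Spec: "space_top (Spec R) = zariski R" "space_top (Spec S) = zariski S"
    "sections (Spec R) = structure_sheaf R" "sections (Spec S) = structure_sheaf S"
    "\<And>U V f. restr (Spec R) U V f = restrict f V" "\<And>U V f. restr (Spec S) U V f = restrict f V"
    by (simp_all add: Spec_def)
  show "continuous_map (space_top (Spec S)) (space_top (Spec R)) (on_points (Spec_map R S \<phi>))"
    unfolding continuous_map_def Spec topspace_zariski[OF R] topspace_zariski[OF S]
    using openin_preimg contract_spectrum by (auto simp: points_Spec_map cong: conj_cong)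
  show "on_points (Spec_map R S \<phi>) \<in> extensional (topspace (space_top (Spec S)))"
    by (simp add: Spec topspace_zariski[OF S] Spec_map_def)
  show "on_sections (Spec_map R S \<phi>) \<in> extensional {V. openin (space_top (Spec R)) V}"
    by (simp add: Spec Spec_map_def)
  fix V assume V: "openin (space_top (Spec R)) V"
  then have V': "openin (zariski R) V"
    by (simp add: Spec)
  show "on_sections (Spec_map R S \<phi>) V \<in> extensional (carrier (sections (Spec R) V))"
    using V by (simp add: Spec Spec_map_def)
  show "on_sections (Spec_map R S \<phi>) V \<in>
      ring_hom (sections (Spec R) V) (sections (Spec S) {q \<in> spectrum S. contract R \<phi> q \<in> V})"
    unfolding Spec
  proof (rule ring_hom_memI)
    let ?U = "{q \<in> spectrum S. contract R \<phi> q \<in> V}"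
    fix f assume f: "f \<in> carrier (structure_sheaf R V)"
    show "on_sections (Spec_map R S \<phi>) V f \<in> carrier (structure_sheaf S ?U)"
      by (rule section_pullback[OF V' f])
    fix g assume g: "g \<in> carrier (structure_sheaf R V)"
    let ?m = "f \<otimes>\<^bsub>structure_sheaf R V\<^esub> g" and ?a = "f \<oplus>\<^bsub>structure_sheaf R V\<^esub> g"
    note mult = section_mult_add(1)[OF R f g] and add = section_mult_add(2)[OF R f g]
    have fg: "f p \<in> carrier (local_ring_at R p)" "g p \<in> carrier (local_ring_at R p)"
      if "p \<in> V" for p
      using f g that by (simp_all add: section_iff)
    show "on_sections (Spec_map R S \<phi>) V ?m =
        on_sections (Spec_map R S \<phi>) V f \<otimes>\<^bsub>structure_sheaf S ?U\<^esub> on_sections (Spec_map R S \<phi>) V g"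
      unfolding sections_Spec_map[OF V' f] sections_Spec_map[OF V' g] sections_Spec_map[OF V' mult]
      using hom_local_ring(1) fg by (auto simp: structure_sheaf_simps intro!: restrict_ext)
    show "on_sections (Spec_map R S \<phi>) V ?a =
        on_sections (Spec_map R S \<phi>) V f \<oplus>\<^bsub>structure_sheaf S ?U\<^esub> on_sections (Spec_map R S \<phi>) V g"
      unfolding sections_Spec_map[OF V' f] sections_Spec_map[OF V' g] sections_Spec_map[OF V' add]
      using hom_local_ring(2) fg by (auto simp: structure_sheaf_simps intro!: restrict_ext)
  next
    note one = section_one[OF R V']
    have "local_hom_at S \<phi> q \<one>\<^bsub>local_ring_at R (contract R \<phi> q)\<^esub> = \<one>\<^bsub>local_ring_at S q\<^esub>"
      if "q \<in> spectrum S" for q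
    proof -
      interpret p: prime_at "contract R \<phi> q" R
        using contract_spectrum[OF that] by (simp add: spectrum_def prime_at_def)
      show ?thesis
        using p.one_nonmember by (simp add: local_hom_frac[OF that] hom_simps local_ring_one)
    qed
    then show "on_sections (Spec_map R S \<phi>) V \<one>\<^bsub>structure_sheaf R V\<^esub> =
        \<one>\<^bsub>structure_sheaf S {q \<in> spectrum S. contract R \<phi> q \<in> V}\<^esub>"
      unfolding sections_Spec_map[OF V' one] by (auto simp: structure_sheaf_simps intro!: restrict_ext)
  qed
  fix q f assume q: "q \<in> {q \<in> spectrum S. contract R \<phi> q \<in> V}"
    and f: "f \<in> carrier (sections (Spec R) V)"
    and u: "germ_is_unit (Spec S) q {q \<in> spectrum S. contract R \<phi> q \<in> V} (on_sections (Spec_map R S \<phi>) V f)"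
  show "germ_is_unit (Spec R) (on_points (Spec_map R S \<phi>) q) V f"
    using germ_unit_reflect[OF V' _ _ _ u] q f by (simp add: Spec points_Spec_map)
next
  have Spec: "space_top (Spec R) = zariski R"
    "sections (Spec R) = structure_sheaf R"
    "\<And>U V f. restr (Spec R) U V f = restrict f V" "\<And>U V f. restr (Spec S) U V f = restrict f V"
    by (simp_all add: Spec_def)
  fix U V f assume UV: "openin (space_top (Spec R)) U" "openin (space_top (Spec R)) V" "V \<subseteq> U"
    and f: "f \<in> carrier (sections (Spec R) U)"
  have *: "openin (zariski R) U" "openin (zariski R) V" "f \<in> carrier (structure_sheaf R U)"
    using UV f by (simp_all add: Spec)
  show "on_sections (Spec_map R S \<phi>) V (restr (Spec R) U V f) =
    restr (Spec S) {q \<in> spectrum S. contract R \<phi> q \<in> U} {q \<in> spectrum S. contract R \<phi> q \<in> V}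
      (on_sections (Spec_map R S \<phi>) U f)"
    unfolding Spec sections_Spec_map[OF *(1,3)]
      sections_Spec_map[OF *(2) section_restrict[OF *(3) UV(3) *(2)]]
    using subsetD[OF UV(3)] by (simp add: restrict_def fun_eq_iff)
qed

end

section \<open>Functoriality and quotients\<close>

lemma Spec_map_cong:
  assumes eq: "\<And>a. a \<in> carrier R \<Longrightarrow> \<phi> a = \<psi> a"
  shows "Spec_map R S \<phi> = Spec_map R S \<psi>"
proof -
  have c: "contract R \<phi> = contract R \<psi>"
    using eq by (auto simp: contract_def fun_eq_iff)
  have "local_hom_at S \<phi> q x = local_hom_at S \<psi> q x" if "x \<in> carrier (local_ring_at R p)" for x p q
  proof -
    from that obtain a s where x: "x = frac_at R p a s" "a \<in> carrier R" "s \<in> carrier R - p"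
      by (auto simp: carrier_local_ring)
    have "x \<subseteq> carrier R \<times> carrier R"
      using x by (auto simp: frac_at_def)
    then show ?thesis
      unfolding local_hom_at_def using eq by (intro SUP_cong) auto
  qed
  then have "local_hom_at S \<phi> q (f p) = local_hom_at S \<psi> q (f p)"
    if "f \<in> carrier (structure_sheaf R U)" "p \<in> U" for f p q U
    using that section_iff by metis
  then show ?thesis
    unfolding Spec_map_def c by (simp cong: restrict_cong)
qed

lemma Spec_map_comp:
  assumes "cring_hom R S \<phi>" "cring_hom S T \<psi>"
  shows "lrs_comp (Spec T) (Spec S) (Spec R) (Spec_map R S \<phi>) (Spec_map S T \<psi>) =
    Spec_map R T (\<lambda>a. \<psi> (\<phi> a))"
proof -
  interpret f: cring_hom R S \<phi> by fact
  interpret g: cring_hom S T \<psi> by fact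
  have "cring_hom R T (\<lambda>a. \<psi> (\<phi> a))"
    using ring_hom_trans[OF f.hom g.hom] f.R g.S by (simp add: cring_hom_def comp_def)
  then interpret h: cring_hom R T "\<lambda>a. \<psi> (\<phi> a)" .
  have c: "contract R \<phi> (contract S \<psi> q) = contract R (\<lambda>a. \<psi> (\<phi> a)) q" for q
    using f.hom_simps(1) by (auto simp: contract_def)
  have pts: "on_points (lrs_comp (Spec T) (Spec S) (Spec R) (Spec_map R S \<phi>) (Spec_map S T \<psi>)) =
      on_points (Spec_map R T (\<lambda>a. \<psi> (\<phi> a)))"
    unfolding lrs_comp_def using g.contract_spectrum
    by (simp add: Spec_def Spec_map_def topspace_zariski[OF g.S] c cong: restrict_cong)
  have sec: "on_sections (Spec_map S T \<psi>) (preimg (Spec S) (on_points (Spec_map R S \<phi>)) W)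
       (on_sections (Spec_map R S \<phi>) W s) = on_sections (Spec_map R T (\<lambda>a. \<psi> (\<phi> a))) W s"
    if W: "openin (zariski R) W" and s: "s \<in> carrier (structure_sheaf R W)" for W s
  proof -
    have "local_hom_at T \<psi> q (local_hom_at S \<phi> (contract S \<psi> q) (s (contract R \<phi> (contract S \<psi> q)))) =
        local_hom_at T (\<lambda>a. \<psi> (\<phi> a)) q (s (contract R (\<lambda>a. \<psi> (\<phi> a)) q))"
      if q: "q \<in> spectrum T" and qW: "contract R (\<lambda>a. \<psi> (\<phi> a)) q \<in> W" for q
    proof -
      obtain a t where at: "a \<in> carrier R" "t \<in> carrier R - contract R (\<lambda>a. \<psi> (\<phi> a)) q"
        and s_eq: "s (contract R (\<lambda>a. \<psi> (\<phi> a)) q) = frac_at R (contract R (\<lambda>a. \<psi> (\<phi> a)) q) a t"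
        by (rule section_value[OF s qW])
      have t: "t \<in> carrier R - contract R \<phi> (contract S \<psi> q)"
        using at(2) by (simp add: c)
      have t': "\<phi> t \<in> carrier S - contract S \<psi> q"
        using at(2) f.hom_simps(1) by (auto simp: contract_def)
      have "local_hom_at S \<phi> (contract S \<psi> q) (s (contract R \<phi> (contract S \<psi> q))) =
          frac_at S (contract S \<psi> q) (\<phi> a) (\<phi> t)"
        unfolding c s_eq
        using f.local_hom_frac[OF g.contract_spectrum[OF q] at(1) t] by (simp add: c)
      then show ?thesis
        unfolding s_eq h.local_hom_frac[OF q at]
        by (simp add: g.local_hom_frac[OF q f.hom_simps(1)[OF at(1)] t'])
    qed
    then show ?thesis
      unfolding f.preimg_Spec_map f.sections_Spec_map[OF W s] h.sections_Spec_map[OF W s]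
        g.sections_Spec_map[OF f.openin_preimg[OF W] f.section_pullback[OF W s, unfolded f.sections_Spec_map[OF W s]]]
      using g.contract_spectrum by (intro ext) (auto simp: c restrict_def)
  qed
  have "on_sections (Spec_map R T (\<lambda>a. \<psi> (\<phi> a))) =
      (\<lambda>W \<in> {W. openin (zariski R) W}. \<lambda>s \<in> carrier (structure_sheaf R W).
         on_sections (Spec_map R T (\<lambda>a. \<psi> (\<phi> a))) W s)"
    by (auto simp: Spec_map_def intro!: ext)
  also have "\<dots> = on_sections (lrs_comp (Spec T) (Spec S) (Spec R) (Spec_map R S \<phi>) (Spec_map S T \<psi>))"
    unfolding lrs_comp_def using sec by (simp add: Spec_def cong: restrict_cong)
  finally show ?thesis
    using pts by (intro space_mor.equality) simp_all
qed

lemma Spec_map_id: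
  assumes R: "cring R"
  shows "Spec_map R R (\<lambda>a. a) = lrs_id (Spec R)"
proof -
  interpret cring_hom R R "\<lambda>a. a"
    using R by (simp add: cring_hom_def ring_hom_def)
  have c: "contract R (\<lambda>a. a) q = q" if "q \<in> spectrum R" for q
    using that additive_subgroup.a_subset ideal.axioms(1) primeideal.axioms(1)
    by (fastforce simp: contract_def spectrum_def)
  have id: "local_hom_at R (\<lambda>a. a) q x = x" if "q \<in> spectrum R" "x \<in> carrier (local_ring_at R q)" for q x
    using that local_hom_frac[of q] by (auto simp: carrier_local_ring c)
  have U: "q \<in> spectrum R" if "openin (zariski R) U" "q \<in> U" for q U
    using that by (auto simp: openin_zariski)
  have "(\<lambda>q \<in> {q \<in> spectrum R. contract R (\<lambda>a. a) q \<in> U}. local_hom_at R (\<lambda>a. a) q (f (contract R (\<lambda>a. a) q))) = f"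
    if "openin (zariski R) U" "f \<in> carrier (structure_sheaf R U)" for U f
  proof
    fix q
    show "(\<lambda>q \<in> {q \<in> spectrum R. contract R (\<lambda>a. a) q \<in> U}.
        local_hom_at R (\<lambda>a. a) q (f (contract R (\<lambda>a. a) q))) q = f q"
      using that U[OF that(1)] by (cases "q \<in> U") (auto simp: c id section_iff extensional_def)
  qed
  then show ?thesis
    by (auto simp: Spec_map_def lrs_id_def Spec_def topspace_zariski[OF R] c cong: restrict_cong)
qed

text \<open>The choice of the representative is immaterial when \<open>f\<close> maps the ideal defining the cosets into \<open>J\<close>.\<close>

definition quotient_hom :: "'a ring \<Rightarrow> 'b ring \<Rightarrow> 'b set \<Rightarrow> ('a \<Rightarrow> 'b) \<Rightarrow> 'a set \<Rightarrow> 'b set" where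
  "quotient_hom R S J f X = J +>\<^bsub>S\<^esub> f (SOME a. a \<in> X)"

lemma (in ideal) coset_eq_iff:
  assumes "a \<in> carrier R" "b \<in> carrier R"
  shows "I +> a = I +> b \<longleftrightarrow> a \<ominus> b \<in> I"
  using assms quotient_eq_iff_same_a_r_cos[OF ideal_axioms] by blast

lemma carrier_Quot: "carrier (R Quot I) = {I +>\<^bsub>R\<^esub> a |a. a \<in> carrier R}"
  by (auto simp: FactRing_def A_RCOSETS_def RCOSETS_def a_r_coset_def)

lemma quotient_hom_coset:
  assumes R: "cring R" and S: "cring S" and I: "ideal I R" and J: "ideal J S"
    and f: "f \<in> ring_hom R S" and IJ: "f ` I \<subseteq> J" and a: "a \<in> carrier R"
  shows "quotient_hom R S J f (I +>\<^bsub>R\<^esub> a) = J +>\<^bsub>S\<^esub> f a"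
proof -
  interpret I: ideal I R by fact
  interpret J: ideal J S by fact
  interpret ring_hom_ring R S f
    using f I.ring_axioms J.ring_axioms by (intro ring_hom_ringI2)
  define b where "b = (SOME b. b \<in> I +>\<^bsub>R\<^esub> a)"
  have "b \<in> I +>\<^bsub>R\<^esub> a"
    unfolding b_def by (rule someI) (rule I.a_rcos_self[OF a])
  then obtain i where i: "i \<in> I" "b = i \<oplus>\<^bsub>R\<^esub> a"
    by (auto simp: a_r_coset_def r_coset_def)
  have ic: "i \<in> carrier R"
    using i(1) by (rule I.Icarr)
  have "f b \<ominus>\<^bsub>S\<^esub> f a = f i"
    using ic a by (simp add: i(2) a_minus_def J.a_assoc J.r_neg)
  also have "f i \<in> J"
    using IJ i by auto
  finally show ?thesis
    unfolding quotient_hom_def b_def[symmetric] using a ic i by (subst J.coset_eq_iff) auto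
qed

lemma quotient_hom:
  assumes R: "cring R" and S: "cring S" and I: "ideal I R" and J: "ideal J S"
    and f: "f \<in> ring_hom R S" and IJ: "f ` I \<subseteq> J"
  shows "cring_hom (R Quot I) (S Quot J) (quotient_hom R S J f)"
proof -
  interpret I: ideal I R by fact
  interpret J: ideal J S by fact
  note [simp] = quotient_hom_coset[OF assms]
  note hs = ring_hom_closed[OF f] ring_hom_mult[OF f] ring_hom_add[OF f] ring_hom_one[OF f]
  note h1 = I.rcos_ring_hom and h2 = J.rcos_ring_hom
  note q1 = ring_hom_closed[OF h1] ring_hom_mult[OF h1, symmetric] ring_hom_add[OF h1, symmetric] ring_hom_one[OF h1, symmetric]
  note q2 = ring_hom_closed[OF h2] ring_hom_mult[OF h2] ring_hom_add[OF h2] ring_hom_one[OF h2]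
  have "quotient_hom R S J f \<in> ring_hom (R Quot I) (S Quot J)"
    by (rule ring_hom_memI) (auto simp: carrier_Quot[of R] q1 q2 hs)
  then show ?thesis
    using I.quotient_is_cring[OF R] J.quotient_is_cring[OF S] by (simp add: cring_hom_def)
qed

lemma coset_cring_hom:
  assumes "cring R" "ideal I R"
  shows "cring_hom R (R Quot I) (\<lambda>a. I +>\<^bsub>R\<^esub> a)"
  using assms ideal.quotient_is_cring[OF assms(2,1)] ideal.rcos_ring_hom[OF assms(2)]
  by (simp add: cring_hom_def)

text \<open>
  Being inverse to each other modulo the ideals, \<open>f\<close> and \<open>g\<close> induce mutually inverse homomorphisms of the
  quotient rings. The square commutes because both composites are induced by mapping \<open>a\<close> to the coset of \<open>f a\<close>.
\<close>

theorem Spec_quotient_isomorphism: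
  fixes R :: "'a ring" and S :: "'b ring"
  assumes R: "cring R" and S: "cring S" and I: "ideal I R" and J: "ideal J S"
    and f: "f \<in> ring_hom R S" and g: "g \<in> ring_hom S R"
    and IJ: "f ` I \<subseteq> J" and JI: "g ` J \<subseteq> I"
    and gf: "\<And>a. a \<in> carrier R \<Longrightarrow> g (f a) \<ominus>\<^bsub>R\<^esub> a \<in> I"
    and fg: "\<And>b. b \<in> carrier S \<Longrightarrow> f (g b) \<ominus>\<^bsub>S\<^esub> b \<in> J"
  shows "\<exists>\<psi>. lrs_isomorphism (Spec (S Quot J)) (Spec (R Quot I)) \<psi> \<and>
    lrs_comp (Spec (S Quot J)) (Spec S) (Spec R) (Spec_map R S f) (closed_embedding S J) =
    lrs_comp (Spec (S Quot J)) (Spec (R Quot I)) (Spec R) (closed_embedding R I) \<psi>"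
proof -
  let ?F = "quotient_hom R S J f" and ?G = "quotient_hom S R I g"
  interpret F: cring_hom "R Quot I" "S Quot J" ?F
    by (rule quotient_hom[OF R S I J f IJ])
  interpret G: cring_hom "S Quot J" "R Quot I" ?G
    by (rule quotient_hom[OF S R J I g JI])
  note Fc = quotient_hom_coset[OF R S I J f IJ] and Gc = quotient_hom_coset[OF S R J I g JI]
  note fc = ring_hom_closed[OF f] and gc = ring_hom_closed[OF g]
  have "I +>\<^bsub>R\<^esub> g (f a) = I +>\<^bsub>R\<^esub> a" if "a \<in> carrier R" for a
    using that gf by (subst ideal.coset_eq_iff[OF I]) (simp_all add: fc gc)
  then have GF: "?G (?F x) = x" if "x \<in> carrier (R Quot I)" for x
    using that by (auto simp: carrier_Quot Fc Gc fc gc)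
  have "J +>\<^bsub>S\<^esub> f (g b) = J +>\<^bsub>S\<^esub> b" if "b \<in> carrier S" for b
    using that fg by (subst ideal.coset_eq_iff[OF J]) (simp_all add: fc gc)
  then have FG: "?F (?G x) = x" if "x \<in> carrier (S Quot J)" for x
    using that by (auto simp: carrier_Quot Fc Gc fc gc)
  let ?\<psi> = "Spec_map (R Quot I) (S Quot J) ?F" and ?\<chi> = "Spec_map (S Quot J) (R Quot I) ?G"
  have "lrs_comp (Spec (S Quot J)) (Spec (R Quot I)) (Spec (S Quot J)) ?\<chi> ?\<psi> = lrs_id (Spec (S Quot J))"
    unfolding Spec_map_comp[OF G.cring_hom_axioms F.cring_hom_axioms] Spec_map_id[OF F.S, symmetric]
    by (rule Spec_map_cong) (rule FG)
  moreover have "lrs_comp (Spec (R Quot I)) (Spec (S Quot J)) (Spec (R Quot I)) ?\<psi> ?\<chi> = lrs_id (Spec (R Quot I))"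
    unfolding Spec_map_comp[OF F.cring_hom_axioms G.cring_hom_axioms] Spec_map_id[OF F.R, symmetric]
    by (rule Spec_map_cong) (rule GF)
  ultimately have "lrs_isomorphism (Spec (S Quot J)) (Spec (R Quot I)) ?\<psi>"
    unfolding lrs_isomorphism_def using F.lrs_morphism_Spec_map G.lrs_morphism_Spec_map by blast
  moreover have "cring_hom R S f"
    using R S f by (simp add: cring_hom_def)
  then have "lrs_comp (Spec (S Quot J)) (Spec S) (Spec R) (Spec_map R S f) (closed_embedding S J) =
    lrs_comp (Spec (S Quot J)) (Spec (R Quot I)) (Spec R) (closed_embedding R I) ?\<psi>"
    unfolding closed_embedding_def Spec_map_comp[OF _ coset_cring_hom[OF S J]]
      Spec_map_comp[OF coset_cring_hom[OF R I] F.cring_hom_axioms]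
    by (subst Spec_map_comp[OF _ coset_cring_hom[OF S J]]) (simp_all add: Fc cong: Spec_map_cong)
  ultimately show ?thesis
    by blast
qed

section \<open>Polynomials over a commutative ring\<close>

text \<open>
  A commutative ring is a module over itself. Its subspaces are the ideals and its spans are the
  generated ideals.
\<close>

interpretation ring_module: module "(*) :: 'r::comm_ring_1 \<Rightarrow> 'r \<Rightarrow> 'r"
  by unfold_locales (simp_all add: algebra_simps)

lemma poly_expand:
  fixes f :: "'a \<Rightarrow>\<^sub>0 'b::comm_monoid_add"
  shows "f = (\<Sum>t\<in>Poly_Mapping.keys f. Poly_Mapping.single t (Poly_Mapping.lookup f t))"
proof (rule poly_mapping_eqI)
  fix k
  have "Poly_Mapping.lookup f k = (\<Sum>t\<in>Poly_Mapping.keys f. Poly_Mapping.lookup f t when t = k)"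
    by (cases "k \<in> Poly_Mapping.keys f") (auto simp: when_def in_keys_iff)
  then show "Poly_Mapping.lookup f k = Poly_Mapping.lookup
      (\<Sum>t\<in>Poly_Mapping.keys f. Poly_Mapping.single t (Poly_Mapping.lookup f t)) k"
    by (simp add: lookup_sum lookup_single)
qed

lemma poly_induct [case_names zero single add]:
  fixes f :: "'a \<Rightarrow>\<^sub>0 'b::comm_monoid_add"
  assumes "P 0" "\<And>t c. P (Poly_Mapping.single t c)" "\<And>f g. P f \<Longrightarrow> P g \<Longrightarrow> P (f + g)"
  shows "P f"
proof -
  have "P (\<Sum>t\<in>A. Poly_Mapping.single t (Poly_Mapping.lookup f t))" if "finite A" for A
    using that by induction (auto intro: assms)
  then show ?thesis
    by (subst poly_expand) simp
qed

definition linear_extension ::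
  "('t \<Rightarrow> 'x pterm \<Rightarrow>\<^sub>0 'r) \<Rightarrow> ('t \<Rightarrow>\<^sub>0 'r::comm_ring_1) \<Rightarrow> ('x pterm \<Rightarrow>\<^sub>0 'r)" where
  "linear_extension F f = (\<Sum>t\<in>Poly_Mapping.keys f. Poly_Mapping.single 0 (Poly_Mapping.lookup f t) * F t)"

lemma linear_extension_superset:
  assumes "finite A" "Poly_Mapping.keys f \<subseteq> A"
  shows "linear_extension F f = (\<Sum>t\<in>A. Poly_Mapping.single 0 (Poly_Mapping.lookup f t) * F t)"
  unfolding linear_extension_def using assms
  by (intro sum.mono_neutral_left) (auto simp: in_keys_iff)

lemma linear_extension_0 [simp]: "linear_extension F 0 = 0"
  by (simp add: linear_extension_def)

lemma linear_extension_single [simp]: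
  "linear_extension F (Poly_Mapping.single t c) = Poly_Mapping.single 0 c * F t"
  by (subst linear_extension_superset[of "{t}"]) auto

lemma linear_extension_add:
  "linear_extension F (f + g) = linear_extension F f + linear_extension F g"
proof -
  let ?A = "Poly_Mapping.keys f \<union> Poly_Mapping.keys g"
  have "Poly_Mapping.keys (f + g) \<subseteq> ?A" by (rule keys_add)
  then show ?thesis
    by (simp add: linear_extension_superset[of ?A] lookup_add single_add algebra_simps sum.distrib)
qed

lemma linear_extension_scale:
  "linear_extension F (Poly_Mapping.single 0 c * f) = Poly_Mapping.single 0 c * linear_extension F f"
  by (induction f rule: poly_induct)
    (simp_all add: mult_single distrib_left linear_extension_add mult.assoc[symmetric])

lemma linear_extension_uminus: "linear_extension F (- f) = - linear_extension F f"
  using linear_extension_add[of F f "- f"] by (simp add: eq_neg_iff_add_eq_0 add.commute)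

lemma linear_extension_diff:
  "linear_extension F (f - g) = linear_extension F f - linear_extension F g"
  using linear_extension_add[of F f "- g"] by (simp add: linear_extension_uminus)

lemma linear_extension_monom_mult:
  fixes f :: "'x pterm \<Rightarrow>\<^sub>0 'r::comm_ring_1"
  shows "linear_extension F (Poly_Mapping.single s c * f) =
    Poly_Mapping.single 0 c * linear_extension (\<lambda>t. F (s + t)) f"
  by (induction f rule: poly_induct)
    (simp_all add: mult_single distrib_left linear_extension_add mult.assoc[symmetric])

lemma linear_extension_in_subspace:
  assumes "ring_module.subspace M" "\<And>t. t \<in> Poly_Mapping.keys f \<Longrightarrow> F t \<in> M"
  shows "linear_extension F f \<in> M"
  unfolding linear_extension_def
  using assms by (intro ring_module.subspace_sum) (auto intro: ring_module.subspace_scale)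

lemma linear_extension_fun_diff:
  "linear_extension F f - linear_extension G f = linear_extension (\<lambda>t. F t - G t) f"
  by (simp add: linear_extension_def sum_subtractf algebra_simps)

lemma linear_extension_cong:
  "(\<And>t. t \<in> Poly_Mapping.keys f \<Longrightarrow> F t = G t) \<Longrightarrow> linear_extension F f = linear_extension G f"
  unfolding linear_extension_def by (intro sum.cong) auto

lemma linear_extension_monomials: "linear_extension (\<lambda>t. Poly_Mapping.single t 1) f = f"
  using poly_expand[of f] by (simp add: linear_extension_def mult_single)

lemma keys_scale: "Poly_Mapping.keys (Poly_Mapping.single 0 c * f) \<subseteq> Poly_Mapping.keys (f :: 'x pterm \<Rightarrow>\<^sub>0 'r::comm_ring_1)"
  using keys_mult[of "Poly_Mapping.single 0 c" f] by (auto split: if_splits)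

lemma keys_linear_extension:
  assumes "\<And>t. t \<in> Poly_Mapping.keys f \<Longrightarrow> Poly_Mapping.keys (F t) \<subseteq> A"
  shows "Poly_Mapping.keys (linear_extension F f) \<subseteq> A"
proof -
  have "Poly_Mapping.keys (linear_extension F f) \<subseteq>
      (\<Union>t\<in>Poly_Mapping.keys f. Poly_Mapping.keys (Poly_Mapping.single 0 (Poly_Mapping.lookup f t) * F t))"
    unfolding linear_extension_def by (rule keys_sum)
  also have "\<dots> \<subseteq> A"
    using assms keys_scale by blast
  finally show ?thesis .
qed

lemma keys_uminus: "Poly_Mapping.keys (- f) = Poly_Mapping.keys (f :: 'a \<Rightarrow>\<^sub>0 'b::ab_group_add)"
  by (auto simp: in_keys_iff)

lemma keys_minus_subset:
  "Poly_Mapping.keys (f - g :: 'a \<Rightarrow>\<^sub>0 'b::ab_group_add) \<subseteq> Poly_Mapping.keys f \<union> Poly_Mapping.keys g"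
  by (auto simp: in_keys_iff lookup_minus)

text \<open>
  For an ideal \<open>N\<close> these are the polynomials which vanish modulo \<open>N\<close>, so two polynomials are congruent
  if their difference is of this kind.
\<close>

definition coeffs_in :: "'r set \<Rightarrow> ('x pterm \<Rightarrow>\<^sub>0 'r::comm_ring_1) set" where
  "coeffs_in N = {f. \<forall>t. Poly_Mapping.lookup f t \<in> N}"

lemma coeffs_in_iff: 
  assumes "ring_module.subspace N"
  shows "f \<in> coeffs_in N \<longleftrightarrow> coeff_set f \<subseteq> N"
proof -
  have "Poly_Mapping.lookup f t \<in> N" if "t \<notin> Poly_Mapping.keys f" for t
    using that ring_module.subspace_0[OF assms] by (simp add: in_keys_iff)
  then show ?thesis
    by (auto simp: coeffs_in_def coeff_set_def)
qed

lemma subspace_coeffs_in: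
  assumes N: "ring_module.subspace N"
  shows "ring_module.subspace (coeffs_in N :: ('x pterm \<Rightarrow>\<^sub>0 'r::comm_ring_1) set)"
proof (rule ring_module.subspaceI)
  show "0 \<in> coeffs_in N"
    using ring_module.subspace_0[OF N] by (simp add: coeffs_in_def)
next
  show "f + g \<in> coeffs_in N" if "f \<in> coeffs_in N" "g \<in> coeffs_in N" for f g :: "'x pterm \<Rightarrow>\<^sub>0 'r"
    using that ring_module.subspace_add[OF N] by (simp add: coeffs_in_def lookup_add)
next
  fix p f :: "'x pterm \<Rightarrow>\<^sub>0 'r"
  assume f: "f \<in> coeffs_in N"
  have "p * f = (\<Sum>t\<in>Poly_Mapping.keys f. p * Poly_Mapping.single t (Poly_Mapping.lookup f t))"
    by (subst poly_expand[of f]) (simp add: sum_distrib_left)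
  moreover have "p * Poly_Mapping.single t c \<in> coeffs_in N" if "c \<in> N" for t c
  proof -
    have "p * Poly_Mapping.single t c =
        (\<Sum>s\<in>Poly_Mapping.keys p. Poly_Mapping.single (s + t) (Poly_Mapping.lookup p s * c))"
      by (subst poly_expand[of p]) (simp add: sum_distrib_right mult_single)
    then show ?thesis
      using that N by (auto simp: coeffs_in_def lookup_sum lookup_single when_def
          intro!: ring_module.subspace_sum ring_module.subspace_scale ring_module.subspace_0)
  qed
  ultimately show "p * f \<in> coeffs_in N"
    using f N unfolding coeffs_in_def mem_Collect_eq
    by (simp add: lookup_sum) (blast intro!: ring_module.subspace_sum)
qed

section \<open>Reduction by marked sets\<close>

text \<open>
  What the two reductions have in common: the cones of the head terms partition the terms outside \<open>\<O>\<close>,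
  and a reduction step replaces such a term by terms which are in \<open>\<O>\<close> or smaller with respect to a
  well-founded relation.
\<close>

locale marked_reduction =
  fixes \<O> :: "'x pterm set" and I :: "nat set" and \<tau> :: "nat \<Rightarrow> 'x pterm"
    and T :: "nat \<Rightarrow> 'x pterm set" and tail :: "nat \<Rightarrow> 'x pterm \<Rightarrow>\<^sub>0 'r::comm_ring_1"
    and r :: "'x pterm rel"
  assumes wf_r: "wf r"
    and keys_tail: "\<And>i. i \<in> I \<Longrightarrow> Poly_Mapping.keys (tail i) \<subseteq> \<O>"
    and cone_outside: "\<And>i \<eta>. i \<in> I \<Longrightarrow> \<eta> \<in> T i \<Longrightarrow> \<eta> + \<tau> i \<notin> \<O>"
    and cone_exists: "\<And>t. t \<notin> \<O> \<Longrightarrow> \<exists>i\<in>I. \<exists>\<eta>\<in>T i. t = \<eta> + \<tau> i"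
    and cone_unique: "\<And>i j \<eta> \<eta>'. i \<in> I \<Longrightarrow> j \<in> I \<Longrightarrow> \<eta> \<in> T i \<Longrightarrow> \<eta>' \<in> T j \<Longrightarrow>
      \<eta> + \<tau> i = \<eta>' + \<tau> j \<Longrightarrow> i = j"
    and decrease: "\<And>i \<eta> s. i \<in> I \<Longrightarrow> \<eta> \<in> T i \<Longrightarrow> s \<in> \<O> \<Longrightarrow> \<eta> + s \<notin> \<O> \<Longrightarrow> (\<eta> + s, \<eta> + \<tau> i) \<in> r"
begin

definition b :: "nat \<Rightarrow> 'x pterm \<Rightarrow>\<^sub>0 'r" where
  "b i = Poly_Mapping.single (\<tau> i) 1 - tail i"

definition cone_index :: "'x pterm \<Rightarrow> nat" where
  "cone_index t = (SOME i. i \<in> I \<and> (\<exists>\<eta>\<in>T i. t = \<eta> + \<tau> i))"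

lemma cone_index:
  assumes "t \<notin> \<O>"
  shows "cone_index t \<in> I" "t - \<tau> (cone_index t) \<in> T (cone_index t)"
    "t - \<tau> (cone_index t) + \<tau> (cone_index t) = t"
proof -
  have *: "\<exists>i. i \<in> I \<and> (\<exists>\<eta>\<in>T i. t = \<eta> + \<tau> i)"
    using cone_exists[OF assms] by blast
  obtain \<eta> where "cone_index t \<in> I" "\<eta> \<in> T (cone_index t)" "t = \<eta> + \<tau> (cone_index t)"
    using someI_ex[OF *] unfolding cone_index_def by blast
  moreover from this(3) have "t - \<tau> (cone_index t) = \<eta>"
    by (metis add_diff_cancel_right')
  ultimately show "cone_index t \<in> I" "t - \<tau> (cone_index t) \<in> T (cone_index t)"
    "t - \<tau> (cone_index t) + \<tau> (cone_index t) = t"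
    by simp_all
qed

lemma cone_index_eq:
  assumes "i \<in> I" "\<eta> \<in> T i"
  shows "cone_index (\<eta> + \<tau> i) = i"
  using cone_index[OF cone_outside[OF assms]] cone_unique assms by metis

text \<open>
  The relation \<open>r\<close> only concerns terms outside \<open>\<O>\<close>. Placing the terms of \<open>\<O>\<close> below all others makes every
  term produced by a step smaller than the term that is reduced.
\<close>

definition outside_first :: "'x pterm rel" where
  "outside_first = inv_image (less_than <*lex*> r) (\<lambda>t. (if t \<in> \<O> then 0 else 1, t))"

lemma wf_outside_first: "wf outside_first"
  unfolding outside_first_def using wf_r by (intro wf_inv_image wf_lex_prod) auto

text \<open>
  The reduced form of a single term. Because the cones are disjoint, there is just one way to reduce it,
  and the linear extension of this function describes the outcome of every reduction.
\<close>

function nf_term :: "'x pterm \<Rightarrow> 'x pterm \<Rightarrow>\<^sub>0 'r" where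
  "nf_term t = (if t \<in> \<O> then Poly_Mapping.single t 1 else
     \<Sum>s\<in>Poly_Mapping.keys (tail (cone_index t)).
       Poly_Mapping.single 0 (Poly_Mapping.lookup (tail (cone_index t)) s) * nf_term (t - \<tau> (cone_index t) + s))"
  by auto
termination
proof (relation outside_first)
  fix t s assume t: "t \<notin> \<O>" and s: "s \<in> Poly_Mapping.keys (tail (cone_index t))"
  show "(t - \<tau> (cone_index t) + s, t) \<in> outside_first"
    using decrease[OF cone_index(1,2)[OF t], of s] keys_tail[OF cone_index(1)[OF t]] s t
    by (auto simp: outside_first_def cone_index(3)[OF t])
qed (rule wf_outside_first)

declare nf_term.simps [simp del]

definition nf :: "('x pterm \<Rightarrow>\<^sub>0 'r) \<Rightarrow> ('x pterm \<Rightarrow>\<^sub>0 'r)" where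
  "nf = linear_extension nf_term"

lemma nf_term_inside: "t \<in> \<O> \<Longrightarrow> nf_term t = Poly_Mapping.single t 1"
  by (simp add: nf_term.simps)

lemma nf_term_cone:
  assumes "i \<in> I" "\<eta> \<in> T i"
  shows "nf_term (\<eta> + \<tau> i) = nf (Poly_Mapping.single \<eta> 1 * tail i)"
  using cone_outside[OF assms]
  by (subst nf_term.simps)
    (simp add: cone_index_eq[OF assms] nf_def linear_extension_monom_mult, simp add: linear_extension_def)

lemma keys_nf_term: "Poly_Mapping.keys (nf_term t) \<subseteq> \<O>"
proof (induction t rule: wf_induct_rule[OF wf_outside_first])
  case (1 t)
  show ?case
  proof (cases "t \<in> \<O>")
    case False
    have "(t - \<tau> (cone_index t) + s, t) \<in> outside_first"
      if "s \<in> Poly_Mapping.keys (tail (cone_index t))" for s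
      using decrease[OF cone_index(1,2)[OF False], of s] keys_tail[OF cone_index(1)[OF False]] that False
      by (auto simp: outside_first_def cone_index(3)[OF False])
    then show ?thesis
      using nf_term_cone[OF cone_index(1,2)[OF False]] 1 unfolding cone_index(3)[OF False]
      by (auto simp: nf_def linear_extension_monom_mult intro!: keys_linear_extension)
  qed (simp add: nf_term_inside)
qed

lemma keys_nf: "Poly_Mapping.keys (nf f) \<subseteq> \<O>"
  unfolding nf_def using keys_nf_term by (rule keys_linear_extension)

lemmas nf_diff = linear_extension_diff[of nf_term, folded nf_def]
  and nf_scale = linear_extension_scale[of nf_term, folded nf_def]
  and nf_single = linear_extension_single[of nf_term, folded nf_def]

lemma nf_reduced: "Poly_Mapping.keys f \<subseteq> \<O> \<Longrightarrow> nf f = f"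
  using linear_extension_cong[of f nf_term "\<lambda>t. Poly_Mapping.single t 1"]
  by (simp add: nf_def nf_term_inside linear_extension_monomials subset_iff)

lemma nf_cone:
  assumes "i \<in> I" "\<eta> \<in> T i"
  shows "nf (Poly_Mapping.single \<eta> c * b i) = 0"
proof -
  have "Poly_Mapping.single \<eta> c * b i = Poly_Mapping.single 0 c * (Poly_Mapping.single \<eta> 1 * b i)"
    by (simp add: mult_single mult.assoc[symmetric])
  moreover have "nf (Poly_Mapping.single \<eta> 1 * b i) = 0"
    using nf_term_cone[OF assms] by (simp add: b_def right_diff_distrib nf_diff mult_single nf_single)
  ultimately show ?thesis
    by (simp only: nf_scale mult_zero_right)
qed

abbreviation step :: "('x pterm \<Rightarrow>\<^sub>0 'r) \<Rightarrow> ('x pterm \<Rightarrow>\<^sub>0 'r) \<Rightarrow> bool" where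
  "step \<equiv> reduction_step I \<tau> T b"

text \<open>
  Steps subtract multiplicative multiples of marked polynomials. Those have normal form zero, so the
  normal form is an invariant of the reduction.
\<close>

lemma nf_steps: "step\<^sup>*\<^sup>* g h \<Longrightarrow> nf h = nf g \<and> g - h \<in> ring_module.span (b ` I)"
proof (induction rule: rtranclp_induct)
  case (step h h')
  then obtain i \<eta> c where i: "i \<in> I" "\<eta> \<in> T i" and h': "h' = h - Poly_Mapping.single \<eta> c * b i"
    unfolding reduction_step_def by blast
  have "Poly_Mapping.single \<eta> c * b i \<in> ring_module.span (b ` I)"
    using i by (intro ring_module.span_scale ring_module.span_base) auto
  then have "g - h + Poly_Mapping.single \<eta> c * b i \<in> ring_module.span (b ` I)"
    using step by (intro ring_module.span_add) auto
  moreover have "g - h' = g - h + Poly_Mapping.single \<eta> c * b i"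
    by (simp add: h')
  ultimately have "g - h' \<in> ring_module.span (b ` I)"
    by (simp only:)
  moreover have "nf h' = nf g"
    using step nf_cone[OF i] by (simp add: h' nf_diff)
  ultimately show ?case
    by blast
qed (simp add: ring_module.span_zero)

text \<open>
  A step removes one term outside \<open>\<O>\<close> from the support, and the terms outside \<open>\<O>\<close> which it adds are smaller.
  Hence the multiset of the terms outside \<open>\<O>\<close> decreases.
\<close>

lemma ex_reduced: "\<exists>h. Poly_Mapping.keys h \<subseteq> \<O> \<and> step\<^sup>*\<^sup>* g h"
proof (induction g rule: wf_induct_rule[OF wf_inv_image[OF wf_mult[OF wf_r],
      of "\<lambda>g. mset_set (Poly_Mapping.keys g - \<O>)"]])
  case (1 g)
  show ?case
  proof (cases "Poly_Mapping.keys g \<subseteq> \<O>")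
    case False
    then obtain t where t: "t \<in> Poly_Mapping.keys g" "t \<notin> \<O>"
      by auto
    define i \<eta> where "i = cone_index t" and "\<eta> = t - \<tau> i"
    have i: "i \<in> I" "\<eta> \<in> T i" "\<eta> + \<tau> i = t"
      using cone_index[OF t(2)] by (simp_all add: i_def \<eta>_def)
    define c where "c = Poly_Mapping.lookup g t"
    define g' where "g' = g - Poly_Mapping.single \<eta> c * b i"
    have st: "step g g'"
      unfolding reduction_step_def g'_def c_def using i t by blast
    have g': "g' = g - Poly_Mapping.single t c + Poly_Mapping.single \<eta> c * tail i"
      using i by (simp add: g'_def b_def right_diff_distrib mult_single)
    have tail: "Poly_Mapping.keys (Poly_Mapping.single \<eta> c * tail i) \<subseteq> (+) \<eta> ` Poly_Mapping.keys (tail i)"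
      using keys_mult[of "Poly_Mapping.single \<eta> c" "tail i"] by (auto split: if_splits)
    have smaller: "(s, t) \<in> r" if "s \<in> Poly_Mapping.keys (Poly_Mapping.single \<eta> c * tail i) - \<O>" for s
      using that tail keys_tail[OF i(1)] decrease[OF i(1,2)] i(3) by blast
    have "wf r" by (rule wf_r)
    then have "(t, t) \<notin> r" by simp
    then have "Poly_Mapping.lookup (Poly_Mapping.single \<eta> c * tail i) t = 0"
      using smaller t(2) by (auto simp: in_keys_iff)
    then have t': "t \<notin> Poly_Mapping.keys g'"
      by (simp add: g' in_keys_iff lookup_add lookup_minus c_def)
    define A B where "A = Poly_Mapping.keys g - \<O>" and "B = Poly_Mapping.keys g' - \<O>"
    have fin: "finite A" "finite B"
      by (simp_all add: A_def B_def)
    have new: "(s, t) \<in> r" if "s \<in> B - A" for s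
    proof -
      have "s \<noteq> t" using that t' by (auto simp: B_def)
      then have "Poly_Mapping.lookup (Poly_Mapping.single \<eta> c * tail i) s \<noteq> 0"
        using that by (auto simp: A_def B_def g' in_keys_iff lookup_add lookup_minus lookup_single)
      then show ?thesis
        using smaller that by (auto simp: B_def in_keys_iff)
    qed
    have "mset_set (A \<inter> B \<union> (A - B)) = mset_set (A \<inter> B) + mset_set (A - B)"
      using fin by (intro mset_set_Union) auto
    moreover have "mset_set (A \<inter> B \<union> (B - A)) = mset_set (A \<inter> B) + mset_set (B - A)"
      using fin by (intro mset_set_Union) auto
    moreover have "A \<inter> B \<union> (A - B) = A" "A \<inter> B \<union> (B - A) = B"
      by auto
    ultimately have AB: "mset_set A = mset_set (A \<inter> B) + mset_set (A - B)"
      "mset_set B = mset_set (A \<inter> B) + mset_set (B - A)"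
      by simp_all
    have tAB: "t \<in> A - B"
      using t t' by (auto simp: A_def B_def)
    have "(mset_set (A \<inter> B) + mset_set (B - A), mset_set (A \<inter> B) + mset_set (A - B)) \<in> mult r"
    proof (rule one_step_implies_mult)
      show "mset_set (A - B) \<noteq> {#}"
        using tAB fin by (auto simp: mset_set_empty_iff)
      show "\<forall>k\<in>set_mset (mset_set (B - A)). \<exists>j\<in>set_mset (mset_set (A - B)). (k, j) \<in> r"
        using new tAB fin by auto
    qed
    then have "(mset_set B, mset_set A) \<in> mult r"
      unfolding AB[symmetric] .
    then obtain h where "Poly_Mapping.keys h \<subseteq> \<O>" "step\<^sup>*\<^sup>* g' h"
      using 1[of g'] by (auto simp: A_def B_def)
    then show ?thesis
      using st by (meson converse_rtranclp_into_rtranclp)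
  qed auto
qed

text \<open>
  An \<open>\<O>\<close>-reduced polynomial is its own normal form. As normal forms are invariant, every complete
  reduction of \<open>g\<close> must therefore end in the normal form of \<open>g\<close>.
\<close>

lemma reduced_form_eq_nf: "reduced_form \<O> I \<tau> T b g = nf g"
  unfolding reduced_form_def
proof (rule the_equality)
  have *: "h = nf g" if "Poly_Mapping.keys h \<subseteq> \<O>" "step\<^sup>*\<^sup>* g h" for h
    using nf_steps[OF that(2)] nf_reduced[OF that(1)] by simp
  then show "h = nf g" if "Poly_Mapping.keys h \<subseteq> \<O> \<and> step\<^sup>*\<^sup>* g h" for h
    using that by blast
  show "Poly_Mapping.keys (nf g) \<subseteq> \<O> \<and> step\<^sup>*\<^sup>* g (nf g)"
    using ex_reduced[of g] * by blast
qed

lemma diff_nf_in_span: "g - nf g \<in> ring_module.span (b ` I)"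
proof -
  obtain h where h: "Poly_Mapping.keys h \<subseteq> \<O>" "step\<^sup>*\<^sup>* g h"
    using ex_reduced by blast
  then have "h = nf g"
    using nf_steps[OF h(2)] nf_reduced[OF h(1)] by simp
  then show ?thesis
    using nf_steps[OF h(2)] by simp
qed

end

section \<open>Terms and order ideals\<close>

lemma lookup_var: "Poly_Mapping.lookup (var x) y = (if x = y then 1 else 0)"
  by (simp add: var_def lookup_single when_def)

lemma term_dvd_iff: "term_dvd \<alpha> \<beta> \<longleftrightarrow> (\<forall>x. Poly_Mapping.lookup \<alpha> x \<le> Poly_Mapping.lookup \<beta> x)"
proof
  assume "\<forall>x. Poly_Mapping.lookup \<alpha> x \<le> Poly_Mapping.lookup \<beta> x"
  then have "\<beta> = (\<beta> - \<alpha>) + \<alpha>"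
    by (intro poly_mapping_eqI) (simp add: lookup_add lookup_minus)
  then show "term_dvd \<alpha> \<beta>"
    unfolding term_dvd_def by blast
qed (auto simp: term_dvd_def lookup_add)

lemma term_dvd_diff: "term_dvd \<alpha> \<beta> \<Longrightarrow> \<beta> - \<alpha> + \<alpha> = \<beta>"
  by (auto simp: term_dvd_def)

lemma var_dvd: "x \<in> Poly_Mapping.keys \<alpha> \<Longrightarrow> term_dvd (var x) \<alpha>"
  by (auto simp: term_dvd_iff lookup_var in_keys_iff)

lemma minus_var: "x \<in> Poly_Mapping.keys \<alpha> \<Longrightarrow> var x + (\<alpha> - var x) = \<alpha>"
  using term_dvd_diff[OF var_dvd] by (simp add: add.commute)

lemma term_deg_add: "term_deg (\<alpha> + \<beta>) = term_deg \<alpha> + term_deg \<beta>"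
  by (simp add: term_deg_def lookup_add sum.distrib)

lemma term_deg_var [simp]: "term_deg (var x) = 1"
  by (simp add: term_deg_def lookup_var)

lemma term_deg_0 [simp]: "term_deg 0 = 0"
  by (simp add: term_deg_def)

lemma term_deg_eq_0 [simp]: "term_deg \<alpha> = 0 \<longleftrightarrow> \<alpha> = 0"
  by (auto simp: term_deg_def poly_mapping_eq_iff fun_eq_iff)

lemma keys_var [simp]: "Poly_Mapping.keys (var x) = {x}"
  by (simp add: var_def)

lemma keys_term_add: "Poly_Mapping.keys (\<alpha> + \<beta> :: 'x pterm) = Poly_Mapping.keys \<alpha> \<union> Poly_Mapping.keys \<beta>"
  by (auto simp: in_keys_iff lookup_add)

lemma term_deg_minus_var: "x \<in> Poly_Mapping.keys \<alpha> \<Longrightarrow> term_deg (\<alpha> - var x) < term_deg \<alpha>"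
  using term_deg_add[of "var x" "\<alpha> - var x"] by (simp add: minus_var)

lemma term_induct [case_names one mult]:
  fixes t :: "'x::finite pterm"
  assumes "P 0" "\<And>x t. P t \<Longrightarrow> P (var x + t)"
  shows "P t"
proof (induction "term_deg t" arbitrary: t rule: less_induct)
  case less
  show ?case
  proof (cases "t = 0")
    case False
    then obtain x where x: "x \<in> Poly_Mapping.keys t"
      using keys_eq_empty by blast
    then have "P (var x + (t - var x))"
      using less term_deg_minus_var assms(2) by blast
    then show ?thesis
      by (simp add: minus_var[OF x])
  qed (simp add: assms)
qed

lemma min_var:
  assumes "\<alpha> \<noteq> 0"
  shows "min_var \<alpha> \<in> Poly_Mapping.keys \<alpha>" "\<And>x. x \<in> Poly_Mapping.keys \<alpha> \<Longrightarrow> min_var \<alpha> \<le> x"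
proof -
  have "Poly_Mapping.keys \<alpha> \<noteq> {}"
    using assms by simp
  then show "min_var \<alpha> \<in> Poly_Mapping.keys \<alpha>" "\<And>x. x \<in> Poly_Mapping.keys \<alpha> \<Longrightarrow> min_var \<alpha> \<le> x"
    by (simp_all add: min_var_def)
qed

text \<open>The lexicographic order in which the largest variable is compared first.\<close>

definition lex_less :: "'x::linorder pterm \<Rightarrow> 'x pterm \<Rightarrow> bool" where
  "lex_less \<alpha> \<beta> \<longleftrightarrow> (\<exists>x. Poly_Mapping.lookup \<alpha> x < Poly_Mapping.lookup \<beta> x \<and>
     (\<forall>y>x. Poly_Mapping.lookup \<alpha> y = Poly_Mapping.lookup \<beta> y))"

lemma lex_less_trans: "lex_less \<alpha> \<beta> \<Longrightarrow> lex_less \<beta> \<gamma> \<Longrightarrow> lex_less \<alpha> \<gamma>"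
  unfolding lex_less_def
proof (elim exE conjE)
  fix x y
  assume "Poly_Mapping.lookup \<alpha> x < Poly_Mapping.lookup \<beta> x" "\<forall>z>x. Poly_Mapping.lookup \<alpha> z = Poly_Mapping.lookup \<beta> z"
    "Poly_Mapping.lookup \<beta> y < Poly_Mapping.lookup \<gamma> y" "\<forall>z>y. Poly_Mapping.lookup \<beta> z = Poly_Mapping.lookup \<gamma> z"
  then show "\<exists>x. Poly_Mapping.lookup \<alpha> x < Poly_Mapping.lookup \<gamma> x \<and>
      (\<forall>y>x. Poly_Mapping.lookup \<alpha> y = Poly_Mapping.lookup \<gamma> y)"
    by (intro exI[of _ "max x y"]) (cases x y rule: linorder_cases; auto simp: max_def)
qed

lemma lex_less_add: "lex_less \<alpha> \<beta> \<Longrightarrow> lex_less (\<gamma> + \<alpha>) (\<gamma> + \<beta>)"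
  by (auto simp: lex_less_def lookup_add)

lemma lex_less_irrefl: "\<not> lex_less \<alpha> \<alpha>"
  by (auto simp: lex_less_def)

lemma lex_less_total:
  fixes \<alpha> \<beta> :: "'x::{finite,linorder} pterm"
  assumes "\<alpha> \<noteq> \<beta>"
  obtains x where "Poly_Mapping.lookup \<alpha> x \<noteq> Poly_Mapping.lookup \<beta> x"
    "\<And>y. y > x \<Longrightarrow> Poly_Mapping.lookup \<alpha> y = Poly_Mapping.lookup \<beta> y"
proof -
  let ?D = "{x. Poly_Mapping.lookup \<alpha> x \<noteq> Poly_Mapping.lookup \<beta> x}"
  have "?D \<noteq> {}"
    using assms by (auto simp: poly_mapping_eq_iff fun_eq_iff)
  then have "Max ?D \<in> ?D"
    by (intro Max_in) simp_all
  moreover have "y \<le> Max ?D" if "y \<in> ?D" for y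
    using that by (intro Max_ge) simp_all
  ultimately show ?thesis
    by (intro that[of "Max ?D"]) (use not_le in blast)+
qed

lemma wf_lex_less: "wf {(\<alpha>, \<beta> :: 'x::{finite,linorder} pterm). lex_less \<alpha> \<beta>}"
proof -
  (* exponents listed from the largest variable on, compared as lists of a fixed length *)
  define xs :: "'x list" where "xs = rev (sorted_list_of_set UNIV)"
  define e :: "'x pterm \<Rightarrow> nat list" where "e = (\<lambda>\<alpha>. map (Poly_Mapping.lookup \<alpha>) xs)"
  have "{(\<alpha>, \<beta> :: 'x pterm). lex_less \<alpha> \<beta>} \<subseteq> inv_image (lex less_than) e"
  proof (clarify)
    fix \<alpha> \<beta> :: "'x pterm"
    assume "lex_less \<alpha> \<beta>"
    then obtain x where x: "Poly_Mapping.lookup \<alpha> x < Poly_Mapping.lookup \<beta> x"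
      "\<And>y. y > x \<Longrightarrow> Poly_Mapping.lookup \<alpha> y = Poly_Mapping.lookup \<beta> y"
      by (auto simp: lex_less_def)
    have "x \<in> set xs"
      by (simp add: xs_def)
    then obtain us vs where xs: "xs = us @ x # vs"
      by (auto simp: in_set_conv_decomp)
    have "sorted_wrt (\<lambda>a b. a > b) xs"
      unfolding xs_def sorted_wrt_rev by (rule strict_sorted_list_of_set)
    then have "\<forall>u\<in>set us. u > x"
      by (auto simp: xs sorted_wrt_append)
    then have "map (Poly_Mapping.lookup \<alpha>) us = map (Poly_Mapping.lookup \<beta>) us"
      using x(2) by auto
    then show "(\<alpha>, \<beta>) \<in> inv_image (lex less_than) e"
      using x(1) by (auto simp: lex_conv e_def xs in_inv_image intro!: exI[of _ "map (Poly_Mapping.lookup \<beta>) us"])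
  qed
  then show ?thesis
    by (rule wf_subset[rotated]) (intro wf_inv_image wf_lex wf_less_than)
qed

text \<open>
  The cone of \<open>\<alpha>'\<close> only admits multipliers in small variables. Hence in a coincidence of products
  the multiplier of \<open>\<alpha>'\<close> is the lexicographically smaller one, as long as \<open>s\<close> is not itself in the cone.
\<close>

lemma pommaret_cone_lex:
  fixes \<alpha>' :: "'x::{finite,linorder} pterm"
  assumes eq: "\<eta>' + \<alpha>' = \<eta> + s" and \<eta>': "\<eta>' \<in> pommaret_mult \<alpha>'" and nz: "\<alpha>' \<noteq> 0"
  shows "lex_less \<eta>' \<eta> \<or> s \<in> pommaret_cone \<alpha>'"
proof (cases "\<eta>' = \<eta>")
  case True
  then have "s = 0 + \<alpha>'"
    using eq by simp
  then show ?thesis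
    unfolding pommaret_cone_def pommaret_mult_def by force
next
  case False
  then obtain x where x: "Poly_Mapping.lookup \<eta>' x \<noteq> Poly_Mapping.lookup \<eta> x"
    "\<And>y. y > x \<Longrightarrow> Poly_Mapping.lookup \<eta>' y = Poly_Mapping.lookup \<eta> y"
    by (rule lex_less_total) blast
  show ?thesis
  proof (cases "Poly_Mapping.lookup \<eta>' x < Poly_Mapping.lookup \<eta> x")
    case True
    then show ?thesis
      using x by (auto simp: lex_less_def)
  next
    case False
    (* x divides the multiplier \<eta>', so it is at most the smallest variable of \<alpha>' *)
    then have gt: "Poly_Mapping.lookup \<eta>' x > Poly_Mapping.lookup \<eta> x"
      using x by simp
    then have "x \<in> Poly_Mapping.keys \<eta>'"
      by (simp add: in_keys_iff)
    then have xm: "x \<le> min_var \<alpha>'"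
      using \<eta>' by (auto simp: pommaret_mult_def)
    have sum: "Poly_Mapping.lookup \<eta>' y + Poly_Mapping.lookup \<alpha>' y = Poly_Mapping.lookup \<eta> y + Poly_Mapping.lookup s y" for y
      using eq by (metis lookup_add)
    have above: "Poly_Mapping.lookup \<alpha>' y = Poly_Mapping.lookup s y" if "y > x" for y
      using sum[of y] x(2)[OF that] by simp
    have below: "Poly_Mapping.lookup \<alpha>' y = 0" if "y < x" for y
      using min_var(2)[OF nz, of y] that xm by (force simp: in_keys_iff)
    have "Poly_Mapping.lookup \<alpha>' y \<le> Poly_Mapping.lookup s y" for y
      using above[of y] below[of y] sum[of x] gt by (cases x y rule: linorder_cases) auto
    then have s: "s = (s - \<alpha>') + \<alpha>'"
      using term_dvd_diff[of \<alpha>' s] by (simp add: term_dvd_iff)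
    have "y \<le> min_var \<alpha>'" if "y \<in> Poly_Mapping.keys (s - \<alpha>')" for y
    proof -
      have "\<not> y > x"
        using that above[of y] by (auto simp: in_keys_iff lookup_minus)
      then show ?thesis
        using xm by simp
    qed
    then have "s - \<alpha>' \<in> pommaret_mult \<alpha>'"
      by (auto simp: pommaret_mult_def)
    then show ?thesis
      using s unfolding pommaret_cone_def by blast
  qed
qed

section \<open>The border and the Pommaret structure\<close>

locale marked_border =
  fixes \<O> :: "'x::{finite,linorder} pterm set" and \<tau> :: "nat \<Rightarrow> 'x pterm" and m :: nat
    and tail :: "nat \<Rightarrow> 'x pterm \<Rightarrow>\<^sub>0 'r::comm_ring_1"
  assumes order_ideal: "order_ideal \<O>"
    and bij_\<tau>: "bij_betw \<tau> {1..m} (border \<O>)"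
    and mono_\<tau>: "mono_on {1..m} (\<lambda>i. term_deg (\<tau> i))"
    and keys_tail: "\<And>i. i \<in> {1..m} \<Longrightarrow> Poly_Mapping.keys (tail i) \<subseteq> \<O>"
begin

lemma factor_inside: "\<alpha> + \<beta> \<in> \<O> \<Longrightarrow> \<alpha> \<in> \<O>" "\<alpha> + \<beta> \<in> \<O> \<Longrightarrow> \<beta> \<in> \<O>"
  using order_ideal unfolding order_ideal_def term_dvd_def by (metis add.commute)+

lemma one_inside: "0 \<in> \<O>"
proof -
  obtain s where "s \<in> \<O>"
    using order_ideal by (auto simp: order_ideal_def)
  then show ?thesis
    using factor_inside(1)[of 0 s] by simp
qed

lemma complement_ideal_eq: "complement_ideal \<O> = - \<O>"
proof -
  have "t \<in> complement_ideal \<O>" if "t \<notin> \<O>" for t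
    unfolding complement_ideal_def using that by (intro CollectI exI[of _ 0] exI[of _ t]) simp
  then show ?thesis
    using factor_inside(2) by (auto simp: complement_ideal_def)
qed

lemma \<tau>_border: "i \<in> {1..m} \<Longrightarrow> \<tau> i \<in> border \<O>"
  using bij_betw_imp_surj_on[OF bij_\<tau>] by blast

lemma \<tau>_outside: "i \<in> {1..m} \<Longrightarrow> \<tau> i \<notin> \<O>"
  using \<tau>_border by (auto simp: border_def)

lemma border_index: 
  assumes "t \<in> border \<O>"
  obtains i where "i \<in> {1..m}" "\<tau> i = t"
proof -
  have "t \<in> \<tau> ` {1..m}"
    using assms bij_betw_imp_surj_on[OF bij_\<tau>] by simp
  then show ?thesis
    using that by (elim imageE) simp
qed

lemma \<tau>_inj: "i \<in> {1..m} \<Longrightarrow> j \<in> {1..m} \<Longrightarrow> \<tau> i = \<tau> j \<Longrightarrow> i = j"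
  using bij_betw_imp_inj_on[OF bij_\<tau>] by (rule inj_onD)

lemma \<tau>_deg: "i \<in> {1..m} \<Longrightarrow> j \<in> {1..m} \<Longrightarrow> i \<le> j \<Longrightarrow> term_deg (\<tau> i) \<le> term_deg (\<tau> j)"
  using mono_onD[OF mono_\<tau>, of i j] by blast

text \<open>The distance of a term from \<open>\<O>\<close>, known as the index of the term in the theory of border bases.\<close>

definition excess :: "'x pterm \<Rightarrow> nat" where
  "excess t = (LEAST d. \<exists>\<gamma> s. s \<in> \<O> \<and> t = \<gamma> + s \<and> d = term_deg \<gamma>)"

lemma excess_le: "s \<in> \<O> \<Longrightarrow> excess (\<gamma> + s) \<le> term_deg \<gamma>"
  unfolding excess_def by (rule Least_le) blast

text \<open>
  A shortest way from \<open>\<O>\<close> to \<open>t\<close> leaves \<open>\<O>\<close> with its first step, which ends in a border term.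
\<close>

lemma excess_border:
  assumes "t \<notin> \<O>"
  obtains \<gamma> j where "j \<in> {1..m}" "t = \<gamma> + \<tau> j" "excess t = Suc (term_deg \<gamma>)"
proof -
  have ex: "\<exists>d \<gamma> s. s \<in> \<O> \<and> t = \<gamma> + s \<and> d = term_deg \<gamma>"
    using one_inside by (intro exI[of _ "term_deg t"] exI[of _ t] exI[of _ 0]) simp
  have "\<exists>\<gamma> s. s \<in> \<O> \<and> t = \<gamma> + s \<and> excess t = term_deg \<gamma>"
    unfolding excess_def by (rule LeastI_ex[OF ex])
  then obtain \<gamma> s where s: "s \<in> \<O>" "t = \<gamma> + s" "excess t = term_deg \<gamma>"
    by blast
  then have "\<gamma> \<noteq> 0"
    using assms by auto
  then obtain x where x: "x \<in> Poly_Mapping.keys \<gamma>"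
    using keys_eq_empty by blast
  have t: "t = (\<gamma> - var x) + (var x + s)"
    using s(2) minus_var[OF x] by (metis add.assoc add.commute)
  have "var x + s \<notin> \<O>"
    using excess_le[of "var x + s" "\<gamma> - var x"] term_deg_minus_var[OF x] s(3) t by auto
  then have "var x + s \<in> border \<O>"
    using s(1) by (auto simp: border_def)
  then obtain j where "j \<in> {1..m}" "\<tau> j = var x + s"
    by (rule border_index)
  moreover have "excess t = Suc (term_deg (\<gamma> - var x))"
    using s(3) term_deg_add[of "var x" "\<gamma> - var x"] by (simp add: minus_var[OF x])
  ultimately show ?thesis
    using t that by metis
qed

lemma border_mult_index:
  assumes "\<eta> \<in> border_mult \<tau> m i" "j \<in> {1..m}" "\<eta> + \<tau> i = \<gamma> + \<tau> j"
  shows "j \<le> i"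
proof (rule ccontr)
  assume "\<not> j \<le> i"
  then have "\<not> term_dvd (\<tau> j) (\<tau> i + \<eta>)"
    using assms(1,2) by (simp add: border_mult_def)
  then show False
    using assms(3) by (auto simp: term_dvd_def add.commute)
qed

text \<open>
  The border is enumerated by increasing degree. So the last border term dividing \<open>t\<close> leaves the cofactor
  of the least degree, namely \<open>excess t - 1\<close>. Applied to a term of \<open>\<O>\<close> this cofactor yields a term
  whose excess is at most \<open>excess t - 1\<close>, and the reduction terminates.
\<close>

sublocale B: marked_reduction \<O> "{1..m}" \<tau> "border_mult \<tau> m" tail "measure excess"
proof
  show "Poly_Mapping.keys (tail i) \<subseteq> \<O>" if "i \<in> {1..m}" for i
    using that by (rule keys_tail)
  show "\<eta> + \<tau> i \<notin> \<O>" if "i \<in> {1..m}" "\<eta> \<in> border_mult \<tau> m i" for i \<eta>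
    using \<tau>_outside[OF that(1)] factor_inside(2) by blast
  show "\<exists>i\<in>{1..m}. \<exists>\<eta>\<in>border_mult \<tau> m i. t = \<eta> + \<tau> i" if "t \<notin> \<O>" for t
  proof -
    let ?J = "{j \<in> {1..m}. term_dvd (\<tau> j) t}"
    have "?J \<noteq> {}"
      using excess_border[OF that] by (force simp: term_dvd_def)
    then have i: "Max ?J \<in> ?J"
      by (intro Max_in) simp_all
    have "t - \<tau> (Max ?J) \<in> border_mult \<tau> m (Max ?J)"
      unfolding border_mult_def
    proof (intro CollectI ballI notI)
      fix j assume j: "j \<in> {Max ?J<..m}" "term_dvd (\<tau> j) (\<tau> (Max ?J) + (t - \<tau> (Max ?J)))"
      moreover have "\<tau> (Max ?J) + (t - \<tau> (Max ?J)) = t"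
        using i term_dvd_diff[of "\<tau> (Max ?J)" t] by (simp add: add.commute)
      ultimately have "j \<in> ?J"
        using i by simp
      then have "j \<le> Max ?J"
        by (intro Max_ge) simp_all
      then show False
        using j by simp
    qed
    then show ?thesis
      using i term_dvd_diff[of "\<tau> (Max ?J)" t] by (metis (no_types, lifting) mem_Collect_eq)
  qed
  show "i = j" if "i \<in> {1..m}" "j \<in> {1..m}" "\<eta> \<in> border_mult \<tau> m i" "\<eta>' \<in> border_mult \<tau> m j"
    "\<eta> + \<tau> i = \<eta>' + \<tau> j" for i j \<eta> \<eta>'
    using that border_mult_index by (metis antisym)
  show "(\<eta> + s, \<eta> + \<tau> i) \<in> measure excess"
    if i: "i \<in> {1..m}" and \<eta>: "\<eta> \<in> border_mult \<tau> m i" and s: "s \<in> \<O>" for i \<eta> s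
  proof -
    have "\<eta> + \<tau> i \<notin> \<O>"
      using \<tau>_outside[OF i] factor_inside(2) by blast
    then obtain \<gamma> j where j: "j \<in> {1..m}" "\<eta> + \<tau> i = \<gamma> + \<tau> j" "excess (\<eta> + \<tau> i) = Suc (term_deg \<gamma>)"
      by (rule excess_border)
    then have "j \<le> i"
      using border_mult_index[OF \<eta>] by blast
    then have "term_deg \<eta> \<le> term_deg \<gamma>"
      using arg_cong[OF j(2), of term_deg] \<tau>_deg[OF j(1) i] by (simp add: term_deg_add)
    then show ?thesis
      using excess_le[OF s, of \<eta>] j(3) by simp
  qed
qed simp

abbreviation P_indices :: "nat set" where
  "P_indices \<equiv> pommaret_indices \<O> \<tau> m"

lemma pommaret_basis_iff: "\<alpha> \<in> pommaret_basis \<O> \<longleftrightarrow> \<alpha> \<notin> \<O> \<and> \<alpha> - var (min_var \<alpha>) \<in> \<O>"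
  by (auto simp: pommaret_basis_def complement_ideal_eq)

lemma outside_neq_0: "\<alpha> \<notin> \<O> \<Longrightarrow> \<alpha> \<noteq> 0"
  using one_inside by auto

lemma pommaret_basis_border: "\<alpha> \<in> pommaret_basis \<O> \<Longrightarrow> \<alpha> \<in> border \<O>"
  unfolding pommaret_basis_iff border_def
  using minus_var[OF min_var(1)[OF outside_neq_0]] by (metis (mono_tags, lifting) DiffI mem_Collect_eq)

lemma P_index:
  assumes "\<alpha> \<in> pommaret_basis \<O>"
  obtains i where "i \<in> P_indices" "\<tau> i = \<alpha>"
  using border_index[OF pommaret_basis_border[OF assms]] assms by (auto simp: pommaret_indices_def)

lemma P_indices_subset: "P_indices \<subseteq> {1..m}"
  by (auto simp: pommaret_indices_def)

lemma P_indices_basis: "i \<in> P_indices \<Longrightarrow> \<tau> i \<in> pommaret_basis \<O>"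
  by (simp add: pommaret_indices_def)

text \<open>
  Divide by the smallest variable until another division would lead into \<open>\<O>\<close>. The smallest variables
  met on the way increase, so their product is a multiplier for the cone of the term where this ends.
\<close>

lemma pommaret_cone_exists:
  assumes "t \<notin> \<O>"
  shows "\<exists>i\<in>P_indices. \<exists>\<eta>\<in>pommaret_mult (\<tau> i). t = \<eta> + \<tau> i"
  using assms
proof (induction "term_deg t" arbitrary: t rule: less_induct)
  case less
  let ?x = "min_var t"
  have x: "?x \<in> Poly_Mapping.keys t"
    using min_var(1) outside_neq_0 less.prems by blast
  show ?case
  proof (cases "t - var ?x \<in> \<O>")
    case True
    then have "t \<in> pommaret_basis \<O>"
      using less.prems by (simp add: pommaret_basis_iff)
    then obtain i where "i \<in> P_indices" "\<tau> i = t"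
      by (rule P_index)
    then show ?thesis
      by (intro bexI[of _ i] bexI[of _ 0]) (auto simp: pommaret_mult_def)
  next
    case False
    then obtain i \<eta> where i: "i \<in> P_indices" "\<eta> \<in> pommaret_mult (\<tau> i)" "t - var ?x = \<eta> + \<tau> i"
      using less.hyps[OF term_deg_minus_var[OF x]] by blast
    have t: "t = (var ?x + \<eta>) + \<tau> i"
      using minus_var[OF x] i(3) by (simp add: add.assoc)
    have "\<tau> i \<noteq> 0"
      using i(1) P_indices_subset \<tau>_outside outside_neq_0 by blast
    then have "?x \<le> min_var (\<tau> i)"
      using min_var(1)[of "\<tau> i"] t min_var(2)[of t] keys_term_add x
      by (metis UnCI emptyE keys_zero)
    then have "var ?x + \<eta> \<in> pommaret_mult (\<tau> i)"
      using i(2) by (auto simp: pommaret_mult_def keys_term_add)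
    then show ?thesis
      using i(1) t by blast
  qed
qed

text \<open>
  If the multiplier \<open>\<delta>\<close> were not \<open>1\<close>, the smallest variable of \<open>\<alpha>\<close> would divide \<open>\<delta>\<close>, and dividing \<open>\<alpha>\<close> by it
  would leave a multiple of \<open>\<alpha>'\<close>, which is outside \<open>\<O>\<close>.
\<close>

lemma pommaret_cone_basis:
  assumes \<alpha>: "\<alpha> \<in> pommaret_basis \<O>" and \<alpha>': "\<alpha>' \<notin> \<O>" and c: "\<alpha> \<in> pommaret_cone \<alpha>'"
  shows "\<alpha> = \<alpha>'"
proof (rule ccontr)
  assume neq: "\<alpha> \<noteq> \<alpha>'"
  from c obtain \<delta> where \<delta>: "\<alpha> = \<delta> + \<alpha>'" "\<delta> \<in> pommaret_mult \<alpha>'"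
    by (auto simp: pommaret_cone_def)
  have nz: "\<delta> \<noteq> 0" "\<alpha>' \<noteq> 0" "\<alpha> \<noteq> 0"
    using neq \<delta>(1) \<alpha>' \<alpha> outside_neq_0 by (auto simp: pommaret_basis_iff)
  have "min_var \<alpha> \<in> Poly_Mapping.keys \<delta>"
  proof (rule ccontr)
    assume *: "min_var \<alpha> \<notin> Poly_Mapping.keys \<delta>"
    have keys: "Poly_Mapping.keys \<alpha> = Poly_Mapping.keys \<delta> \<union> Poly_Mapping.keys \<alpha>'"
      by (simp add: \<delta>(1) keys_term_add)
    then have "min_var \<alpha> \<in> Poly_Mapping.keys \<alpha>'"
      using * min_var(1)[OF nz(3)] by auto
    then have "min_var \<alpha>' \<le> min_var \<alpha>"
      by (rule min_var(2)[OF nz(2)])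
    moreover have "min_var \<delta> \<le> min_var \<alpha>'"
      using \<delta>(2) min_var(1)[OF nz(1)] by (auto simp: pommaret_mult_def)
    moreover have "min_var \<alpha> \<le> min_var \<delta>"
      using keys min_var(1)[OF nz(1)] by (intro min_var(2)[OF nz(3)]) auto
    ultimately have "min_var \<alpha> = min_var \<delta>"
      by simp
    then show False
      using * min_var(1)[OF nz(1)] by simp
  qed
  then have "var (min_var \<alpha>) + (\<delta> - var (min_var \<alpha>)) = \<delta>"
    by (rule minus_var)
  then have "\<alpha> = var (min_var \<alpha>) + ((\<delta> - var (min_var \<alpha>)) + \<alpha>')"
    using \<delta>(1) by (metis add.assoc)
  then have "\<alpha> - var (min_var \<alpha>) = (\<delta> - var (min_var \<alpha>)) + \<alpha>'"
    by (metis add_diff_cancel_left')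
  then show False
    using \<alpha> \<alpha>' factor_inside(2) unfolding pommaret_basis_iff by metis
qed

lemma pommaret_cone_unique:
  assumes \<alpha>: "\<alpha> \<in> pommaret_basis \<O>" "\<eta> \<in> pommaret_mult \<alpha>"
    and \<alpha>': "\<alpha>' \<in> pommaret_basis \<O>" "\<eta>' \<in> pommaret_mult \<alpha>'" and eq: "\<eta> + \<alpha> = \<eta>' + \<alpha>'"
  shows "\<alpha> = \<alpha>'"
proof -
  have out: "\<alpha> \<notin> \<O>" "\<alpha>' \<notin> \<O>"
    using \<alpha> \<alpha>' by (auto simp: pommaret_basis_iff)
  have "\<not> (lex_less \<eta> \<eta>' \<and> lex_less \<eta>' \<eta>)"
    using lex_less_trans lex_less_irrefl by blast
  then show ?thesis
    using pommaret_cone_lex[OF eq \<alpha>(2)] pommaret_cone_lex[OF eq[symmetric] \<alpha>'(2)]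
      out outside_neq_0 pommaret_cone_basis \<alpha>(1) \<alpha>'(1) by metis
qed

definition multiplier :: "'x pterm \<Rightarrow> 'x pterm" where
  "multiplier t = (SOME \<eta>. \<exists>\<alpha>\<in>pommaret_basis \<O>. \<eta> \<in> pommaret_mult \<alpha> \<and> t = \<eta> + \<alpha>)"

lemma multiplier_eq:
  assumes "\<alpha> \<in> pommaret_basis \<O>" "\<eta> \<in> pommaret_mult \<alpha>"
  shows "multiplier (\<eta> + \<alpha>) = \<eta>"
  unfolding multiplier_def
proof (rule some_equality)
  fix \<eta>'
  assume "\<exists>\<alpha>'\<in>pommaret_basis \<O>. \<eta>' \<in> pommaret_mult \<alpha>' \<and> \<eta> + \<alpha> = \<eta>' + \<alpha>'"
  then obtain \<alpha>' where *: "\<alpha>'\<in>pommaret_basis \<O>" "\<eta>' \<in> pommaret_mult \<alpha>'" "\<eta> + \<alpha> = \<eta>' + \<alpha>'"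
    by blast
  then have "\<alpha> = \<alpha>'"
    using pommaret_cone_unique[OF assms] by blast
  then show "\<eta>' = \<eta>"
    using *(3) by simp
qed (use assms in blast)

text \<open>
  When a term of a tail is multiplied by \<open>\<eta>\<close> and falls outside \<open>\<O>\<close>, it belongs to a cone with a
  lexicographically smaller multiplier. This makes the Pommaret reduction terminate.
\<close>

lemma pommaret_decrease:
  assumes s: "s \<in> \<O>" and out: "\<eta> + s \<notin> \<O>"
  obtains j \<eta>' where "j \<in> P_indices" "\<eta>' \<in> pommaret_mult (\<tau> j)" "\<eta> + s = \<eta>' + \<tau> j" "lex_less \<eta>' \<eta>"
proof -
  obtain j \<eta>' where j: "j \<in> P_indices" "\<eta>' \<in> pommaret_mult (\<tau> j)" "\<eta> + s = \<eta>' + \<tau> j"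
    using pommaret_cone_exists[OF out] by blast
  have oj: "\<tau> j \<notin> \<O>"
    using j(1) P_indices_subset \<tau>_outside by blast
  have "s \<notin> pommaret_cone (\<tau> j)"
    using s oj factor_inside(2) by (auto simp: pommaret_cone_def)
  then have "lex_less \<eta>' \<eta>"
    using pommaret_cone_lex[OF j(3)[symmetric] j(2) outside_neq_0[OF oj]] by blast
  then show ?thesis
    using that j by blast
qed

sublocale P: marked_reduction \<O> P_indices \<tau> "\<lambda>i. pommaret_mult (\<tau> i)" tail
  "inv_image {(\<alpha>, \<beta>). lex_less \<alpha> \<beta>} multiplier"
proof
  show "wf (inv_image {(\<alpha>, \<beta>). lex_less \<alpha> \<beta>} multiplier)"
    by (intro wf_inv_image wf_lex_less)
  show "Poly_Mapping.keys (tail i) \<subseteq> \<O>" if "i \<in> P_indices" for i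
    using that keys_tail P_indices_subset by blast
  show "\<eta> + \<tau> i \<notin> \<O>" if "i \<in> P_indices" for i \<eta>
    using \<tau>_outside that P_indices_subset factor_inside(2) by blast
  show "\<exists>i\<in>P_indices. \<exists>\<eta>\<in>pommaret_mult (\<tau> i). t = \<eta> + \<tau> i" if "t \<notin> \<O>" for t
    using that by (rule pommaret_cone_exists)
  show "i = j" if "i \<in> P_indices" "j \<in> P_indices" "\<eta> \<in> pommaret_mult (\<tau> i)" "\<eta>' \<in> pommaret_mult (\<tau> j)"
    "\<eta> + \<tau> i = \<eta>' + \<tau> j" for i j \<eta> \<eta>'
    using pommaret_cone_unique[OF _ that(3) _ that(4,5)] that(1,2) P_indices_basis \<tau>_inj P_indices_subset by blast
  show "(\<eta> + s, \<eta> + \<tau> i) \<in> inv_image {(\<alpha>, \<beta>). lex_less \<alpha> \<beta>} multiplier"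
    if i: "i \<in> P_indices" "\<eta> \<in> pommaret_mult (\<tau> i)" and s: "s \<in> \<O>" "\<eta> + s \<notin> \<O>" for i \<eta> s
  proof -
    obtain j \<eta>' where "j \<in> P_indices" "\<eta>' \<in> pommaret_mult (\<tau> j)" "\<eta> + s = \<eta>' + \<tau> j" "lex_less \<eta>' \<eta>"
      by (rule pommaret_decrease[OF s])
    then show ?thesis
      using i P_indices_basis by (simp add: multiplier_eq)
  qed
qed

end

section \<open>The criterion for the border structure\<close>

(* otherwise simplification turns the index range {1..m} into {Suc 0..m} *)
declare One_nat_def [simp del]

lemma linear_extension_compose:
  "linear_extension G (linear_extension F f) = linear_extension (\<lambda>t. linear_extension G (F t)) f"
  by (induction f rule: poly_induct) (simp_all add: linear_extension_add linear_extension_scale)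

lemma (in marked_reduction) nf_in_subspace:
  assumes "ring_module.subspace N" "f \<in> coeffs_in N"
  shows "nf f \<in> coeffs_in N"
proof -
  have "Poly_Mapping.single 0 (Poly_Mapping.lookup f t) \<in> coeffs_in N" for t
    using assms ring_module.subspace_0[OF assms(1)]
    by (auto simp: coeffs_in_def lookup_single when_def)
  then have "Poly_Mapping.single 0 (Poly_Mapping.lookup f t) * nf_term t \<in> coeffs_in N" for t
    by (subst mult.commute) (intro ring_module.subspace_scale[OF subspace_coeffs_in[OF assms(1)]])
  then show ?thesis
    unfolding nf_def linear_extension_def
    by (intro ring_module.subspace_sum[OF subspace_coeffs_in[OF assms(1)]])
qed

lemma term_lcm_dvd: "term_lcm (\<gamma> + \<alpha>) \<alpha> = \<gamma> + \<alpha>"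
  by (intro poly_mapping_eqI) (simp add: term_lcm_def lookup_add lookup_minus)

lemma term_lcm_vars:
  assumes "x \<noteq> y" "var x + \<alpha> = var y + \<beta>"
  shows "term_lcm \<alpha> \<beta> = var x + \<alpha>"
proof (intro poly_mapping_eqI)
  fix z
  have "Poly_Mapping.lookup (var x) z + Poly_Mapping.lookup \<alpha> z =
      Poly_Mapping.lookup (var y) z + Poly_Mapping.lookup \<beta> z"
    using assms(2) by (metis lookup_add)
  then show "Poly_Mapping.lookup (term_lcm \<alpha> \<beta>) z = Poly_Mapping.lookup (var x + \<alpha>) z"
    using assms(1) by (auto simp: term_lcm_def lookup_add lookup_minus lookup_var split: if_splits)
qed

text \<open>
  Let the S-polynomials of neighbours vanish modulo \<open>N\<close>. Next-door neighbours are related by a variable,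
  across-the-street neighbours by two of them.
\<close>

locale border_criterion = marked_border +
  fixes N :: "'b set"
  assumes subspace_N: "ring_module.subspace N"
    and S_poly_N: "\<And>r s. r \<in> {1..m} \<Longrightarrow> s \<in> {1..m} \<Longrightarrow> neighbour_couple (\<tau> r) (\<tau> s) \<Longrightarrow>
      B.nf (S_poly \<tau> B.b r s) \<in> coeffs_in N"
begin

text \<open>The formal multiplication by a variable on the span of \<open>\<O>\<close>: multiply, then reduce.\<close>

definition mult_var :: "'a \<Rightarrow> ('a pterm \<Rightarrow>\<^sub>0 'b) \<Rightarrow> ('a pterm \<Rightarrow>\<^sub>0 'b)" where
  "mult_var x = linear_extension (\<lambda>t. B.nf_term (var x + t))"

lemma mult_var_nf: "B.nf (Poly_Mapping.single (var x) 1 * f) = mult_var x f"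
  by (simp add: B.nf_def mult_var_def linear_extension_monom_mult)

lemma mult_var_diff: "mult_var x (f - g) = mult_var x f - mult_var x g"
  by (simp add: mult_var_def linear_extension_diff)

lemmas subspace_coeffs = subspace_coeffs_in[OF subspace_N]

lemma mult_var_N: "f \<in> coeffs_in N \<Longrightarrow> mult_var x f \<in> coeffs_in N"
  unfolding mult_var_nf[symmetric]
  by (intro B.nf_in_subspace subspace_N ring_module.subspace_scale[OF subspace_coeffs])

lemma keys_mult_var: "Poly_Mapping.keys (mult_var x f) \<subseteq> \<O>"
  unfolding mult_var_nf[symmetric] by (rule B.keys_nf)

lemma nf_term_border:
  assumes "k \<in> {1..m}"
  shows "B.nf_term (\<tau> k) = tail k"
proof -
  have "0 \<in> border_mult \<tau> m k"
    unfolding border_mult_def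
  proof (intro CollectI ballI notI)
    fix j assume j: "j \<in> {k<..m}" and dvd: "term_dvd (\<tau> j) (\<tau> k + 0)"
    have j': "j \<in> {1..m}"
      using j assms by auto
    obtain \<gamma> where \<gamma>: "\<tau> k = \<gamma> + \<tau> j"
      using dvd by (auto simp: term_dvd_def)
    then have "term_deg \<gamma> = 0"
      using \<tau>_deg[OF assms j'] j by (simp add: term_deg_add)
    then have "k = j"
      using \<gamma> by (intro \<tau>_inj[OF assms j']) simp
    then show False
      using j by simp
  qed
  from B.nf_term_cone[OF assms this] show ?thesis
    using B.nf_reduced[OF keys_tail[OF assms]] by simp
qed

lemma mult_var_next_door:
  assumes k: "k \<in> {1..m}" "k' \<in> {1..m}" and eq: "\<tau> k = var x + \<tau> k'"
  shows "mult_var x (tail k') - tail k \<in> coeffs_in N"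
proof -
  have "S_poly \<tau> B.b k k' = Poly_Mapping.single (var x) 1 * tail k' - tail k"
    unfolding S_poly_def eq term_lcm_dvd
    by (simp add: B.b_def eq[symmetric] right_diff_distrib mult_single) (simp add: eq)
  moreover have "neighbour_couple (\<tau> k) (\<tau> k')"
    using eq by (auto simp: neighbour_couple_def)
  ultimately show ?thesis
    using S_poly_N[OF k] B.nf_reduced[OF keys_tail[OF k(1)]] by (simp add: B.nf_diff mult_var_nf)
qed

lemma mult_var_across_street:
  assumes k: "k \<in> {1..m}" "k' \<in> {1..m}" and eq: "var x + \<tau> k = var y + \<tau> k'" and "x \<noteq> y"
  shows "mult_var y (tail k') - mult_var x (tail k) \<in> coeffs_in N"
proof -
  have "S_poly \<tau> B.b k k' = Poly_Mapping.single (var y) 1 * tail k' - Poly_Mapping.single (var x) 1 * tail k"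
    unfolding S_poly_def term_lcm_vars[OF \<open>x \<noteq> y\<close> eq]
    by (simp add: B.b_def right_diff_distrib mult_single) (simp add: eq mult_single)
  moreover have "neighbour_couple (\<tau> k) (\<tau> k')"
    using eq by (auto simp: neighbour_couple_def)
  ultimately show ?thesis
    using S_poly_N[OF k] by (simp add: B.nf_diff mult_var_nf)
qed

lemma mult_var_single [simp]: "mult_var x (Poly_Mapping.single t 1) = B.nf_term (var x + t)"
  by (simp add: mult_var_def)

lemma N_commute: "f - g \<in> coeffs_in N \<Longrightarrow> g - f \<in> coeffs_in N"
  using ring_module.subspace_neg[OF subspace_coeffs, of "f - g"] by simp

text \<open>
  If exactly one of \<open>x s\<close> and \<open>y s\<close> is in \<open>\<O>\<close>, this is the relation of next-door neighbours. If neither is in \<open>\<O>\<close>, both are border terms and it is the relation of across-the-street neighbours.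
\<close>

lemma mult_var_commute_term:
  assumes s: "s \<in> \<O>"
  shows "mult_var x (B.nf_term (var y + s)) - mult_var y (B.nf_term (var x + s)) \<in> coeffs_in N"
proof (cases "x = y")
  case False
  have border: "var z + s \<in> \<O> \<or> (\<exists>k\<in>{1..m}. \<tau> k = var z + s)" for z
    using s border_index[of "var z + s"] unfolding border_def by blast
  have half: "mult_var u (B.nf_term (var z + s)) - mult_var z (B.nf_term (var u + s)) \<in> coeffs_in N"
    if u: "var u + s \<in> \<O>" and z: "var z + s \<notin> \<O>" for u z
  proof -
    obtain k' where k': "k' \<in> {1..m}" "\<tau> k' = var z + s"
      using border[of z] z by blast
    have eq: "var z + (var u + s) = var u + (var z + s)"
      by (simp add: algebra_simps)
    then have "var z + (var u + s) \<notin> \<O>"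
      using z factor_inside(2)[of "var u" "var z + s"] by auto
    then have "var z + (var u + s) \<in> border \<O>"
      using u unfolding border_def by blast
    then obtain k where k: "k \<in> {1..m}" "\<tau> k = var z + (var u + s)"
      by (rule border_index)
    have "\<tau> k = var u + \<tau> k'"
      using k k' eq by simp
    from mult_var_next_door[OF k(1) k'(1) this] show ?thesis
      using u nf_term_border[OF k(1)] nf_term_border[OF k'(1)] k(2) k'(2)
      by (simp add: B.nf_term_inside)
  qed
  show ?thesis
  proof (cases "var x + s \<in> \<O>"; cases "var y + s \<in> \<O>")
    assume "var x + s \<in> \<O>" "var y + s \<in> \<O>"
    then show ?thesis
      using ring_module.subspace_0[OF subspace_coeffs] by (simp add: B.nf_term_inside algebra_simps)
  next
    assume "var x + s \<in> \<O>" "var y + s \<notin> \<O>"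
    then show ?thesis by (rule half)
  next
    assume "var x + s \<notin> \<O>" "var y + s \<in> \<O>"
    then show ?thesis by (rule N_commute[OF half[rotated]])
  next
    assume "var x + s \<notin> \<O>" "var y + s \<notin> \<O>"
    then obtain k k' where k: "k \<in> {1..m}" "\<tau> k = var y + s" "k' \<in> {1..m}" "\<tau> k' = var x + s"
      using border by metis
    then have "var x + \<tau> k = var y + \<tau> k'"
      by (simp add: algebra_simps)
    from N_commute[OF mult_var_across_street[OF k(1,3) this False]] show ?thesis
      using nf_term_border[OF k(1)] nf_term_border[OF k(3)] k(2,4) by simp
  qed
qed (simp add: ring_module.subspace_0[OF subspace_coeffs])

lemma mult_var_commute:
  assumes "Poly_Mapping.keys f \<subseteq> \<O>"
  shows "mult_var x (mult_var y f) - mult_var y (mult_var x f) \<in> coeffs_in N"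
proof -
  have "mult_var x (mult_var y f) - mult_var y (mult_var x f) = linear_extension
      (\<lambda>s. mult_var x (B.nf_term (var y + s)) - mult_var y (B.nf_term (var x + s))) f"
    by (simp add: mult_var_def linear_extension_compose linear_extension_fun_diff)
  also have "\<dots> \<in> coeffs_in N"
    using assms mult_var_commute_term by (intro linear_extension_in_subspace[OF subspace_coeffs]) blast
  finally show ?thesis .
qed

text \<open>
  The result of letting the term act on \<open>1\<close> through the formal multiplications. These commute only modulo
  \<open>N\<close>, so an order of the variables is fixed.
\<close>

function act :: "'a pterm \<Rightarrow> 'a pterm \<Rightarrow>\<^sub>0 'b" where
  "act t = (if t = 0 then Poly_Mapping.single 0 1 else mult_var (min_var t) (act (t - var (min_var t))))"
  by auto
termination
  by (relation "measure term_deg") (auto intro: term_deg_minus_var min_var(1))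

declare act.simps [simp del]

lemma keys_act: "Poly_Mapping.keys (act t) \<subseteq> \<O>"
  using one_inside keys_mult_var by (subst act.simps) auto

lemma act_inside: "t \<in> \<O> \<Longrightarrow> act t = Poly_Mapping.single t 1"
proof (induction t rule: act.induct)
  case (1 t)
  show ?case
  proof (cases "t = 0")
    case False
    have eq: "var (min_var t) + (t - var (min_var t)) = t"
      using False by (intro minus_var min_var(1))
    then have "t - var (min_var t) \<in> \<O>"
      using 1 factor_inside(2) by metis
    then show ?thesis
      using False 1 eq by (subst act.simps) (simp add: B.nf_term_inside)
  qed (simp add: act.simps)
qed

text \<open>
  Modulo \<open>N\<close> the order of the variables is irrelevant: by induction \<open>x\<close> can be moved past the
  variable which is applied last.
\<close>

lemma act_var: "act (var x + t) - mult_var x (act t) \<in> coeffs_in N"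
proof (induction "term_deg t" arbitrary: x t rule: less_induct)
  case less
  define u y where "u = var x + t" and "y = min_var u"
  have "u \<noteq> 0"
    by (auto simp: u_def poly_mapping_eq_iff lookup_var lookup_add fun_eq_iff intro!: exI[of _ x])
  then have y: "y \<in> Poly_Mapping.keys u" and act_u: "act u = mult_var y (act (u - var y))"
    using min_var(1) by (auto simp: y_def act.simps[of u])
  show ?case
  proof (cases "x = y")
    case True
    then show ?thesis
      using act_u ring_module.subspace_0[OF subspace_coeffs] by (simp add: u_def)
  next
    case False
    then have yt: "y \<in> Poly_Mapping.keys t"
      using y by (simp add: u_def keys_term_add)
    define t' where "t' = t - var y"
    have t: "t = var y + t'" and deg: "term_deg t' < term_deg t"
      using minus_var[OF yt] term_deg_minus_var[OF yt] by (simp_all add: t'_def)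
    have "u = var y + (var x + t')"
      by (simp add: u_def t algebra_simps)
    then have "u - var y = var x + t'"
      by simp
    then have 1: "act u = mult_var y (act (var x + t'))"
      using act_u by simp
    have 2: "mult_var y (act (var x + t')) - mult_var y (mult_var x (act t')) \<in> coeffs_in N"
      unfolding mult_var_diff[symmetric] by (intro mult_var_N less deg)
    have 3: "mult_var y (mult_var x (act t')) - mult_var x (mult_var y (act t')) \<in> coeffs_in N"
      by (intro mult_var_commute keys_act)
    have 4: "mult_var x (mult_var y (act t')) - mult_var x (act t) \<in> coeffs_in N"
      unfolding mult_var_diff[symmetric]
      using N_commute[OF less[OF deg, of y]] by (intro mult_var_N) (simp add: t)
    show ?thesis
      using ring_module.subspace_add[OF subspace_coeffs ring_module.subspace_add[OF subspace_coeffs 2 3] 4]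
      by (simp add: 1 u_def[symmetric])
  qed
qed

text \<open>
  The action of a polynomial on \<open>1\<close>. Modulo \<open>N\<close> it is linear over the whole polynomial ring, and it is the
  projection onto the span of \<open>\<O>\<close> along the ideal generated by the marked set.
\<close>

definition Phi :: "('a pterm \<Rightarrow>\<^sub>0 'b) \<Rightarrow> ('a pterm \<Rightarrow>\<^sub>0 'b)" where
  "Phi = linear_extension act"

lemma Phi_reduced: "Poly_Mapping.keys f \<subseteq> \<O> \<Longrightarrow> Phi f = f"
  using linear_extension_cong[of f act "\<lambda>t. Poly_Mapping.single t 1"]
  by (simp add: Phi_def act_inside linear_extension_monomials subset_iff)

lemma Phi_var: "Phi (Poly_Mapping.single (var x) 1 * f) - mult_var x (Phi f) \<in> coeffs_in N"
proof -
  have "Phi (Poly_Mapping.single (var x) 1 * f) - mult_var x (Phi f) =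
      linear_extension (\<lambda>t. act (var x + t) - mult_var x (act t)) f"
    by (simp add: Phi_def mult_var_def linear_extension_compose linear_extension_monom_mult
        linear_extension_fun_diff)
  also have "\<dots> \<in> coeffs_in N"
    using act_var by (intro linear_extension_in_subspace[OF subspace_coeffs])
  finally show ?thesis .
qed

definition killed :: "('a pterm \<Rightarrow>\<^sub>0 'b) set" where
  "killed = {f. Phi f \<in> coeffs_in N}"

lemma subspace_killed: "ring_module.subspace killed"
proof (rule ring_module.subspaceI)
  show "0 \<in> killed"
    using ring_module.subspace_0[OF subspace_coeffs] by (simp add: killed_def Phi_def)
  show add: "f + g \<in> killed" if "f \<in> killed" "g \<in> killed" for f g
    using that ring_module.subspace_add[OF subspace_coeffs]
    by (simp add: killed_def Phi_def linear_extension_add)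
  have scale: "Poly_Mapping.single 0 c * f \<in> killed" if "f \<in> killed" for c f
    using that ring_module.subspace_scale[OF subspace_coeffs]
    by (simp add: killed_def Phi_def linear_extension_scale)
  have var: "Poly_Mapping.single (var x) 1 * f \<in> killed" if "f \<in> killed" for x f
    using ring_module.subspace_add[OF subspace_coeffs Phi_var[of x f] mult_var_N[of "Phi f" x]] that
    by (simp add: killed_def)
  have monom: "Poly_Mapping.single t 1 * f \<in> killed" if "f \<in> killed" for t f
  proof (induction t rule: term_induct)
    case (mult x t)
    then show ?case
      using var[of "Poly_Mapping.single t 1 * f" x] by (simp add: mult_single mult.assoc[symmetric])
  qed (simp add: that)
  show "p * f \<in> killed" if f: "f \<in> killed" for p f
  proof (induction p rule: poly_induct)
    case (single t c)
    then show ?case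
      using scale[OF monom[OF f, of t], of c] by (simp add: mult_single mult.assoc[symmetric])
  next
    case (add p q)
    then show ?case
      using \<open>\<And>g h. g \<in> killed \<Longrightarrow> h \<in> killed \<Longrightarrow> g + h \<in> killed\<close> by (simp add: distrib_right)
  qed (simp add: \<open>0 \<in> killed\<close>)
qed

lemma b_killed:
  assumes k: "k \<in> {1..m}"
  shows "B.b k \<in> killed"
proof -
  obtain x s where s: "\<tau> k = var x + s" "s \<in> \<O>"
    using \<tau>_border[OF k] by (auto simp: border_def)
  then have "act (\<tau> k) - tail k \<in> coeffs_in N"
    using act_var[of x s] nf_term_border[OF k] by (simp add: act_inside)
  moreover have "Phi (B.b k) = act (\<tau> k) - tail k"
    using Phi_reduced[OF keys_tail[OF k]] by (simp add: B.b_def Phi_def linear_extension_diff)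
  ultimately show ?thesis
    by (simp add: killed_def)
qed

text \<open>
  The polynomials acting as zero modulo \<open>N\<close> form an ideal containing the marked set, while an
  \<open>\<O>\<close>-reduced polynomial maps \<open>1\<close> to itself.
\<close>

theorem reduced_in_border_ideal:
  assumes "f \<in> ring_module.span (B.b ` {1..m})" "Poly_Mapping.keys f \<subseteq> \<O>"
  shows "f \<in> coeffs_in N"
proof -
  have "ring_module.span (B.b ` {1..m}) \<subseteq> killed"
    using b_killed by (intro ring_module.span_minimal subspace_killed) auto
  then show ?thesis
    using assms Phi_reduced by (auto simp: killed_def)
qed

end

section \<open>The criterion for the Pommaret structure\<close>

lemma term_lcm_eqI:
  assumes "var x + \<alpha> = \<eta> + \<beta>" "x \<notin> Poly_Mapping.keys \<eta>"
  shows "term_lcm \<alpha> \<beta> = var x + \<alpha>"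
proof (intro poly_mapping_eqI)
  fix z
  have "Poly_Mapping.lookup (var x) z + Poly_Mapping.lookup \<alpha> z =
      Poly_Mapping.lookup \<eta> z + Poly_Mapping.lookup \<beta> z"
    using assms(1) by (metis lookup_add)
  moreover have "Poly_Mapping.lookup \<eta> x = 0"
    using assms(2) by (simp add: in_keys_iff)
  ultimately show "Poly_Mapping.lookup (term_lcm \<alpha> \<beta>) z = Poly_Mapping.lookup (var x + \<alpha>) z"
    by (auto simp: term_lcm_def lookup_add lookup_minus lookup_var split: if_splits)
qed

locale pommaret_criterion = marked_border +
  fixes N :: "'b set"
  assumes subspace_N: "ring_module.subspace N"
    and S_poly_N: "\<And>r s. r \<in> P_indices \<Longrightarrow> s \<in> P_indices \<Longrightarrow> nonmult_couple (\<tau> r) (\<tau> s) \<Longrightarrow>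
      P.nf (S_poly \<tau> P.b r s) \<in> coeffs_in N"
begin

lemmas subspace_coeffs = subspace_coeffs_in[OF subspace_N]

text \<open>Multiplication by a term, followed by reduction.\<close>

definition shift :: "'a pterm \<Rightarrow> ('a pterm \<Rightarrow>\<^sub>0 'b) \<Rightarrow> ('a pterm \<Rightarrow>\<^sub>0 'b)" where
  "shift \<nu> = linear_extension (\<lambda>t. P.nf_term (\<nu> + t))"

lemma shift_nf: "P.nf (Poly_Mapping.single \<nu> 1 * f) = shift \<nu> f"
  by (simp add: P.nf_def shift_def linear_extension_monom_mult)

lemma shift_diff: "shift \<nu> (f - g) = shift \<nu> f - shift \<nu> g"
  by (simp add: shift_def linear_extension_diff)

lemma shift_single [simp]: "shift \<nu> (Poly_Mapping.single t 1) = P.nf_term (\<nu> + t)"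
  by (simp add: shift_def)

lemma shift_N: "f \<in> coeffs_in N \<Longrightarrow> shift \<nu> f \<in> coeffs_in N"
  unfolding shift_nf[symmetric]
  by (intro P.nf_in_subspace subspace_N ring_module.subspace_scale[OF subspace_coeffs])

lemma shift_cone: "i \<in> P_indices \<Longrightarrow> \<eta> \<in> pommaret_mult (\<tau> i) \<Longrightarrow> P.nf_term (\<eta> + \<tau> i) = shift \<eta> (tail i)"
  by (simp add: P.nf_term_cone shift_nf)

lemma shift_b: "shift \<mu> (P.b k) = P.nf_term (\<mu> + \<tau> k) - shift \<mu> (tail k)"
  by (simp add: P.b_def shift_diff)

text \<open>
  Reducing before the multiplication by \<open>\<nu>\<close> does not change the reduced form modulo \<open>N\<close>. The reduction of a
  multiple \<open>\<eta> s\<close> uses only multipliers below \<open>\<eta>\<close>, and their products with \<open>\<nu>\<close> are below \<open>\<nu> \<xi>\<close>, where the marked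
  polynomials are already known to reduce to zero.
\<close>

lemma shift_shift_term:
  assumes small: "\<And>\<mu>' k. k \<in> P_indices \<Longrightarrow> lex_less \<mu>' (\<nu> + \<xi>) \<Longrightarrow> shift \<mu>' (P.b k) \<in> coeffs_in N"
    and \<eta>: "\<eta> = \<xi> \<or> lex_less \<eta> \<xi>" and s: "s \<in> \<O>"
  shows "P.nf_term (\<nu> + (\<eta> + s)) - shift \<nu> (P.nf_term (\<eta> + s)) \<in> coeffs_in N"
  using \<eta> s
proof (induction \<eta> arbitrary: s rule: wf_induct_rule[OF wf_lex_less])
  case (1 \<eta>)
  show ?case
  proof (cases "\<eta> + s \<in> \<O>")
    case True
    then show ?thesis
      using ring_module.subspace_0[OF subspace_coeffs] by (simp add: P.nf_term_inside)
  next
    case False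
    then obtain j \<eta>' where j: "j \<in> P_indices" "\<eta>' \<in> pommaret_mult (\<tau> j)" "\<eta> + s = \<eta>' + \<tau> j"
      and lex: "lex_less \<eta>' \<eta>"
      by (rule pommaret_decrease[OF "1.prems"(2)])
    have lex': "lex_less \<eta>' \<xi>"
      using lex "1.prems"(1) lex_less_trans by blast
    have "P.nf_term (\<nu> + (\<eta>' + s')) - shift \<nu> (P.nf_term (\<eta>' + s')) \<in> coeffs_in N"
      if "s' \<in> Poly_Mapping.keys (tail j)" for s'
      using "1.IH"[of \<eta>' s'] lex lex' that keys_tail[of j] j(1) P_indices_subset by blast
    then have "linear_extension
        (\<lambda>s'. P.nf_term (\<nu> + (\<eta>' + s')) - shift \<nu> (P.nf_term (\<eta>' + s'))) (tail j) \<in> coeffs_in N"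
      by (intro linear_extension_in_subspace[OF subspace_coeffs])
    then have 1: "shift (\<nu> + \<eta>') (tail j) - shift \<nu> (shift \<eta>' (tail j)) \<in> coeffs_in N"
      by (simp add: shift_def linear_extension_compose linear_extension_fun_diff add.assoc)
    have 2: "P.nf_term ((\<nu> + \<eta>') + \<tau> j) - shift (\<nu> + \<eta>') (tail j) \<in> coeffs_in N"
      using small[OF j(1) lex_less_add[OF lex', of \<nu>]] by (simp add: shift_b)
    show ?thesis
      using ring_module.subspace_add[OF subspace_coeffs 2 1] shift_cone[OF j(1,2)]
      by (simp add: j(3) add.assoc)
  qed
qed

lemma shift_shift:
  assumes small: "\<And>\<mu>' k. k \<in> P_indices \<Longrightarrow> lex_less \<mu>' (\<nu> + \<xi>) \<Longrightarrow> shift \<mu>' (P.b k) \<in> coeffs_in N"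
    and \<eta>: "\<eta> = \<xi> \<or> lex_less \<eta> \<xi>" and f: "Poly_Mapping.keys f \<subseteq> \<O>"
  shows "shift (\<nu> + \<eta>) f - shift \<nu> (shift \<eta> f) \<in> coeffs_in N"
proof -
  have "shift (\<nu> + \<eta>) f - shift \<nu> (shift \<eta> f) =
      linear_extension (\<lambda>s. P.nf_term (\<nu> + (\<eta> + s)) - shift \<nu> (P.nf_term (\<eta> + s))) f"
    by (simp add: shift_def linear_extension_compose linear_extension_fun_diff add.assoc)
  also have "\<dots> \<in> coeffs_in N"
    using f shift_shift_term[OF small \<eta>] by (intro linear_extension_in_subspace[OF subspace_coeffs]) blast
  finally show ?thesis .
qed

text \<open>
  Let \<open>\<mu> = \<nu> x\<close> with \<open>x\<close> non-multiplicative for the head term \<open>\<tau>\<^sub>k\<close>, and write \<open>x \<tau>\<^sub>k = \<eta> \<tau>\<^sub>j\<close> in the cone of \<open>\<tau>\<^sub>j\<close>.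
  Then \<open>\<eta>\<close> is lexicographically smaller than \<open>x\<close>, and the S-polynomial is \<open>x b\<^sub>k - \<eta> b\<^sub>j\<close>. Multiplied by \<open>\<nu>\<close> it
  compares \<open>\<mu> b\<^sub>k\<close> with the smaller multiple \<open>\<nu> \<eta> b\<^sub>j\<close>.
\<close>

lemma multiples_reduce:
  assumes "k \<in> P_indices"
  shows "shift \<mu> (P.b k) \<in> coeffs_in N"
  using assms
proof (induction \<mu> arbitrary: k rule: wf_induct_rule[OF wf_lex_less])
  case (1 \<mu>)
  note k = "1.prems"
  have IH: "shift \<mu>' (P.b k) \<in> coeffs_in N" if "k \<in> P_indices" "lex_less \<mu>' \<mu>" for \<mu>' k
    using "1.IH" that by blast
  show ?case
  proof (cases "\<mu> \<in> pommaret_mult (\<tau> k)")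
    case True
    then show ?thesis
      using P.nf_cone[OF k True, of 1] ring_module.subspace_0[OF subspace_coeffs] by (simp add: shift_nf)
  next
    case False
    then obtain x where x: "x \<in> Poly_Mapping.keys \<mu>" "\<not> x \<le> min_var (\<tau> k)"
      by (auto simp: pommaret_mult_def)
    define \<nu> where "\<nu> = \<mu> - var x"
    have \<mu>: "\<mu> = \<nu> + var x"
      using minus_var[OF x(1)] by (simp add: \<nu>_def add.commute)
    have k_out: "\<tau> k \<notin> \<O>"
      using k P_indices_subset \<tau>_outside by blast
    then have "var x + \<tau> k \<notin> \<O>"
      using factor_inside(2) by blast
    then obtain j \<eta> where j: "j \<in> P_indices" "\<eta> \<in> pommaret_mult (\<tau> j)" "var x + \<tau> k = \<eta> + \<tau> j"
      using pommaret_cone_exists by blast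
    have j_out: "\<tau> j \<notin> \<O>"
      using j(1) P_indices_subset \<tau>_outside by blast
    have nonmult: "var x \<notin> pommaret_mult (\<tau> k)"
      using x(2) by (simp add: pommaret_mult_def)
    have "\<tau> k \<notin> pommaret_cone (\<tau> j)"
    proof
      assume "\<tau> k \<in> pommaret_cone (\<tau> j)"
      then have "\<tau> k = \<tau> j"
        using pommaret_cone_basis[OF P_indices_basis[OF k] j_out] by blast
      then show False
        using j nonmult by simp
    qed
    then have lex: "lex_less \<eta> (var x)"
      using pommaret_cone_lex[OF j(3)[symmetric] j(2) outside_neq_0[OF j_out]] by blast
    then have "x \<notin> Poly_Mapping.keys \<eta>"
      by (auto simp: lex_less_def lookup_var in_keys_iff split: if_splits)
    then have lcm: "term_lcm (\<tau> k) (\<tau> j) = var x + \<tau> k"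
      by (rule term_lcm_eqI[OF j(3)])
    have "S_poly \<tau> P.b k j = Poly_Mapping.single \<eta> 1 * tail j - Poly_Mapping.single (var x) 1 * tail k"
      unfolding S_poly_def lcm
      by (simp add: P.b_def right_diff_distrib mult_single) (simp add: j(3) mult_single)
    moreover have "nonmult_couple (\<tau> k) (\<tau> j)"
      unfolding nonmult_couple_def pommaret_cone_def using nonmult j(2,3) by blast
    ultimately have S: "shift \<eta> (tail j) - shift (var x) (tail k) \<in> coeffs_in N"
      using S_poly_N[OF k j(1)] by (simp add: P.nf_diff shift_nf)
    have tails: "Poly_Mapping.keys (tail j) \<subseteq> \<O>" "Poly_Mapping.keys (tail k) \<subseteq> \<O>"
      using keys_tail k j(1) P_indices_subset by blast+
    have 1: "P.nf_term (\<nu> + \<eta> + \<tau> j) - shift (\<nu> + \<eta>) (tail j) \<in> coeffs_in N"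
      using IH[OF j(1), of "\<nu> + \<eta>"] lex_less_add[OF lex, of \<nu>] by (simp add: shift_b \<mu>)
    have 2: "shift (\<nu> + \<eta>) (tail j) - shift \<nu> (shift \<eta> (tail j)) \<in> coeffs_in N"
      using IH lex tails(1) unfolding \<mu> by (intro shift_shift[where \<xi> = "var x"]) auto
    have 3: "shift \<nu> (shift \<eta> (tail j)) - shift \<nu> (shift (var x) (tail k)) \<in> coeffs_in N"
      unfolding shift_diff[symmetric] by (rule shift_N[OF S])
    have "shift (\<nu> + var x) (tail k) - shift \<nu> (shift (var x) (tail k)) \<in> coeffs_in N"
      using IH tails(2) unfolding \<mu> by (intro shift_shift[where \<xi> = "var x"]) auto
    from ring_module.subspace_diff[OF subspace_coeffs
        ring_module.subspace_add[OF subspace_coeffs ring_module.subspace_add[OF subspace_coeffs 1 2] 3] this]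
    have "P.nf_term (\<nu> + \<eta> + \<tau> j) - shift (\<nu> + var x) (tail k) \<in> coeffs_in N"
      by simp
    moreover have "\<nu> + \<eta> + \<tau> j = \<mu> + \<tau> k"
      using j(3) by (simp add: \<mu> add.assoc)
    ultimately show ?thesis
      by (simp add: shift_b \<mu>)
  qed
qed

definition killed :: "('a pterm \<Rightarrow>\<^sub>0 'b) set" where
  "killed = {f. \<forall>\<mu>. shift \<mu> f \<in> coeffs_in N}"

lemma subspace_killed: "ring_module.subspace killed"
proof (rule ring_module.subspaceI)
  show zero: "0 \<in> killed"
    using ring_module.subspace_0[OF subspace_coeffs] by (simp add: killed_def shift_def)
  show add: "f + g \<in> killed" if "f \<in> killed" "g \<in> killed" for f g
  proof -
    have "shift \<mu> (f + g) = shift \<mu> f + shift \<mu> g" for \<mu>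
      by (simp add: shift_def linear_extension_add)
    then show ?thesis
      using that by (simp add: killed_def ring_module.subspace_add[OF subspace_coeffs])
  qed
  show "p * f \<in> killed" if f: "f \<in> killed" for p f
  proof (induction p rule: poly_induct)
    case (single t c)
    have "shift \<mu> (Poly_Mapping.single t c * f) = Poly_Mapping.single 0 c * shift (\<mu> + t) f" for \<mu>
      by (simp add: shift_def linear_extension_monom_mult add.assoc)
    then show ?case
      using f by (simp add: killed_def ring_module.subspace_scale[OF subspace_coeffs])
  next
    case (add p q)
    then show ?case
      using \<open>\<And>g h. g \<in> killed \<Longrightarrow> h \<in> killed \<Longrightarrow> g + h \<in> killed\<close> by (simp add: distrib_right)
  qed (simp add: zero)
qed

text \<open>
  The polynomials all of whose monomial multiples reduce to zero modulo \<open>N\<close> form an ideal. It contains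
  the marked set, and an \<open>\<O>\<close>-reduced polynomial in it equals its own reduced form.
\<close>

theorem reduced_in_pommaret_ideal:
  assumes "f \<in> ring_module.span (P.b ` P_indices)" "Poly_Mapping.keys f \<subseteq> \<O>"
  shows "f \<in> coeffs_in N"
proof -
  have "ring_module.span (P.b ` P_indices) \<subseteq> killed"
    using multiples_reduce by (intro ring_module.span_minimal subspace_killed) (auto simp: killed_def)
  then have "shift 0 f \<in> coeffs_in N"
    using assms(1) by (auto simp: killed_def)
  moreover have "shift 0 f = f"
    using P.nf_reduced[OF assms(2)] by (simp add: shift_def P.nf_def)
  ultimately show ?thesis
    by simp
qed

end

section \<open>Substitution in the parameter ring\<close>

definition param_var :: "'v \<Rightarrow> ('v \<Rightarrow>\<^sub>0 nat) \<Rightarrow>\<^sub>0 'k::field" where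
  "param_var v = Poly_Mapping.single (Poly_Mapping.single v 1) 1"

definition monom_eval :: "('v \<Rightarrow> ('w \<Rightarrow>\<^sub>0 nat) \<Rightarrow>\<^sub>0 'k::field) \<Rightarrow> ('v \<Rightarrow>\<^sub>0 nat) \<Rightarrow> ('w \<Rightarrow>\<^sub>0 nat) \<Rightarrow>\<^sub>0 'k" where
  "monom_eval \<theta> t = (\<Prod>v\<in>Poly_Mapping.keys t. \<theta> v ^ Poly_Mapping.lookup t v)"

definition poly_subst :: "('v \<Rightarrow> ('w \<Rightarrow>\<^sub>0 nat) \<Rightarrow>\<^sub>0 'k::field) \<Rightarrow> (('v \<Rightarrow>\<^sub>0 nat) \<Rightarrow>\<^sub>0 'k) \<Rightarrow> (('w \<Rightarrow>\<^sub>0 nat) \<Rightarrow>\<^sub>0 'k)" where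
  "poly_subst \<theta> = linear_extension (monom_eval \<theta>)"

lemma monom_eval_superset:
  "finite A \<Longrightarrow> Poly_Mapping.keys t \<subseteq> A \<Longrightarrow> monom_eval \<theta> t = (\<Prod>v\<in>A. \<theta> v ^ Poly_Mapping.lookup t v)"
  unfolding monom_eval_def by (intro prod.mono_neutral_left) (auto simp: in_keys_iff)

lemma monom_eval_0 [simp]: "monom_eval \<theta> 0 = 1"
  by (simp add: monom_eval_def)

lemma monom_eval_single: "monom_eval \<theta> (Poly_Mapping.single v n) = \<theta> v ^ n"
  by (subst monom_eval_superset[of "{v}"]) auto

lemma monom_eval_add: "monom_eval \<theta> (s + t) = monom_eval \<theta> s * monom_eval \<theta> t"
proof -
  let ?A = "Poly_Mapping.keys s \<union> Poly_Mapping.keys t"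
  have "Poly_Mapping.keys (s + t) \<subseteq> ?A"
    by (rule keys_add)
  then show ?thesis
    by (simp add: monom_eval_superset[of ?A] lookup_add power_add prod.distrib)
qed

lemma poly_subst_0 [simp]: "poly_subst \<theta> 0 = 0"
  by (simp add: poly_subst_def)

lemma poly_subst_add: "poly_subst \<theta> (f + g) = poly_subst \<theta> f + poly_subst \<theta> g"
  by (simp add: poly_subst_def linear_extension_add)

lemma poly_subst_1 [simp]: "poly_subst \<theta> 1 = 1"
  using linear_extension_single[of "monom_eval \<theta>" 0 1] by (simp add: poly_subst_def)

lemma poly_subst_mult:
  fixes \<theta> :: "'v \<Rightarrow> ('w \<Rightarrow>\<^sub>0 nat) \<Rightarrow>\<^sub>0 'k::field"
  shows "poly_subst \<theta> (f * g) = poly_subst \<theta> f * poly_subst \<theta> g"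
proof (induction f rule: poly_induct)
  case (single s c)
  have "linear_extension (\<lambda>t. a * F t) g = a * linear_extension F g" for a and F :: "('v \<Rightarrow>\<^sub>0 nat) \<Rightarrow> ('w \<Rightarrow>\<^sub>0 nat) \<Rightarrow>\<^sub>0 'k"
    unfolding linear_extension_def sum_distrib_left by (intro sum.cong) (simp_all only: mult.left_commute)
  then have "linear_extension (\<lambda>t. monom_eval \<theta> (s + t)) g = monom_eval \<theta> s * linear_extension (monom_eval \<theta>) g"
    by (simp add: monom_eval_add)
  then show ?case
    by (simp only: poly_subst_def linear_extension_monom_mult linear_extension_single mult.assoc)
qed (simp_all add: poly_subst_add distrib_right)

lemma poly_subst_var: "poly_subst \<theta> (param_var v) = \<theta> v"
  by (simp add: poly_subst_def param_var_def monom_eval_single)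

lemma monom_eval_param_var: "monom_eval param_var t = Poly_Mapping.single t (1 :: 'k::field)"
proof (induction t rule: poly_induct)
  case (single v n)
  have "param_var v ^ n = Poly_Mapping.single (Poly_Mapping.single v n) (1::'k)"
    by (induction n) (simp_all add: param_var_def mult_single single_add[symmetric] plus_1_eq_Suc)
  then show ?case
    by (simp add: monom_eval_single)
qed (simp_all add: monom_eval_add mult_single)

lemma poly_subst_congruent:
  assumes N: "ring_module.subspace N" and eq: "\<And>v. \<theta> v - \<theta>' v \<in> N"
  shows "poly_subst \<theta> f - poly_subst \<theta>' f \<in> N"
proof -
  have mult: "a * b - a' * b' \<in> N" if "a - a' \<in> N" "b - b' \<in> N" for a a' b b'
  proof -
    have "a * b - a' * b' = b * (a - a') + a' * (b - b')"
      by (simp add: algebra_simps)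
    then show ?thesis
      using that N by (auto intro: ring_module.subspace_add ring_module.subspace_scale)
  qed
  have "monom_eval \<theta> t - monom_eval \<theta>' t \<in> N" for t
  proof (induction t rule: poly_induct)
    case (single v n)
    have "\<theta> v ^ n - \<theta>' v ^ n \<in> N"
    proof (induction n)
      case (Suc n)
      then show ?case
        using mult[OF eq[of v]] by simp
    qed (simp add: ring_module.subspace_0[OF N])
    then show ?case
      by (simp add: monom_eval_single)
  qed (simp_all add: monom_eval_add mult ring_module.subspace_0[OF N])
  then show ?thesis
    unfolding poly_subst_def linear_extension_fun_diff by (intro linear_extension_in_subspace[OF N])
qed

section \<open>Polynomial rings in subsets of the parameters\<close>

definition is_subring :: "'r::comm_ring_1 set \<Rightarrow> bool" where
  "is_subring A \<longleftrightarrow> 1 \<in> A \<and> (\<forall>a\<in>A. \<forall>b\<in>A. a + b \<in> A \<and> a * b \<in> A \<and> - a \<in> A)"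

lemma is_subringD:
  assumes "is_subring A"
  shows "1 \<in> A" "0 \<in> A" "a \<in> A \<Longrightarrow> b \<in> A \<Longrightarrow> a + b \<in> A" "a \<in> A \<Longrightarrow> b \<in> A \<Longrightarrow> a * b \<in> A"
    "a \<in> A \<Longrightarrow> - a \<in> A" "a \<in> A \<Longrightarrow> b \<in> A \<Longrightarrow> a - b \<in> A"
proof -
  show 1: "1 \<in> A" "a \<in> A \<Longrightarrow> b \<in> A \<Longrightarrow> a + b \<in> A" "a \<in> A \<Longrightarrow> b \<in> A \<Longrightarrow> a * b \<in> A" "a \<in> A \<Longrightarrow> - a \<in> A"
    for a b using assms by (auto simp: is_subring_def)
  show "a \<in> A \<Longrightarrow> b \<in> A \<Longrightarrow> a - b \<in> A"
    using 1(2)[of a "- b"] 1(4)[of b] by simp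
  show "0 \<in> A"
    using 1(2)[OF 1(1) 1(4)[OF 1(1)]] by simp
qed

lemma is_subring_sum: "is_subring A \<Longrightarrow> (\<And>i. i \<in> X \<Longrightarrow> f i \<in> A) \<Longrightarrow> sum f X \<in> A"
  by (induction X rule: infinite_finite_induct) (auto intro: is_subringD)

lemma is_subring_prod: "is_subring A \<Longrightarrow> (\<And>i. i \<in> X \<Longrightarrow> f i \<in> A) \<Longrightarrow> prod f X \<in> A"
  by (induction X rule: infinite_finite_induct) (auto intro: is_subringD)

lemma is_subring_power: "is_subring A \<Longrightarrow> a \<in> A \<Longrightarrow> a ^ n \<in> A"
  by (induction n) (auto intro: is_subringD)

lemma is_subring_coeffs_in:
  assumes A: "is_subring A"
  shows "is_subring (coeffs_in A :: ('x pterm \<Rightarrow>\<^sub>0 'r::comm_ring_1) set)"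
proof -
  have add: "f + g \<in> coeffs_in A" if "f \<in> coeffs_in A" "g \<in> coeffs_in A" for f g :: "'x pterm \<Rightarrow>\<^sub>0 'r"
    using that is_subringD(3)[OF A] by (simp add: coeffs_in_def lookup_add)
  have zero: "0 \<in> (coeffs_in A :: ('x pterm \<Rightarrow>\<^sub>0 'r) set)"
    by (simp add: coeffs_in_def is_subringD(2)[OF A])
  have sum: "sum h X \<in> coeffs_in A" if "\<And>i. i \<in> X \<Longrightarrow> h i \<in> coeffs_in A"
    for h :: "'x pterm \<Rightarrow> 'x pterm \<Rightarrow>\<^sub>0 'r" and X
    using that by (induction X rule: infinite_finite_induct) (auto intro: add zero)
  have single: "Poly_Mapping.single t c \<in> (coeffs_in A :: ('x pterm \<Rightarrow>\<^sub>0 'r) set)" if "c \<in> A" for t c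
    using that is_subringD(2)[OF A] by (simp add: coeffs_in_def lookup_single when_def)
  have "f * g \<in> coeffs_in A" if fg: "f \<in> coeffs_in A" "g \<in> coeffs_in A" for f g :: "'x pterm \<Rightarrow>\<^sub>0 'r"
  proof -
    have "f * g = (\<Sum>s\<in>Poly_Mapping.keys f. \<Sum>t\<in>Poly_Mapping.keys g.
        Poly_Mapping.single (s + t) (Poly_Mapping.lookup f s * Poly_Mapping.lookup g t))"
      by (subst poly_expand[of f], subst poly_expand[of g]) (simp add: sum_product mult_single)
    also have "\<dots> \<in> coeffs_in A"
      using fg by (intro sum single is_subringD(4)[OF A]) (auto simp: coeffs_in_def)
    finally show ?thesis .
  qed
  moreover have "1 \<in> (coeffs_in A :: ('x pterm \<Rightarrow>\<^sub>0 'r) set)"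
    using single[OF is_subringD(1)[OF A], of 0] by simp
  ultimately show ?thesis
    using add is_subringD(5)[OF A] by (simp add: is_subring_def) (simp add: coeffs_in_def)
qed

lemma single_in_coeffs: "is_subring A \<Longrightarrow> c \<in> A \<Longrightarrow> Poly_Mapping.single t c \<in> coeffs_in A"
  using is_subringD(2) by (auto simp: coeffs_in_def lookup_single when_def)

text \<open>
  Reduction combines the coefficients of \<open>f\<close> and of the tails by ring operations only, so it does not leave a
  subring containing them.
\<close>

lemma (in marked_reduction) nf_coeffs:
  assumes A: "is_subring A" and tail: "\<And>i. i \<in> I \<Longrightarrow> tail i \<in> coeffs_in A" and f: "f \<in> coeffs_in A"
  shows "nf f \<in> coeffs_in A"
proof -
  note sub = is_subring_coeffs_in[OF A]
  have lin: "linear_extension F g \<in> coeffs_in A"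
    if "g \<in> coeffs_in A" "\<And>t. t \<in> Poly_Mapping.keys g \<Longrightarrow> F t \<in> coeffs_in A" for F and g :: "'x pterm \<Rightarrow>\<^sub>0 'r"
    unfolding linear_extension_def using that
    by (intro is_subring_sum[OF sub] is_subringD(4)[OF sub] single_in_coeffs[OF A]) (auto simp: coeffs_in_def)
  have "nf_term t \<in> coeffs_in A" for t
  proof (induction t rule: wf_induct_rule[OF wf_outside_first])
    case (1 t)
    show ?case
    proof (cases "t \<in> \<O>")
      case True
      then show ?thesis
        by (simp add: nf_term_inside single_in_coeffs[OF A is_subringD(1)[OF A]])
    next
      case False
      have "(t - \<tau> (cone_index t) + s, t) \<in> outside_first"
        if "s \<in> Poly_Mapping.keys (tail (cone_index t))" for s
        using decrease[OF cone_index(1,2)[OF False], of s] keys_tail[OF cone_index(1)[OF False]] that False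
        by (auto simp: outside_first_def cone_index(3)[OF False])
      then have "linear_extension (\<lambda>s. nf_term (t - \<tau> (cone_index t) + s)) (tail (cone_index t)) \<in> coeffs_in A"
        using 1 by (intro lin tail cone_index(1)[OF False]) blast
      then show ?thesis
        using nf_term_cone[OF cone_index(1,2)[OF False]] unfolding cone_index(3)[OF False]
        by (simp add: nf_def linear_extension_monom_mult)
    qed
  qed
  then show ?thesis
    unfolding nf_def using f by (intro lin)
qed

lemma carrier_poly_ring: "carrier (poly_ring V) = {p. \<forall>t \<in> Poly_Mapping.keys p. Poly_Mapping.keys t \<subseteq> V}"
  by (simp add: poly_ring_def)

lemma poly_ring_simps [simp]:
  "a \<otimes>\<^bsub>poly_ring V\<^esub> b = a * b" "a \<oplus>\<^bsub>poly_ring V\<^esub> b = a + b"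
  "\<one>\<^bsub>poly_ring V\<^esub> = 1" "\<zero>\<^bsub>poly_ring V\<^esub> = 0"
  by (simp_all add: poly_ring_def)

lemma is_subring_poly_ring: "is_subring (carrier (poly_ring V :: (('v \<Rightarrow>\<^sub>0 nat) \<Rightarrow>\<^sub>0 'k::field) ring))"
  unfolding is_subring_def carrier_poly_ring
proof (intro conjI ballI CollectI)
  fix a b :: "('v \<Rightarrow>\<^sub>0 nat) \<Rightarrow>\<^sub>0 'k" and t
  assume a: "a \<in> {p. \<forall>t\<in>Poly_Mapping.keys p. Poly_Mapping.keys t \<subseteq> V}"
    and b: "b \<in> {p. \<forall>t\<in>Poly_Mapping.keys p. Poly_Mapping.keys t \<subseteq> V}"
  show "Poly_Mapping.keys t \<subseteq> V" if "t \<in> Poly_Mapping.keys (a + b)"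
    using that keys_add[of a b] a b by blast
  show "Poly_Mapping.keys t \<subseteq> V" if "t \<in> Poly_Mapping.keys (- a)"
    using that a by (simp add: keys_uminus)
  show "Poly_Mapping.keys t \<subseteq> V" if t: "t \<in> Poly_Mapping.keys (a * b)"
  proof -
    obtain u v where "t = u + v" "u \<in> Poly_Mapping.keys a" "v \<in> Poly_Mapping.keys b"
      using t keys_mult[of a b] by blast
    then show ?thesis
      using a b keys_add[of u v] by blast
  qed
qed simp

lemma cring_poly_ring: "cring (poly_ring V :: (('v \<Rightarrow>\<^sub>0 nat) \<Rightarrow>\<^sub>0 'k::field) ring)"
proof (rule cringI)
  note A = is_subringD[OF is_subring_poly_ring[of V]]
  show "abelian_group (poly_ring V :: (('v \<Rightarrow>\<^sub>0 nat) \<Rightarrow>\<^sub>0 'k) ring)"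
  proof (rule abelian_groupI)
    fix x :: "('v \<Rightarrow>\<^sub>0 nat) \<Rightarrow>\<^sub>0 'k" assume "x \<in> carrier (poly_ring V)"
    then show "\<exists>y\<in>carrier (poly_ring V). y \<oplus>\<^bsub>poly_ring V\<^esub> x = \<zero>\<^bsub>poly_ring V\<^esub>"
      by (intro bexI[of _ "- x"]) (auto intro: A)
  qed (simp_all add: A add_ac)
  show "comm_monoid (poly_ring V :: (('v \<Rightarrow>\<^sub>0 nat) \<Rightarrow>\<^sub>0 'k) ring)"
  proof (rule comm_monoidI)
    fix x y z :: "('v \<Rightarrow>\<^sub>0 nat) \<Rightarrow>\<^sub>0 'k"
    show "x \<otimes>\<^bsub>poly_ring V\<^esub> y \<otimes>\<^bsub>poly_ring V\<^esub> z = x \<otimes>\<^bsub>poly_ring V\<^esub> (y \<otimes>\<^bsub>poly_ring V\<^esub> z)"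
      by (simp only: poly_ring_simps mult.assoc)
    show "x \<otimes>\<^bsub>poly_ring V\<^esub> y = y \<otimes>\<^bsub>poly_ring V\<^esub> x"
      by (simp only: poly_ring_simps mult.commute)
  qed (simp_all add: A)
qed (simp add: distrib_right)

lemma minus_poly_ring:
  fixes a b :: "('v \<Rightarrow>\<^sub>0 nat) \<Rightarrow>\<^sub>0 'k::field"
  assumes "a \<in> carrier (poly_ring V)" "b \<in> carrier (poly_ring V)"
  shows "a \<ominus>\<^bsub>poly_ring V\<^esub> b = a - b"
proof -
  interpret cring "poly_ring V :: (('v \<Rightarrow>\<^sub>0 nat) \<Rightarrow>\<^sub>0 'k) ring"
    by (rule cring_poly_ring)
  have "- b \<in> carrier (poly_ring V)"
    using assms(2) is_subringD(5)[OF is_subring_poly_ring] by blast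
  then have "\<ominus>\<^bsub>poly_ring V\<^esub> b = - b"
    using assms(2) by (intro minus_equality) simp_all
  then show ?thesis
    by (simp add: a_minus_def)
qed

lemma param_var_carrier: "v \<in> V \<Longrightarrow> param_var v \<in> carrier (poly_ring V)"
  by (simp add: carrier_poly_ring param_var_def)

lemma poly_subst_carrier:
  assumes "p \<in> carrier (poly_ring V)" "\<And>v. v \<in> V \<Longrightarrow> \<theta> v \<in> carrier (poly_ring W)"
  shows "poly_subst \<theta> p \<in> carrier (poly_ring W)"
proof -
  note A = is_subring_poly_ring[of W]
  have c: "Poly_Mapping.single 0 c \<in> carrier (poly_ring W)" for c :: 'b
    by (simp add: carrier_poly_ring)
  have t: "\<theta> v \<in> carrier (poly_ring W)" if "t \<in> Poly_Mapping.keys p" "v \<in> Poly_Mapping.keys t" for t v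
  proof -
    have "v \<in> V"
      using assms(1) that by (auto simp: carrier_poly_ring)
    then show ?thesis
      by (rule assms(2))
  qed
  show ?thesis
    unfolding poly_subst_def linear_extension_def monom_eval_def
    using t by (intro is_subring_sum[OF A] is_subringD(4)[OF A] c is_subring_prod[OF A] is_subring_power[OF A])
qed

lemma poly_subst_ident:
  assumes "p \<in> carrier (poly_ring V)" "\<And>v. v \<in> V \<Longrightarrow> \<theta> v = param_var v"
  shows "poly_subst \<theta> p = p"
proof -
  have "monom_eval \<theta> t = Poly_Mapping.single t 1" if "t \<in> Poly_Mapping.keys p" for t
  proof -
    have "\<forall>v\<in>Poly_Mapping.keys t. \<theta> v = param_var v"
      using assms that by (auto simp: carrier_poly_ring)
    then have "monom_eval \<theta> t = monom_eval param_var t"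
      unfolding monom_eval_def by (intro prod.cong) auto
    then show ?thesis
      by (simp add: monom_eval_param_var)
  qed
  then show ?thesis
    unfolding poly_subst_def
    using linear_extension_cong[of p "monom_eval \<theta>" "\<lambda>t. Poly_Mapping.single t 1"]
    by (simp add: linear_extension_monomials)
qed

lemma poly_subst_span:
  assumes N: "ring_module.subspace N" and G: "\<And>a. a \<in> G \<Longrightarrow> poly_subst \<theta> a \<in> N"
    and a: "a \<in> ring_module.span G"
  shows "poly_subst \<theta> a \<in> N"
  using a
proof (induction rule: ring_module.span_induct_alt)
  case base
  then show ?case
    using ring_module.subspace_0[OF N] by simp
next
  case (step c x y)
  then show ?case
    using G[of x] ring_module.subspace_add[OF N] ring_module.subspace_scale[OF N]
    by (simp add: poly_subst_add poly_subst_mult)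
qed

text \<open>
  Ideals generated in \<open>K[V]\<close> can be computed in the ring of all parameters, where no carriers have to be
  respected. The reason is that setting the variables outside \<open>V\<close> to zero is a retraction onto \<open>K[V]\<close>.
\<close>

lemma genideal_poly_ring:
  fixes G :: "(('v \<Rightarrow>\<^sub>0 nat) \<Rightarrow>\<^sub>0 'k::field) set"
  assumes G: "G \<subseteq> carrier (poly_ring V)"
  shows "genideal (poly_ring V) G = ring_module.span G \<inter> carrier (poly_ring V)"
proof -
  interpret R: cring "poly_ring V :: (('v \<Rightarrow>\<^sub>0 nat) \<Rightarrow>\<^sub>0 'k) ring"
    by (rule cring_poly_ring)
  note A = is_subringD[OF is_subring_poly_ring[of V]]
  have "ideal (ring_module.span G \<inter> carrier (poly_ring V)) (poly_ring V)"
  proof (rule idealI)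
    show "subgroup (ring_module.span G \<inter> carrier (poly_ring V)) (add_monoid (poly_ring V))"
    proof (rule R.add.subgroupI)
      show "\<ominus>\<^bsub>poly_ring V\<^esub> a \<in> ring_module.span G \<inter> carrier (poly_ring V)"
        if "a \<in> ring_module.span G \<inter> carrier (poly_ring V)" for a
        using that minus_poly_ring[OF A(2), of a] ring_module.span_neg[of a G] A(5)[of a]
        by (simp add: R.minus_eq)
    qed (auto intro: A ring_module.span_add ring_module.span_zero)
  qed (auto intro: A ring_module.span_scale simp: R.ring_axioms, metis mult.commute ring_module.span_scale)
  moreover have "G \<subseteq> ring_module.span G \<inter> carrier (poly_ring V)"
    using G ring_module.span_superset by blast
  ultimately have 1: "genideal (poly_ring V) G \<subseteq> ring_module.span G \<inter> carrier (poly_ring V)"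
    by (rule R.genideal_minimal)
  interpret I: ideal "genideal (poly_ring V) G" "poly_ring V"
    using G by (rule R.genideal_ideal)
  (* applied to a linear combination of G, the retraction moves the coefficients into K[V] *)
  define \<rho> :: "'v \<Rightarrow> ('v \<Rightarrow>\<^sub>0 nat) \<Rightarrow>\<^sub>0 'k" where "\<rho> v = (if v \<in> V then param_var v else 0)" for v
  have \<rho>: "poly_subst \<rho> p \<in> carrier (poly_ring V)" for p
    by (rule poly_subst_carrier[of _ UNIV]) (auto simp: carrier_poly_ring[of UNIV] \<rho>_def A(2) param_var_carrier)
  have "poly_subst \<rho> a \<in> genideal (poly_ring V) G" if "a \<in> ring_module.span G" for a
    using that
  proof (induction rule: ring_module.span_induct_alt)
    case base
    then show ?case
      using I.zero_closed by simp
  next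
    case (step c x y)
    have "poly_subst \<rho> x = x"
      using step(1) G by (intro poly_subst_ident[of _ V]) (auto simp: \<rho>_def)
    moreover have "x \<in> genideal (poly_ring V) G"
      using step(1) R.genideal_self[OF G] by blast
    ultimately have "poly_subst \<rho> c * poly_subst \<rho> x \<in> genideal (poly_ring V) G"
      using I.I_l_closed[OF _ \<rho>[of c]] by simp
    then show ?case
      using step(2) I.a_closed by (simp add: poly_subst_add poly_subst_mult)
  qed
  moreover have "poly_subst \<rho> a = a" if "a \<in> carrier (poly_ring V)" for a
    using that by (rule poly_subst_ident) (simp add: \<rho>_def)
  ultimately show ?thesis
    using 1 by fastforce
qed

lemma poly_subst_hom:
  assumes "\<And>v. v \<in> V \<Longrightarrow> \<theta> v \<in> carrier (poly_ring W)"
  shows "poly_subst \<theta> \<in> ring_hom (poly_ring V) (poly_ring W)"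
  by (rule ring_hom_memI) (simp_all add: poly_subst_carrier[OF _ assms] poly_subst_add poly_subst_mult)

section \<open>Applying a homomorphism to coefficients\<close>

lemma lookup_map_poly:
  assumes "g 0 = 0"
  shows "Poly_Mapping.lookup (Poly_Mapping.map g f) t = g (Poly_Mapping.lookup f t)"
  using assms by (simp add: map.rep_eq when_def)

lemma map_poly_add:
  assumes "g 0 = 0" "\<And>a b. g (a + b) = g a + g b"
  shows "Poly_Mapping.map g (f + h) = Poly_Mapping.map g f + Poly_Mapping.map g h"
  by (intro poly_mapping_eqI) (simp add: lookup_map_poly[of g] assms lookup_add)

lemma map_poly_mult:
  fixes g :: "'r::comm_ring_1 \<Rightarrow> 's::comm_ring_1" and f h :: "'x pterm \<Rightarrow>\<^sub>0 'r"
  assumes g: "g 0 = 0" "\<And>a b. g (a + b) = g a + g b" "\<And>a b. g (a * b) = g a * g b"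
  shows "Poly_Mapping.map g (f * h) = Poly_Mapping.map g f * Poly_Mapping.map g h"
proof (induction f rule: poly_induct)
  have map_0: "Poly_Mapping.map g (0 :: 'x pterm \<Rightarrow>\<^sub>0 'r) = 0"
    by (rule poly_mapping_eqI) (simp add: lookup_map_poly[of g] g)
  case zero
  show ?case by (simp add: map_0)
next
  case (single s c)
  have map_0: "Poly_Mapping.map g (0 :: 'x pterm \<Rightarrow>\<^sub>0 'r) = 0"
    by (rule poly_mapping_eqI) (simp add: lookup_map_poly[of g] g)
  have sg: "Poly_Mapping.map g (Poly_Mapping.single u a) = Poly_Mapping.single u (g a)" for u :: "'x pterm" and a
    by (simp add: g)
  show ?case
    by (induction h rule: poly_induct)
      (simp_all only: map_0 mult_zero_right sg mult_single g(3) distrib_left map_poly_add[OF g(1,2)])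
qed (simp_all only: distrib_right map_poly_add[OF g(1,2)])

section \<open>Comparison of the two marked schemes\<close>

definition generic_tail :: "(nat \<Rightarrow> 'x pterm) \<Rightarrow> nat \<Rightarrow> nat \<Rightarrow> ('x pterm \<Rightarrow>\<^sub>0 'k::field param_poly)" where
  "generic_tail \<sigma> l i = (\<Sum>j\<in>{1..l}. Poly_Mapping.single (\<sigma> j) (param i j))"

locale generic_border = marked_border \<O> \<tau> m tail
  for \<O> :: "'x::{finite,linorder} pterm set" and \<tau> m
    and tail :: "nat \<Rightarrow> 'x pterm \<Rightarrow>\<^sub>0 'k::field param_poly" +
  fixes \<sigma> :: "nat \<Rightarrow> 'x pterm" and l :: nat
  assumes bij_\<sigma>: "bij_betw \<sigma> {1..l} \<O>" and tail_eq: "tail = generic_tail \<sigma> l"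
begin

abbreviation gen :: "nat \<Rightarrow> 'x pterm \<Rightarrow>\<^sub>0 'k param_poly" where
  "gen \<equiv> P.b"

lemma generic_poly_eq: "generic_poly \<sigma> l \<tau> = gen"
  by (rule ext) (simp only: generic_poly_def P.b_def, simp only: tail_eq generic_tail_def)

definition border_gens :: "'k param_poly set" where
  "border_gens = \<Union>{coeff_set (B.nf (S_poly \<tau> gen r s)) |r s.
     r \<in> {1..m} \<and> s \<in> {1..m} \<and> neighbour_couple (\<tau> r) (\<tau> s)}"

definition pommaret_gens :: "'k param_poly set" where
  "pommaret_gens = \<Union>{coeff_set (P.nf (S_poly \<tau> gen r s)) |r s.
     r \<in> P_indices \<and> s \<in> P_indices \<and> nonmult_couple (\<tau> r) (\<tau> s)}"

abbreviation "N\<^sub>B \<equiv> ring_module.span border_gens"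
abbreviation "N\<^sub>P \<equiv> ring_module.span pommaret_gens"
abbreviation "C \<equiv> border_params l m"
abbreviation "C' \<equiv> border_params l m - extra_params \<O> l \<tau> m"

lemma border_ideal_genideal: "border_ideal \<O> \<sigma> l \<tau> m = genideal (poly_ring C) border_gens"
  by (simp only: border_ideal_def border_gens_def Let_def generic_poly_eq B.reduced_form_eq_nf)

lemma pommaret_ideal_genideal: "pommaret_ideal \<O> \<sigma> l \<tau> m = genideal (poly_ring C') pommaret_gens"
  by (simp only: pommaret_ideal_def pommaret_gens_def Let_def generic_poly_eq P.reduced_form_eq_nf)

lemma param_eq: "param i j = param_var (i, j)"
  by (simp add: param_def param_var_def)

lemma generic_tail_coeffs:
  assumes "\<And>j. j \<in> {1..l} \<Longrightarrow> (i, j) \<in> V"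
  shows "tail i \<in> coeffs_in (carrier (poly_ring V) :: 'k param_poly set)"
  unfolding tail_eq generic_tail_def param_eq using assms
  by (intro is_subring_sum[OF is_subring_coeffs_in[OF is_subring_poly_ring]]
      single_in_coeffs[OF is_subring_poly_ring] param_var_carrier)

lemma border_tail_coeffs: "i \<in> {1..m} \<Longrightarrow> tail i \<in> coeffs_in (carrier (poly_ring C) :: 'k param_poly set)"
  by (intro generic_tail_coeffs) (simp add: border_params_def)

lemma pommaret_tail_coeffs: "i \<in> P_indices \<Longrightarrow> tail i \<in> coeffs_in (carrier (poly_ring C') :: 'k param_poly set)"
  using P_indices_subset P_indices_basis[of i]
  by (intro generic_tail_coeffs) (auto simp: border_params_def extra_params_def)

lemma S_poly_coeffs:
  assumes A: "is_subring A" and "tail r \<in> coeffs_in A" "tail s \<in> coeffs_in A"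
  shows "S_poly \<tau> gen r s \<in> coeffs_in A"
  unfolding S_poly_def P.b_def
  by (intro is_subringD(4,6)[OF is_subring_coeffs_in[OF A]] single_in_coeffs[OF A] is_subringD(1)[OF A] assms(2,3))

lemma coeff_set_subset: "f \<in> coeffs_in A \<Longrightarrow> coeff_set f \<subseteq> A"
  by (auto simp: coeffs_in_def coeff_set_def)

lemma border_gens_carrier: "border_gens \<subseteq> carrier (poly_ring C)"
proof -
  have "coeff_set (B.nf (S_poly \<tau> gen r s)) \<subseteq> carrier (poly_ring C)" if "r \<in> {1..m}" "s \<in> {1..m}" for r s
    using that by (intro coeff_set_subset B.nf_coeffs S_poly_coeffs is_subring_poly_ring border_tail_coeffs)
  then show ?thesis
    unfolding border_gens_def by blast
qed

lemma pommaret_gens_carrier: "pommaret_gens \<subseteq> carrier (poly_ring C')"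
proof -
  have "coeff_set (P.nf (S_poly \<tau> gen r s)) \<subseteq> carrier (poly_ring C')" if "r \<in> P_indices" "s \<in> P_indices" for r s
    using that by (intro coeff_set_subset P.nf_coeffs S_poly_coeffs is_subring_poly_ring pommaret_tail_coeffs)
  then show ?thesis
    unfolding pommaret_gens_def by blast
qed

lemma border_criterion: "border_criterion \<O> \<tau> m tail N\<^sub>B"
proof
  show "ring_module.subspace N\<^sub>B"
    by (rule ring_module.subspace_span)
  then show "B.nf (S_poly \<tau> gen r s) \<in> coeffs_in N\<^sub>B"
    if "r \<in> {1..m}" "s \<in> {1..m}" "neighbour_couple (\<tau> r) (\<tau> s)" for r s
    using that ring_module.span_superset[of border_gens]
    by (subst coeffs_in_iff) (auto simp: border_gens_def)
qed

lemma pommaret_criterion: "pommaret_criterion \<O> \<tau> m tail N\<^sub>P"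
proof
  show "ring_module.subspace N\<^sub>P"
    by (rule ring_module.subspace_span)
  then show "P.nf (S_poly \<tau> gen r s) \<in> coeffs_in N\<^sub>P"
    if "r \<in> P_indices" "s \<in> P_indices" "nonmult_couple (\<tau> r) (\<tau> s)" for r s
    using that ring_module.span_superset[of pommaret_gens]
    by (subst coeffs_in_iff) (auto simp: pommaret_gens_def)
qed

lemmas reduced_in_border_ideal = border_criterion.reduced_in_border_ideal[OF border_criterion]
lemmas reduced_in_pommaret_ideal = pommaret_criterion.reduced_in_pommaret_ideal[OF pommaret_criterion]

lemma S_poly_span: "r \<in> I \<Longrightarrow> s \<in> I \<Longrightarrow> S_poly \<tau> gen r s \<in> ring_module.span (gen ` I)"
  unfolding S_poly_def
  by (intro ring_module.span_diff ring_module.span_scale ring_module.span_base imageI)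

lemma border_nf_span:
  assumes "f \<in> ring_module.span (gen ` {1..m})"
  shows "B.nf f \<in> ring_module.span (gen ` {1..m})"
  using ring_module.span_diff[OF assms B.diff_nf_in_span[of f]] by simp

lemma pommaret_nf_span:
  assumes "f \<in> ring_module.span (gen ` P_indices)"
  shows "P.nf f \<in> ring_module.span (gen ` P_indices)"
  using ring_module.span_diff[OF assms P.diff_nf_in_span[of f]] by simp

lemma span_gen_mono: "ring_module.span (gen ` P_indices) \<subseteq> ring_module.span (gen ` {1..m})"
  using P_indices_subset by (intro ring_module.span_mono image_mono)

lemma pommaret_gens_in_border_ideal: "pommaret_gens \<subseteq> N\<^sub>B"
proof -
  have "coeff_set (P.nf (S_poly \<tau> gen r s)) \<subseteq> N\<^sub>B" if "r \<in> P_indices" "s \<in> P_indices" for r s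
    using that span_gen_mono P.keys_nf
    by (intro coeff_set_subset reduced_in_border_ideal subsetD[OF span_gen_mono] pommaret_nf_span S_poly_span)
  then show ?thesis
    unfolding pommaret_gens_def by blast
qed

text \<open>The value which the Pommaret marked set forces upon the parameter with index \<open>(i, j)\<close>.\<close>

definition forced_value :: "nat \<times> nat \<Rightarrow> 'k param_poly" where
  "forced_value v = (if v \<in> C then Poly_Mapping.lookup (P.nf (Poly_Mapping.single (\<tau> (fst v)) 1)) (\<sigma> (snd v))
     else param_var v)"

lemma lookup_generic_tail:
  assumes "j \<in> {1..l}"
  shows "Poly_Mapping.lookup (tail i) (\<sigma> j) = param i j"
proof -
  have "Poly_Mapping.lookup (tail i) (\<sigma> j) =
      (\<Sum>j'\<in>{1..l}. if j' = j then param i j' else 0)"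
    unfolding tail_eq generic_tail_def lookup_sum lookup_single when_def
    using inj_onD[OF bij_betw_imp_inj_on[OF bij_\<sigma>], of _ j] assms by (intro sum.cong) auto
  then show ?thesis
    using assms by simp
qed

lemma nf_pommaret_head:
  assumes "i \<in> P_indices"
  shows "P.nf (Poly_Mapping.single (\<tau> i) 1) = tail i"
proof -
  have "P.nf_term (0 + \<tau> i) = P.nf (Poly_Mapping.single 0 1 * tail i)"
    using assms by (intro P.nf_term_cone) (auto simp: pommaret_mult_def)
  then show ?thesis
    using P.nf_reduced[OF P.keys_tail[OF assms]] by (simp add: P.nf_single)
qed

text \<open>
  The head term of a marked polynomial of the Pommaret set reduces to the tail of this polynomial in one
  step, so its parameters are their own forced values.
\<close>

lemma forced_value_pommaret: "v \<in> C' \<Longrightarrow> forced_value v = param_var v"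
proof -
  assume v: "v \<in> C'"
  obtain i j where ij: "v = (i, j)" by (cases v)
  then have "i \<in> {1..m}" "j \<in> {1..l}" "i \<in> P_indices"
    using v \<tau>_border by (auto simp: border_params_def extra_params_def pommaret_indices_def)
  then show ?thesis
    using v nf_pommaret_head lookup_generic_tail by (simp add: forced_value_def ij param_eq)
qed

lemma forced_value_carrier: "v \<in> C \<Longrightarrow> forced_value v \<in> carrier (poly_ring C')"
proof -
  assume v: "v \<in> C"
  have "P.nf (Poly_Mapping.single (\<tau> (fst v)) 1) \<in> coeffs_in (carrier (poly_ring C') :: 'k param_poly set)"
    by (intro P.nf_coeffs is_subring_poly_ring pommaret_tail_coeffs single_in_coeffs
        is_subringD(1)[OF is_subring_poly_ring])
  then show ?thesis
    using v by (simp add: forced_value_def coeffs_in_def)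
qed

text \<open>
  Subtracting \<open>b\<^sub>i\<close> from the difference between \<open>\<tau>\<^sub>i\<close> and its reduced form leaves the tail of \<open>b\<^sub>i\<close> minus this
  reduced form. This is an \<open>\<O>\<close>-reduced element of the ideal generated by the border marked set.
\<close>

lemma forced_value_border: "param_var v - forced_value v \<in> N\<^sub>B"
proof (cases "v \<in> C")
  case True
  then obtain i j where ij: "v = (i, j)" "i \<in> {1..m}" "j \<in> {1..l}"
    by (auto simp: border_params_def)
  let ?h = "P.nf (Poly_Mapping.single (\<tau> i) 1)"
  have "Poly_Mapping.single (\<tau> i) 1 - ?h \<in> ring_module.span (gen ` {1..m})"
    using P.diff_nf_in_span span_gen_mono by blast
  moreover have "gen i \<in> ring_module.span (gen ` {1..m})"
    using ij(2) by (intro ring_module.span_base imageI)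
  ultimately have "Poly_Mapping.single (\<tau> i) 1 - ?h - gen i \<in> ring_module.span (gen ` {1..m})"
    by (rule ring_module.span_diff)
  then have "tail i - ?h \<in> ring_module.span (gen ` {1..m})"
    by (simp add: P.b_def)
  moreover have "Poly_Mapping.keys (tail i - ?h) \<subseteq> \<O>"
    using keys_minus_subset[of "tail i" ?h] keys_tail[OF ij(2)] P.keys_nf by blast
  ultimately have "tail i - ?h \<in> coeffs_in N\<^sub>B"
    by (rule reduced_in_border_ideal)
  then have "Poly_Mapping.lookup (tail i - ?h) (\<sigma> j) \<in> N\<^sub>B"
    by (simp add: coeffs_in_def)
  then show ?thesis
    using True lookup_generic_tail[OF ij(3), of i] by (simp add: lookup_minus forced_value_def ij(1) param_eq)
next
  case False
  then show ?thesis
    by (simp add: forced_value_def ring_module.span_zero)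
qed

abbreviation "force \<equiv> poly_subst forced_value"

text \<open>
  The forced values are chosen such that the tail of \<open>b\<^sub>i\<close> becomes the reduced form of \<open>\<tau>\<^sub>i\<close> with respect to
  the Pommaret marked set.
\<close>

lemma map_force_gen:
  assumes i: "i \<in> {1..m}"
  shows "Poly_Mapping.map force (gen i) \<in> ring_module.span (gen ` P_indices)"
proof -
  let ?h = "P.nf (Poly_Mapping.single (\<tau> i) 1)"
  have "Poly_Mapping.map force (gen i) = Poly_Mapping.single (\<tau> i) 1 - ?h"
  proof (rule poly_mapping_eqI)
    fix t
    have neg: "force (- a) = - force a" for a
      using poly_subst_add[of forced_value a "- a"] by (simp add: eq_neg_iff_add_eq_0 add.commute)
    have tail: "force (Poly_Mapping.lookup (tail i) t) = Poly_Mapping.lookup ?h t"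
    proof (cases "t \<in> \<O>")
      case True
      then obtain j where j: "j \<in> {1..l}" "t = \<sigma> j"
        using bij_betw_imp_surj_on[OF bij_\<sigma>] by blast
      have "(i, j) \<in> C"
        using i j(1) by (simp add: border_params_def)
      then show ?thesis
        using j(1) by (simp add: j(2) lookup_generic_tail param_eq poly_subst_var forced_value_def)
    next
      case False
      then have "t \<notin> Poly_Mapping.keys (tail i)" "t \<notin> Poly_Mapping.keys ?h"
        using keys_tail[OF i] P.keys_nf by blast+
      then show ?thesis
        by (simp add: in_keys_iff)
    qed
    have "Poly_Mapping.lookup (gen i) t = (1 when \<tau> i = t) + - Poly_Mapping.lookup (tail i) t"
      by (simp add: P.b_def lookup_minus lookup_single)
    moreover have "force (1 when \<tau> i = t) = (1 when \<tau> i = t)"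
      by (simp add: when_def)
    ultimately show "Poly_Mapping.lookup (Poly_Mapping.map force (gen i)) t =
        Poly_Mapping.lookup (Poly_Mapping.single (\<tau> i) 1 - ?h) t"
      by (simp only: lookup_map_poly[of force, OF poly_subst_0] poly_subst_add neg tail lookup_minus lookup_single)
        simp
  qed
  then show ?thesis
    using P.diff_nf_in_span by simp
qed

text \<open>
  By the preceding lemma the substitution maps the ideal generated by the border marked set into the one
  generated by the Pommaret marked set, and it does not enlarge the support of a reduced polynomial.
\<close>

lemma force_border_gens: "a \<in> border_gens \<Longrightarrow> force a \<in> N\<^sub>P"
proof -
  assume "a \<in> border_gens"
  then obtain r s where rs: "r \<in> {1..m}" "s \<in> {1..m}" and a: "a \<in> coeff_set (B.nf (S_poly \<tau> gen r s))"
    unfolding border_gens_def by blast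
  let ?h = "B.nf (S_poly \<tau> gen r s)" and ?m = "Poly_Mapping.map force"
  note hom = poly_subst_0 poly_subst_add poly_subst_mult
  have "?h \<in> ring_module.span (gen ` {1..m})"
    by (intro border_nf_span S_poly_span rs)
  then have "?m ?h \<in> ring_module.span (gen ` P_indices)"
  proof (induction rule: ring_module.span_induct_alt)
    case base
    have "?m (0 :: 'x pterm \<Rightarrow>\<^sub>0 'k param_poly) = 0"
      by (rule poly_mapping_eqI) (simp only: lookup_map_poly[of force, OF poly_subst_0] lookup_zero poly_subst_0)
    then show ?case
      using ring_module.span_zero by simp
  next
    case (step c x y)
    then show ?case
      using map_force_gen
      by (auto simp: map_poly_add[of force, OF hom(1,2)] map_poly_mult[of force, OF hom]
          intro!: ring_module.span_add ring_module.span_scale)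
  qed
  moreover have "Poly_Mapping.keys (?m ?h) \<subseteq> \<O>"
  proof
    fix t assume "t \<in> Poly_Mapping.keys (?m ?h)"
    then have "t \<in> Poly_Mapping.keys ?h"
      by (auto simp: in_keys_iff lookup_map_poly[of force, OF poly_subst_0])
    then show "t \<in> \<O>"
      by (rule subsetD[OF B.keys_nf])
  qed
  ultimately have "?m ?h \<in> coeffs_in N\<^sub>P"
    by (rule reduced_in_pommaret_ideal)
  then show ?thesis
    using a by (auto simp: coeff_set_def coeffs_in_def lookup_map_poly[of force, OF poly_subst_0])
qed

lemma C'_subset: "carrier (poly_ring C') \<subseteq> (carrier (poly_ring C) :: 'k param_poly set)"
  by (auto simp: carrier_poly_ring)

lemma inclusion_hom: "(\<lambda>p. p) \<in> ring_hom (poly_ring C' :: 'k param_poly ring) (poly_ring C)"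
  using C'_subset by (intro ring_hom_memI) auto

lemma marked_schemes_isomorphic:
  fixes \<BB> \<PP> :: "'k param_poly set"
  defines "\<BB> \<equiv> border_ideal \<O> \<sigma> l \<tau> m" and "\<PP> \<equiv> pommaret_ideal \<O> \<sigma> l \<tau> m"
  shows "\<exists>\<psi>. lrs_isomorphism (Spec (poly_ring C Quot \<BB>)) (Spec (poly_ring C' Quot \<PP>)) \<psi> \<and>
    lrs_comp (Spec (poly_ring C Quot \<BB>)) (Spec (poly_ring C)) (Spec (poly_ring C'))
      (Spec_map (poly_ring C') (poly_ring C) (\<lambda>p. p)) (closed_embedding (poly_ring C) \<BB>) =
    lrs_comp (Spec (poly_ring C Quot \<BB>)) (Spec (poly_ring C' Quot \<PP>)) (Spec (poly_ring C'))
      (closed_embedding (poly_ring C') \<PP>) \<psi>"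
proof (rule Spec_quotient_isomorphism[where g = force])
  have B: "\<BB> = N\<^sub>B \<inter> carrier (poly_ring C)" and P: "\<PP> = N\<^sub>P \<inter> carrier (poly_ring C')"
    unfolding \<BB>_def \<PP>_def border_ideal_genideal pommaret_ideal_genideal
    using genideal_poly_ring[OF border_gens_carrier] genideal_poly_ring[OF pommaret_gens_carrier] by simp_all
  show "ideal \<BB> (poly_ring C)" "ideal \<PP> (poly_ring C')"
    unfolding \<BB>_def \<PP>_def border_ideal_genideal pommaret_ideal_genideal
    by (rule ring.genideal_ideal[OF cring.axioms(1)[OF cring_poly_ring] border_gens_carrier],
        rule ring.genideal_ideal[OF cring.axioms(1)[OF cring_poly_ring] pommaret_gens_carrier])
  have force_carrier: "force a \<in> carrier (poly_ring C')" if "a \<in> carrier (poly_ring C)" for a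
    using that forced_value_carrier by (rule poly_subst_carrier)
  show "force \<in> ring_hom (poly_ring C) (poly_ring C')"
    using forced_value_carrier by (rule poly_subst_hom)
  have "N\<^sub>P \<subseteq> N\<^sub>B"
    using pommaret_gens_in_border_ideal by (intro ring_module.span_minimal ring_module.subspace_span)
  then show "(\<lambda>p. p) ` \<PP> \<subseteq> \<BB>"
    using C'_subset unfolding B P by auto
  show "force ` \<BB> \<subseteq> \<PP>"
    using poly_subst_span[OF ring_module.subspace_span force_border_gens] force_carrier
    unfolding B P by blast
  show "force a \<ominus>\<^bsub>poly_ring C'\<^esub> a \<in> \<PP>" if a: "a \<in> carrier (poly_ring C')" for a
  proof -
    have "force a = a"
      using a forced_value_pommaret by (rule poly_subst_ident)
    then show ?thesis
      using a is_subringD(2)[OF is_subring_poly_ring] by (simp add: minus_poly_ring P ring_module.span_zero)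
  qed
  show "force b \<ominus>\<^bsub>poly_ring C\<^esub> b \<in> \<BB>" if b: "b \<in> carrier (poly_ring C)" for b
  proof -
    have "poly_subst param_var b - force b \<in> N\<^sub>B"
      by (rule poly_subst_congruent[OF ring_module.subspace_span forced_value_border])
    moreover have "poly_subst param_var b = b"
      using b by (rule poly_subst_ident) simp
    ultimately have "force b - b \<in> N\<^sub>B"
      using ring_module.span_neg[of "b - force b"] by simp
    moreover have fb: "force b \<in> carrier (poly_ring C)"
      using force_carrier[OF b] C'_subset by blast
    ultimately show ?thesis
      using b is_subringD(6)[OF is_subring_poly_ring fb b] by (simp add: minus_poly_ring B)
  qed
qed (rule cring_poly_ring inclusion_hom)+

end

theorem corollary4p3:
  fixes \<O> :: "'x::{finite,linorder} pterm set"
    and \<sigma> \<tau> :: "nat \<Rightarrow> 'x pterm"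
    and l m :: nat
  assumes "finite \<O>" and "order_ideal \<O>"
    and "bij_betw \<sigma> {1..l} \<O>"
    and "bij_betw \<tau> {1..m} (border \<O>)"
    and "mono_on {1..m} (\<lambda>i. term_deg (\<tau> i))"
  defines "C \<equiv> border_params l m"
    and "C' \<equiv> border_params l m - extra_params \<O> l \<tau> m"
    and "\<BB> \<equiv> (border_ideal \<O> \<sigma> l \<tau> m :: 'k::field param_poly set)"
    and "\<PP> \<equiv> (pommaret_ideal \<O> \<sigma> l \<tau> m :: 'k param_poly set)"
  shows "\<exists>\<pi>. projection_morphism C C' \<pi> \<and>
           (\<exists>\<psi>. lrs_isomorphism (Spec (poly_ring C Quot \<BB>)) (Spec (poly_ring C' Quot \<PP>)) \<psi> \<and>
              lrs_comp (Spec (poly_ring C Quot \<BB>)) (affine_space C) (affine_space C')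
                \<pi> (closed_embedding (poly_ring C) \<BB>) =
              lrs_comp (Spec (poly_ring C Quot \<BB>)) (Spec (poly_ring C' Quot \<PP>)) (affine_space C')
                (closed_embedding (poly_ring C') \<PP>) \<psi>)"
proof -
  have keys_in_order_ideal: "Poly_Mapping.keys (generic_tail \<sigma> l i :: 'x pterm \<Rightarrow>\<^sub>0 'k param_poly) \<subseteq> \<O>" for i
  proof -
    have "Poly_Mapping.keys (generic_tail \<sigma> l i :: 'x pterm \<Rightarrow>\<^sub>0 'k param_poly) \<subseteq>
        (\<Union>j\<in>{1..l}. Poly_Mapping.keys (Poly_Mapping.single (\<sigma> j) (param i j :: 'k param_poly)))"
      unfolding generic_tail_def by (rule keys_sum)
    also have "\<dots> \<subseteq> \<sigma> ` {1..l}"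
      by auto
    finally show ?thesis
      by (simp only: bij_betw_imp_surj_on[OF assms(3)])
  qed
  interpret marked: generic_border \<O> \<tau> m "generic_tail \<sigma> l :: nat \<Rightarrow> 'x pterm \<Rightarrow>\<^sub>0 'k param_poly" \<sigma> l
    using assms(2-5) keys_in_order_ideal by unfold_locales simp_all
  have "cring_hom (poly_ring C' :: 'k param_poly ring) (poly_ring C) (\<lambda>p. p)"
    using marked.inclusion_hom unfolding C_def C'_def by (simp add: cring_hom_def cring_poly_ring)
  then have "projection_morphism C C' (Spec_map (poly_ring C' :: 'k param_poly ring) (poly_ring C) (\<lambda>p. p))"
    by (auto simp: projection_morphism_def affine_space_def C_def C'_def
        dest: cring_hom.lrs_morphism_Spec_map)
  then show ?thesis
    using marked.marked_schemes_isomorphic unfolding C_def C'_def \<BB>_def \<PP>_def affine_space_def by blast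
qed

end
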